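(* Let $p$ be an odd prime. Suppose that $G$ is a finite solvable group that is $\mathcal{U}$-semicritical with respect to $p$. Then $|\pi(G)|\leq 4$, the $p$-length of $G$ is $1$, and one of the following possibilities occurs: (1) $G$ is $\mathcal{U}$-critical (of order divisible by $p$); (2) ${\bf O}_p(G)>1$, and $G={\bf O}_p(G)M$, where ${\bf O}_p(G)$ is a minimal normal subgroup of $G$ and $M$ is a maximal $p'$-subgroup of $G$ that is $\mathcal{U}$-critical; if, in addition, ${\bf O}_{p'}(G)=1$, then $M$ is $\mathcal{A}$-critical, $|G|_p\geq p^2$ and $|\pi(G)|=3$; (3) ${\bf O}_p(G)=1$, and $|G|_p=p$ and $G=PM$, where $P$ is a Sylow $p$-subgroup of $G$ and $M$ is a maximal $p'$-subgroup of $G$ that is not supersolvable (with no claim that $M$ is $\mathcal{U}$-critical).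
   Context: All groups are finite. $\mathcal{U}$ denotes the class of supersolvable groups and $\mathcal{A}$ the class of abelian groups. For a class $\mathcal{X}$ of groups, a group $G$ is $\mathcal{X}$-critical if $G\notin\mathcal{X}$ and every proper subgroup of $G$ belongs to $\mathcal{X}$. For a prime $p$, a group $G$ is called $\mathcal{U}$-semicritical with respect to $p$ if $p$ divides $|G|$, $G$ is not supersolvable, and every proper subgroup of $G$ whose order is divisible by $p$ is supersolvable. $\pi(G)$ is the set of primes dividing $|G|$, and $|G|_p$ is the largest power of $p$ dividing $|G|$. ${\bf O}_p(G)$ is the largest normal $p$-subgroup of $G$, and ${\bf O}_{p'}(G)$ is the largest normal subgroup of $G$ of order not divisible by $p$. A $p'$-subgroup is a subgroup of order not divisible by $p$; "maximal $p'$-subgroup of $G$" means a maximal subgroup of $G$ that is a $p'$-group. The $p$-length of a solvable group $G$ is the number of nontrivial $p$-factors in its upper $p'p$-series $1\leq {\bf O}_{p'}(G)\leq {\bf O}_{p',p}(G)\leq {\bf O}_{p',p,p'}(G)\leq\cdots$. *)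

theory Defs
  imports "HOL-Algebra.Algebra" "HOL-Computational_Algebra.Primes"
begin

text \<open>
  A class of groups is a predicate on group records. The definitions are meaningful for finite
  groups only: for instance \<open>card\<close> and \<open>order\<close> are \<open>0\<close> on infinite carriers. The constant \<open>prime\<close>
  is qualified because \<open>HOL-Algebra.Divisibility\<close> defines another one.
\<close>

text \<open>
  A normal series of the whole group with cyclic factors. The predicate \<open>N \<lhd> G\<close> of the library
  includes that \<open>G\<close> is a group.
\<close>

definition supersolvable :: "('a, 'b) monoid_scheme \<Rightarrow> bool" where
  "supersolvable G \<longleftrightarrow>
     (\<exists>n (N :: nat \<Rightarrow> 'a set).
        N 0 = {\<one>\<^bsub>G\<^esub>} \<and> N n = carrier G \<and>
        (\<forall>i\<le>n. N i \<lhd> G) \<and>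
        (\<forall>i<n. N i \<subseteq> N (Suc i) \<and> cyclic_group ((G\<lparr>carrier := N (Suc i)\<rparr>) Mod N i)))"

definition critical ::
  "(('a, 'b) monoid_scheme \<Rightarrow> bool) \<Rightarrow> ('a, 'b) monoid_scheme \<Rightarrow> bool" where
  "critical C G \<longleftrightarrow>
     group G \<and> \<not> C G \<and>
     (\<forall>H. subgroup H G \<and> H \<noteq> carrier G \<longrightarrow> C (G\<lparr>carrier := H\<rparr>))"

definition U_semicritical :: "nat \<Rightarrow> ('a, 'b) monoid_scheme \<Rightarrow> bool" where
  "U_semicritical p G \<longleftrightarrow>
     group G \<and> p dvd order G \<and> \<not> supersolvable G \<and>
     (\<forall>H. subgroup H G \<and> H \<noteq> carrier G \<and> p dvd card H \<longrightarrow> supersolvable (G\<lparr>carrier := H\<rparr>))"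

definition primes_of :: "('a, 'b) monoid_scheme \<Rightarrow> nat set" where
  "primes_of G = {q. Factorial_Ring.prime q \<and> q dvd order G}"

definition p_part :: "nat \<Rightarrow> ('a, 'b) monoid_scheme \<Rightarrow> nat" where
  "p_part p G = p ^ multiplicity p (order G)"

definition sylow_subgroup :: "nat \<Rightarrow> 'a set \<Rightarrow> ('a, 'b) monoid_scheme \<Rightarrow> bool" where
  "sylow_subgroup p P G \<longleftrightarrow> subgroup P G \<and> card P = p_part p G"

definition maximal_subgroup :: "'a set \<Rightarrow> ('a, 'b) monoid_scheme \<Rightarrow> bool" where
  "maximal_subgroup M G \<longleftrightarrow>
     subgroup M G \<and> M \<noteq> carrier G \<and>
     (\<forall>K. subgroup K G \<and> M \<subseteq> K \<longrightarrow> K = M \<or> K = carrier G)"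

text \<open>A maximal subgroup that is a \<open>p'\<close>-group (not merely maximal among the \<open>p'\<close>-subgroups).\<close>

definition maximal_p'_subgroup :: "nat \<Rightarrow> 'a set \<Rightarrow> ('a, 'b) monoid_scheme \<Rightarrow> bool" where
  "maximal_p'_subgroup p M G \<longleftrightarrow> maximal_subgroup M G \<and> \<not> p dvd card M"

definition minimal_normal :: "'a set \<Rightarrow> ('a, 'b) monoid_scheme \<Rightarrow> bool" where
  "minimal_normal N G \<longleftrightarrow>
     N \<lhd> G \<and> N \<noteq> {\<one>\<^bsub>G\<^esub>} \<and>
     (\<forall>K. K \<lhd> G \<and> K \<subseteq> N \<longrightarrow> K = {\<one>\<^bsub>G\<^esub>} \<or> K = N)"

text \<open>
  \<open>GREATEST\<close> is with respect to set inclusion; \<open>p_core\<close> and \<open>p'_core\<close> below show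
  that the greatest element exists in a finite group.
\<close>

definition p_core :: "nat \<Rightarrow> ('a, 'b) monoid_scheme \<Rightarrow> 'a set" where
  "p_core p G = (GREATEST N. N \<lhd> G \<and> (\<exists>k. card N = p ^ k))"

definition p'_core :: "nat \<Rightarrow> ('a, 'b) monoid_scheme \<Rightarrow> 'a set" where
  "p'_core p G = (GREATEST N. N \<lhd> G \<and> \<not> p dvd card N)"

text \<open>
  The terms of the upper \<open>p'p\<close>-series. Each one is the full preimage in \<open>G\<close> of a core of the
  quotient by the previous one: the \<open>p'\<close>-core at even stages, the \<open>p\<close>-core at odd stages. Thus
  term \<open>1\<close> is \<open>O\<^bsub>p'\<^esub>(G)\<close>, term \<open>2\<close> is \<open>O\<^bsub>p',p\<^esub>(G)\<close>, and the \<open>p\<close>-factors are the quotients of term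
  \<open>Suc i\<close> by term \<open>i\<close> for odd \<open>i\<close>.
\<close>

primrec upper_series :: "nat \<Rightarrow> ('a, 'b) monoid_scheme \<Rightarrow> nat \<Rightarrow> 'a set" where
  "upper_series p G 0 = {\<one>\<^bsub>G\<^esub>}"
| "upper_series p G (Suc i) =
     {x \<in> carrier G. upper_series p G i #>\<^bsub>G\<^esub> x \<in>
        (if even i then p'_core p (G Mod upper_series p G i)
         else p_core p (G Mod upper_series p G i))}"

definition p_length :: "nat \<Rightarrow> ('a, 'b) monoid_scheme \<Rightarrow> nat" where
  "p_length p G = card {i. odd i \<and> upper_series p G (Suc i) \<noteq> upper_series p G i}"

lemma (in group) card_set_mult_dvd:
  assumes fin: "finite (carrier G)" and N: "N \<lhd> G" and K: "subgroup K G"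
  shows "card (N <#> K) dvd card N * card K"
proof -
  interpret second_isomorphism_grp N G K
    using N K by (simp add: second_isomorphism_grp_def second_isomorphism_grp_axioms_def)
  let ?NK = "G\<lparr>carrier := N <#> K\<rparr>" and ?K = "G\<lparr>carrier := K\<rparr>"
  have sub: "N <#> K \<subseteq> carrier G" "K \<subseteq> carrier G"
    using normal_set_mult_subgroup K subgroup.subset by auto
  interpret NK: group ?NK
    using normal_set_mult_subgroup subgroup_imp_group by blast
  interpret K: group ?K
    using K subgroup_imp_group by blast
  have "N \<lhd> ?NK"
    by (simp add: H_contained_in_set_mult N normal_restrict_supergroup normal_set_mult_subgroup)
  then have 1: "card (rcosets\<^bsub>?NK\<^esub> N) * card N = card (N <#> K)"
    using NK.lagrange[of N] by (simp add: normal_imp_subgroup order_def)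
  have NI: "N \<inter> K \<lhd> ?K"
    using normal_subgrp_intersection_normal by (simp add: Int_commute)
  then have 2: "card (rcosets\<^bsub>?K\<^esub> (N \<inter> K)) * card (N \<inter> K) = card K"
    using K.lagrange[of "N \<inter> K"] by (simp add: normal_imp_subgroup order_def)
  have "card (carrier (?K Mod (N \<inter> K))) = card (carrier (?NK Mod N))"
    using normal_intersection_quotient_isom
    by (auto simp: iso_def dest: bij_betw_same_card)
  then have "card (rcosets\<^bsub>?K\<^esub> (N \<inter> K)) = card (rcosets\<^bsub>?NK\<^esub> N)"
    by (simp add: FactGroup_def)
  with 2 have "card (rcosets\<^bsub>?NK\<^esub> N) dvd card K"
    by (metis dvd_triv_left)
  with 1 show ?thesis
    by (metis dvd_refl mult.commute mult_dvd_mono)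
qed

lemma (in group) greatest_normal:
  fixes Q :: "nat \<Rightarrow> bool"
  assumes fin: "finite (carrier G)" and "Q 1"
    and Q: "\<forall>a b c. Q a \<and> Q b \<and> c dvd a * b \<longrightarrow> Q c"
  defines "C \<equiv> (GREATEST N. N \<lhd> G \<and> Q (card N))"
  shows "C \<lhd> G" "Q (card C)" "\<And>N. N \<lhd> G \<Longrightarrow> Q (card N) \<Longrightarrow> N \<subseteq> C"
proof -
  let ?S = "{N. N \<lhd> G \<and> Q (card N)}"
  have "?S \<subseteq> Pow (carrier G)"
    by (auto dest: normal_imp_subgroup subgroup.subset)
  then have "finite ?S"
    using fin finite_subset by blast
  moreover have "{\<one>} \<in> ?S"
    using one_is_normal \<open>Q 1\<close> by simp
  ultimately obtain M where M: "M \<in> ?S" and max: "\<And>N. N \<in> ?S \<Longrightarrow> M \<subseteq> N \<Longrightarrow> M = N"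
    by (metis (lifting) empty_iff finite_has_maximal)
  have ub: "N \<subseteq> M" if N: "N \<lhd> G" "Q (card N)" for N
  proof -
    interpret second_isomorphism_grp M G N
      using M N by (simp add: second_isomorphism_grp_def second_isomorphism_grp_axioms_def
          normal_imp_subgroup)
    have "Q (card (M <#> N))"
      using Q M N card_set_mult_dvd[OF fin, of M N] normal_imp_subgroup by blast
    then have "M <#> N \<in> ?S"
      using M N normal_subgroup_set_mult_closed by simp
    then have "M = M <#> N"
      using max H_contained_in_set_mult by blast
    then show ?thesis
      using S_contained_in_set_mult by blast
  qed
  have "C = M"
    unfolding C_def using M ub by (intro Greatest_equality) auto
  then show "C \<lhd> G" "Q (card C)" "\<And>N. N \<lhd> G \<Longrightarrow> Q (card N) \<Longrightarrow> N \<subseteq> C"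
    using M ub by auto
qed

lemma (in group) p_core:
  assumes fin: "finite (carrier G)" and p: "Factorial_Ring.prime (p :: nat)"
  shows "p_core p G \<lhd> G" "\<exists>k. card (p_core p G) = p ^ k"
    "\<And>N. N \<lhd> G \<Longrightarrow> card N = p ^ k \<Longrightarrow> N \<subseteq> p_core p G"
proof -
  let ?Q = "\<lambda>n. \<exists>k. n = p ^ k"
  have 1: "?Q 1"
    by (metis power_0)
  have mult: "\<forall>a b c. ?Q a \<and> ?Q b \<and> c dvd a * b \<longrightarrow> ?Q c"
    using divides_primepow_nat[OF p] by (metis power_add)
  note * = greatest_normal[where Q = ?Q, OF fin 1 mult]
  show "p_core p G \<lhd> G" "\<exists>k. card (p_core p G) = p ^ k"
    "\<And>N. N \<lhd> G \<Longrightarrow> card N = p ^ k \<Longrightarrow> N \<subseteq> p_core p G"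
    unfolding p_core_def using * by blast+
qed

lemma (in group) p'_core:
  assumes fin: "finite (carrier G)" and p: "Factorial_Ring.prime (p :: nat)"
  shows "p'_core p G \<lhd> G" "\<not> p dvd card (p'_core p G)"
    "\<And>N. N \<lhd> G \<Longrightarrow> \<not> p dvd card N \<Longrightarrow> N \<subseteq> p'_core p G"
proof -
  have 1: "\<not> p dvd 1"
    using p not_prime_unit by blast
  have mult: "\<forall>a b c. \<not> p dvd a \<and> \<not> p dvd b \<and> c dvd a * b \<longrightarrow> \<not> p dvd c"
    using p by (metis dvd_trans prime_dvd_multD)
  note * = greatest_normal[where Q = "\<lambda>n. \<not> p dvd n", OF fin 1 mult]
  show "p'_core p G \<lhd> G" "\<not> p dvd card (p'_core p G)"
    "\<And>N. N \<lhd> G \<Longrightarrow> \<not> p dvd card N \<Longrightarrow> N \<subseteq> p'_core p G"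
    unfolding p'_core_def using * by blast+
qed

end

theory Submission
  imports Defs "HOL-Number_Theory.Residues"
begin

text \<open>
  The proof works inside one ambient finite group. A chief factor \<open>K/L\<close> is a pair of normal
  subgroups, \<open>G\<close> acts on it by conjugation, and \<open>C = C\<^bsub>G\<^esub>(K/L)\<close> is the kernel of this action; equations
  in \<open>K/L\<close> and \<open>G/C\<close> are congruences in \<open>G\<close>.

  A finite group is supersolvable iff its chief factors have prime order, and a group acts on a
  section of prime order \<open>q\<close> by power maps, so that commutators and \<open>(q - 1)\<close>-th powers act trivially.
  An element that acts trivially on the factors of a chain acts trivially on the whole section if
  its order there is prime to that of the section (\<open>stability\<close>). So a supersolvable subgroup that
  covers a chief factor \<open>K/L\<close> of \<open>p\<close>-power order induces on it a group with a normal Sylow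
  \<open>p\<close>-subgroup whose quotient is abelian of exponent dividing \<open>p - 1\<close>. On the other hand
  \<open>O\<^bsub>p\<^esub>(G/C) = 1\<close> (\<open>p_core_mod_centralizer\<close>). Comparing these two facts is the main tool.

  The number of primes. By a theorem of Doerk (\<open>four_ss_supersolvable\<close>), a solvable group with four
  supersolvable subgroups of pairwise coprime indices is supersolvable. For a chief factor of
  \<open>p\<close>-power order three of the indices are prime to \<open>p\<close>; two of these subgroups normalise \<open>C P\<close> for a
  Sylow subgroup \<open>P\<close>, so \<open>C P\<close> is normal and \<open>P \<le> C\<close>; then all three are abelian modulo \<open>C\<close>, which
  makes \<open>G/C\<close> abelian, and eigenvectors of the subgroups show that \<open>K/L\<close> has order \<open>p\<close>. In a solvable
  group each prime divisor \<open>q\<close> of the order has a proper subgroup of \<open>q\<close>-power index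
  (\<open>prime_power_index\<close>). If \<open>G\<close> is semicritical and \<open>q \<noteq> p\<close>, this subgroup is supersolvable, so five
  prime divisors are impossible.

  The critical case. Here a Sylow \<open>p\<close>-subgroup \<open>P\<close> centralises all chief factors of \<open>p\<close>-power order
  (\<open>critical_p_centralises\<close>), and therefore \<open>T P\<close> is normal for some normal \<open>p'\<close>-subgroup \<open>T\<close>
  (\<open>p'_kernel\<close>). This means that the \<open>p\<close>-length is \<open>1\<close> (\<open>p_length_one\<close>).

  The other cases. A maximal subgroup \<open>M\<close> above a proper subgroup that is not supersolvable is a
  \<open>p'\<close>-group, and its index is a prime power, hence \<open>|G|\<^bsub>p\<^esub>\<close>. So \<open>M\<close> is a \<open>p\<close>-complement, and every
  normal subgroup of order divisible by \<open>p\<close> supplements it. If \<open>O\<^bsub>p\<^esub>(G) \<noteq> 1\<close>, then \<open>O\<^bsub>p\<^esub>(G)\<close> is a minimal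
  normal Sylow subgroup, and each proper \<open>K < M\<close> lies in the proper, hence supersolvable, subgroup
  \<open>O\<^bsub>p\<^esub>(G) K\<close>. If moreover \<open>O\<^bsub>p'\<^esub>(G) = 1\<close>, then \<open>M\<close> acts faithfully on \<open>O\<^bsub>p\<^esub>(G)\<close> while commutators of
  \<open>K\<close> act trivially; so \<open>M\<close> is minimal nonabelian, and three subgroups of coprime prime power indices
  bound the number of its prime divisors by \<open>2\<close>. If \<open>O\<^bsub>p\<^esub>(G) = 1\<close>, let \<open>N = O\<^bsub>p'\<^esub>(G)\<close> and let
  \<open>N P/N\<close> be a chief factor of \<open>G\<close>. By the Frattini argument \<open>G = N N\<^bsub>G\<^esub>(P)\<close> with \<open>N\<^bsub>G\<^esub>(P)\<close> proper and
  therefore supersolvable, so \<open>P\<close> contains a normal subgroup \<open>A\<close> of \<open>N\<^bsub>G\<^esub>(P)\<close> of order \<open>p\<close>. Then \<open>N A\<close>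
  is normal in \<open>G\<close> and supplements \<open>M\<close>, which forces \<open>|G|\<^bsub>p\<^esub> = p\<close>.
\<close>

section \<open>Counting\<close>

lemma card_fibres:
  assumes "finite A" "\<And>z. z \<in> f ` A \<Longrightarrow> card {x \<in> A. f x = z} = k"
  shows "card A = card (f ` A) * k"
  using sum.image_gen[OF assms(1), of "\<lambda>_. 1::nat" f] assms(2) by simp

lemma prime_power_eq:
  assumes "Factorial_Ring.prime (p::nat)" "m > 0" "\<And>s. Factorial_Ring.prime s \<Longrightarrow> s dvd m \<Longrightarrow> s = p"
  shows "\<exists>k. m = p ^ k"
proof -
  obtain x where x: "m = p ^ multiplicity p m * x" "\<not> p dvd x"
    using multiplicity_decompose'[of m p] assms by (metis not_prime_unit not_gr_zero)
  have "x = 1"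
  proof (rule ccontr)
    assume "x \<noteq> 1"
    then obtain s where "Factorial_Ring.prime s" "s dvd x"
      using prime_factor_nat by blast
    then show False
      using assms(3)[of s] x by (metis dvd_mult)
  qed
  then show ?thesis using x by auto
qed

lemma not_dvd_cofactor:
  assumes "Factorial_Ring.prime (p::nat)" "n > 0" "n = m * c" "p ^ multiplicity p n dvd c"
  shows "\<not> p dvd m"
proof
  assume "p dvd m"
  then have "p * p ^ multiplicity p n dvd n"
    unfolding assms(3) using assms(4) by (subst (asm) assms(3)) (rule mult_dvd_mono)
  then have "p ^ Suc (multiplicity p n) dvd n" by simp
  then have "Suc (multiplicity p n) \<le> multiplicity p n"
    using assms(1,2) by (intro multiplicity_geI) auto
  then show False by simp
qed

section \<open>Sections of a finite group\<close>

locale fin_group = group G for G (structure) +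
  assumes fin: "finite (carrier G)"
begin

text \<open>Conjugation is written from the left, so that \<open>g \<mapsto> conj_by g\<close> is a homomorphism.\<close>

definition conj_by :: "'a \<Rightarrow> 'a \<Rightarrow> 'a" where
  "conj_by g x = g \<otimes> x \<otimes> inv g"

text \<open>Subgroups \<open>U\<close> of the ambient group stand for groups \<open>G\<lparr>carrier := U\<rparr>\<close>; thus inverses and powers
  do not depend on the group in which they are taken.\<close>

definition normal_sub :: "'a set \<Rightarrow> 'a set \<Rightarrow> bool" where
  "normal_sub A U \<longleftrightarrow> subgroup A G \<and> subgroup U G \<and> A \<subseteq> U \<and> (\<forall>u\<in>U. \<forall>a\<in>A. conj_by u a \<in> A)"

text \<open>The chief factor is \<open>A/B\<close>; the smaller group comes first.\<close>

definition chief :: "'a set \<Rightarrow> 'a set \<Rightarrow> 'a set \<Rightarrow> bool" where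
  "chief U B A \<longleftrightarrow> normal_sub B U \<and> normal_sub A U \<and> B \<subset> A \<and>
     (\<forall>Y. normal_sub Y U \<and> B \<subseteq> Y \<and> Y \<subseteq> A \<longrightarrow> Y = B \<or> Y = A)"

definition cong_mod :: "'a set \<Rightarrow> 'a \<Rightarrow> 'a \<Rightarrow> bool" where
  "cong_mod B x y \<longleftrightarrow> x \<otimes> inv y \<in> B"

definition acts_trivially :: "'a \<Rightarrow> 'a set \<Rightarrow> 'a set \<Rightarrow> bool" where
  "acts_trivially g A B \<longleftrightarrow> (\<forall>a\<in>A. cong_mod B (conj_by g a) a)"

lemma mult_inv_cancel [simp]:
  "x \<in> carrier G \<Longrightarrow> y \<in> carrier G \<Longrightarrow> x \<otimes> (inv x \<otimes> y) = y"
  "x \<in> carrier G \<Longrightarrow> y \<in> carrier G \<Longrightarrow> inv x \<otimes> (x \<otimes> y) = y"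
  by (simp_all add: m_assoc [symmetric])

lemma conj_by_closed [simp, intro]: "g \<in> carrier G \<Longrightarrow> x \<in> carrier G \<Longrightarrow> conj_by g x \<in> carrier G"
  by (simp add: conj_by_def)

lemma conj_by_one [simp]: "x \<in> carrier G \<Longrightarrow> conj_by \<one> x = x" "g \<in> carrier G \<Longrightarrow> conj_by g \<one> = \<one>"
  by (simp_all add: conj_by_def)

lemma conj_by_mult: "g \<in> carrier G \<Longrightarrow> x \<in> carrier G \<Longrightarrow> y \<in> carrier G \<Longrightarrow> conj_by g (x \<otimes> y) = conj_by g x \<otimes> conj_by g y"
  by (simp add: conj_by_def m_assoc)

lemma conj_by_conj_by: "g \<in> carrier G \<Longrightarrow> h \<in> carrier G \<Longrightarrow> x \<in> carrier G \<Longrightarrow> conj_by (g \<otimes> h) x = conj_by g (conj_by h x)"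
  by (simp add: conj_by_def m_assoc inv_mult_group)

lemma conj_by_inv: "g \<in> carrier G \<Longrightarrow> x \<in> carrier G \<Longrightarrow> conj_by g (inv x) = inv (conj_by g x)"
  by (simp add: conj_by_def m_assoc inv_mult_group)

lemma conj_by_pow: "g \<in> carrier G \<Longrightarrow> x \<in> carrier G \<Longrightarrow> conj_by g (x [^] (n::nat)) = conj_by g x [^] n"
  by (induction n) (simp_all add: conj_by_mult)

lemma conj_by_cancel [simp]:
  "g \<in> carrier G \<Longrightarrow> x \<in> carrier G \<Longrightarrow> conj_by (inv g) (conj_by g x) = x"
  "g \<in> carrier G \<Longrightarrow> x \<in> carrier G \<Longrightarrow> conj_by g (conj_by (inv g) x) = x"
  by (simp_all add: conj_by_conj_by [symmetric])

lemma inj_conj_by: "g \<in> carrier G \<Longrightarrow> Y \<subseteq> carrier G \<Longrightarrow> inj_on (conj_by g) Y"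
  by (rule inj_on_inverseI[where g = "conj_by (inv g)"]) (auto simp: conj_by_cancel)

lemma finite_sub: "Y \<subseteq> carrier G \<Longrightarrow> finite Y"
  using fin finite_subset by blast

lemma sub_closed:
  assumes "subgroup H G"
  shows "\<And>x. x \<in> H \<Longrightarrow> x \<in> carrier G" "\<one> \<in> H" "\<And>x y. x \<in> H \<Longrightarrow> y \<in> H \<Longrightarrow> x \<otimes> y \<in> H"
    "\<And>x. x \<in> H \<Longrightarrow> inv x \<in> H" "\<And>x (n::nat). x \<in> H \<Longrightarrow> x [^] n \<in> H"
proof -
  show *: "\<And>x. x \<in> H \<Longrightarrow> x \<in> carrier G" "\<one> \<in> H" "\<And>x y. x \<in> H \<Longrightarrow> y \<in> H \<Longrightarrow> x \<otimes> y \<in> H"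
    "\<And>x. x \<in> H \<Longrightarrow> inv x \<in> H"
    using assms by (auto simp: subgroup_def)
  show "x [^] n \<in> H" if "x \<in> H" for x and n :: nat
    by (induction n) (simp_all add: * that)
qed

lemma sub_conj_by: "subgroup H G \<Longrightarrow> x \<in> H \<Longrightarrow> y \<in> H \<Longrightarrow> conj_by x y \<in> H"
  by (simp add: conj_by_def sub_closed)

lemma sub_finite: "subgroup H G \<Longrightarrow> finite H"
  by (meson finite_sub subgroup.subset)

lemma sub_pos: "subgroup H G \<Longrightarrow> card H > 0"
  using sub_finite[of H] sub_closed(2)[of H] by (auto simp: card_gt_0_iff)

text \<open>In a finite group closure under products suffices, because inverses are powers.\<close>

lemma subgroup_if_closed:
  assumes "H \<subseteq> carrier G" "\<one> \<in> H" "\<And>x y. x \<in> H \<Longrightarrow> y \<in> H \<Longrightarrow> x \<otimes> y \<in> H"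
  shows "subgroup H G"
proof (rule subgroupI)
  fix x assume x: "x \<in> H"
  have pow: "x [^] n \<in> H" for n :: nat
    by (induction n) (simp_all add: assms x)
  have "order G > 0"
    using fin order_gt_0_iff_finite by blast
  then obtain m where m: "order G = Suc m"
    using gr0_conv_Suc by blast
  have "x [^] m \<otimes> x = \<one>"
    using m assms(1) x pow_order_eq_1 by (metis nat_pow_Suc subsetD)
  then have "inv x = x [^] m"
    by (metis assms(1) inv_equality nat_pow_closed subsetD x)
  then show "inv x \<in> H"
    using pow by simp
qed (use assms in auto)

lemma sub_card_dvd:
  assumes "subgroup A G" "subgroup B G" "A \<subseteq> B"
  shows "card A dvd card B"
proof -
  have "subgroup A (G\<lparr>carrier := B\<rparr>)"
    using assms subgroup_incl by blast
  then show ?thesis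
    using group.lagrange[OF subgroup_imp_group[OF assms(2)]] unfolding order_def
    by (metis dvd_triv_right partial_object.select_convs(1) partial_object.surjective
        partial_object.update_convs(1))
qed

lemma sub_card_order: "subgroup A G \<Longrightarrow> card A dvd order G"
  using sub_card_dvd[of A "carrier G"] subgroup_self subgroup.subset[of A G]
  by (simp add: order_def)

lemma sub_Int: "subgroup A G \<Longrightarrow> subgroup B G \<Longrightarrow> subgroup (A \<inter> B) G"
  by (rule subgroups_Inter_pair)

lemma set_mult_iff: "x \<in> A <#> B \<longleftrightarrow> (\<exists>a\<in>A. \<exists>b\<in>B. x = a \<otimes> b)"
  by (auto simp: set_mult_def)

lemma mult_sub_incl:
  assumes "subgroup A G" "subgroup B G"
  shows "A \<subseteq> A <#> B" "B \<subseteq> A <#> B"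
proof -
  note c = sub_closed[OF assms(1)] sub_closed[OF assms(2)]
  have "a \<otimes> \<one> \<in> A <#> B" if "a \<in> A" for a
    using that c unfolding set_mult_iff by blast
  then show "A \<subseteq> A <#> B"
    using c by auto
  have "\<one> \<otimes> b \<in> A <#> B" if "b \<in> B" for b
    using that c unfolding set_mult_iff by blast
  then show "B \<subseteq> A <#> B"
    using c by auto
qed

lemma mult_sub_least:
  "subgroup U G \<Longrightarrow> A \<subseteq> U \<Longrightarrow> B \<subseteq> U \<Longrightarrow> A <#> B \<subseteq> U"
  by (auto simp: set_mult_iff sub_closed(3) subset_iff)

lemma mult_subgroup:
  assumes A: "subgroup A G" and B: "subgroup B G" and nz: "\<And>a b. a \<in> A \<Longrightarrow> b \<in> B \<Longrightarrow> conj_by b a \<in> A"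
  shows "subgroup (A <#> B) G"
proof (rule subgroup_if_closed)
  note c = sub_closed[OF A] sub_closed[OF B]
  show "A <#> B \<subseteq> carrier G"
    using c by (auto simp: set_mult_iff)
  show "\<one> \<in> A <#> B"
    using mult_sub_incl[OF A B] c by blast
  fix x y assume "x \<in> A <#> B" "y \<in> A <#> B"
  then obtain a b a' b' where *: "a \<in> A" "b \<in> B" "a' \<in> A" "b' \<in> B" "x = a \<otimes> b" "y = a' \<otimes> b'"
    by (auto simp: set_mult_iff)
  then have "x \<otimes> y = (a \<otimes> conj_by b a') \<otimes> (b \<otimes> b')"
    using c by (simp add: conj_by_def m_assoc)
  moreover have "a \<otimes> conj_by b a' \<in> A" "b \<otimes> b' \<in> B"
    using * nz sub_closed(3)[OF A] sub_closed(3)[OF B] by simp_all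
  ultimately show "x \<otimes> y \<in> A <#> B"
    unfolding set_mult_iff by blast
qed

lemma card_mult:
  assumes A: "subgroup A G" and B: "subgroup B G"
  shows "card (A <#> B) * card (A \<inter> B) = card A * card B"
proof -
  note c = sub_closed[OF A] sub_closed[OF B]
  let ?f = "\<lambda>(a, b). a \<otimes> b"
  have fib: "card {p \<in> A \<times> B. ?f p = x} = card (A \<inter> B)" if x: "x \<in> A <#> B" for x
  proof -
    obtain a b where ab: "a \<in> A" "b \<in> B" "x = a \<otimes> b"
      using x by (auto simp: set_mult_iff)
    have "bij_betw (\<lambda>d. (a \<otimes> d, inv d \<otimes> b)) (A \<inter> B) {p \<in> A \<times> B. ?f p = x}"
    proof (rule bij_betwI[where g = "\<lambda>p. inv a \<otimes> fst p"])
      show "(\<lambda>d. (a \<otimes> d, inv d \<otimes> b)) \<in> A \<inter> B \<rightarrow> {p \<in> A \<times> B. ?f p = x}"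
        using ab c by (auto simp: m_assoc)
      show "(\<lambda>p. inv a \<otimes> fst p) \<in> {p \<in> A \<times> B. ?f p = x} \<rightarrow> A \<inter> B"
      proof (clarsimp simp: ab c)
        fix a' b' assume *: "a' \<in> A" "b' \<in> B" "a' \<otimes> b' = a \<otimes> b"
        have "inv a \<otimes> a' = inv a \<otimes> (a' \<otimes> b') \<otimes> inv b'"
          using *(1,2) ab(1,2) c by (simp add: m_assoc)
        also have "\<dots> = inv a \<otimes> (a \<otimes> b) \<otimes> inv b'"
          by (simp only: *(3))
        also have "\<dots> = b \<otimes> inv b'"
          using *(1,2) ab(1,2) c by (simp add: m_assoc)
        finally show "inv a \<otimes> a' \<in> B"
          using * ab c by simp
      qed
      show "inv a \<otimes> fst (a \<otimes> d, inv d \<otimes> b) = d" if "d \<in> A \<inter> B" for d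
        using that ab c by simp
      show "(a \<otimes> (inv a \<otimes> fst p), inv (inv a \<otimes> fst p) \<otimes> b) = p"
        if p: "p \<in> {p \<in> A \<times> B. ?f p = x}" for p
      proof -
        obtain a' b' where *: "p = (a', b')" "a' \<in> A" "b' \<in> B" "a' \<otimes> b' = a \<otimes> b"
          using p ab by auto
        have "inv a' \<otimes> (a \<otimes> b) = b'"
          using *(2,3) c by (simp flip: *(4))
        then show ?thesis
          using * ab c by (simp add: inv_mult_group m_assoc)
      qed
    qed
    then show ?thesis
      by (simp add: bij_betw_same_card)
  qed
  have fAB: "finite (A \<times> B)"
    using A B sub_finite by blast
  have "card A * card B = card (A \<times> B)"
    by (simp add: card_cartesian_product)
  also have "\<dots> = (\<Sum>x\<in>A <#> B. card {p \<in> A \<times> B. ?f p = x})"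
  proof -
    have "A <#> B = ?f ` (A \<times> B)"
      unfolding set_mult_def by auto
    then show ?thesis
      using sum.image_gen[OF fAB, of "\<lambda>_. 1::nat" ?f] by simp
  qed
  also have "\<dots> = card (A <#> B) * card (A \<inter> B)"
    using fib by simp
  finally show ?thesis by simp
qed

lemma normal_subD:
  assumes "normal_sub A U"
  shows "subgroup A G" "subgroup U G" "A \<subseteq> U" "\<And>u a. u \<in> U \<Longrightarrow> a \<in> A \<Longrightarrow> conj_by u a \<in> A"
  using assms by (auto simp: normal_sub_def)

lemma normal_sub_iff: "subgroup U G \<Longrightarrow> normal_sub A U \<longleftrightarrow> A \<lhd> G\<lparr>carrier := U\<rparr>"
proof
  assume U: "subgroup U G"
  interpret U: group "G\<lparr>carrier := U\<rparr>"
    using U subgroup_imp_group by blast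
  show "A \<lhd> G\<lparr>carrier := U\<rparr>" if "normal_sub A U"
    using normal_subD[OF that] subgroup_incl
    by (subst U.normal_inv_iff) (simp add: conj_by_def m_inv_consistent)
  show "normal_sub A U" if "A \<lhd> G\<lparr>carrier := U\<rparr>"
  proof -
    have *: "subgroup A (G\<lparr>carrier := U\<rparr>)" "\<forall>x\<in>U. \<forall>h\<in>A. x \<otimes> h \<otimes> inv\<^bsub>G\<lparr>carrier := U\<rparr>\<^esub> x \<in> A"
      using that unfolding U.normal_inv_iff by auto
    have "subgroup A G" "A \<subseteq> U"
      using incl_subgroup[OF U *(1)] subgroup.subset[OF *(1)] by auto
    then show ?thesis
      using *(2) U by (auto simp: normal_sub_def conj_by_def m_inv_consistent)
  qed
qed

lemma normal_sub_carrier: "normal_sub A (carrier G) \<longleftrightarrow> A \<lhd> G"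
  using normal_sub_iff[OF subgroup_self] by simp

lemma normal_sub_self: "subgroup U G \<Longrightarrow> normal_sub U U"
  by (simp add: normal_sub_def sub_conj_by)

lemma normal_sub_one: "subgroup U G \<Longrightarrow> normal_sub {\<one>} U"
  by (auto simp: normal_sub_def triv_subgroup sub_closed)

lemma normal_sub_Int: "normal_sub A U \<Longrightarrow> subgroup V G \<Longrightarrow> V \<subseteq> U \<Longrightarrow> normal_sub (A \<inter> V) V"
  unfolding normal_sub_def by (auto simp: sub_Int sub_conj_by)

lemma normal_sub_restrict: "normal_sub A U \<Longrightarrow> subgroup V G \<Longrightarrow> V \<subseteq> U \<Longrightarrow> A \<subseteq> V \<Longrightarrow> normal_sub A V"
  unfolding normal_sub_def by blast

lemma normal_sub_Int2: "normal_sub A U \<Longrightarrow> normal_sub B U \<Longrightarrow> normal_sub (A \<inter> B) U"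
  unfolding normal_sub_def by (auto simp: sub_Int)

lemma normal_mult_subgroup:
  assumes "normal_sub A U" "subgroup B G" "B \<subseteq> U"
  shows "subgroup (A <#> B) G" "A \<subseteq> A <#> B" "B \<subseteq> A <#> B" "A <#> B \<subseteq> U"
  using assms mult_subgroup[of A B] mult_sub_incl[of A B] mult_sub_least[of U A B]
  by (auto simp: normal_sub_def subset_iff)

lemma normal_sub_mult:
  assumes "normal_sub A U" "normal_sub B U"
  shows "normal_sub (A <#> B) U"
proof -
  note A = normal_subD[OF assms(1)] and B = normal_subD[OF assms(2)]
  note AB = normal_mult_subgroup[OF assms(1) B(1,3)]
  have "conj_by u x \<in> A <#> B" if "u \<in> U" "x \<in> A <#> B" for u x
    using that A(4) B(4) conj_by_mult unfolding set_mult_iff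
    by (metis A(1,2) B(1) sub_closed(1))
  then show ?thesis
    using AB A by (auto simp: normal_sub_def)
qed

lemma chiefD:
  assumes "chief U B A"
  shows "normal_sub B U" "normal_sub A U" "B \<subset> A"
    "\<And>Y. normal_sub Y U \<Longrightarrow> B \<subseteq> Y \<Longrightarrow> Y \<subseteq> A \<Longrightarrow> Y \<noteq> B \<Longrightarrow> Y = A"
  using assms unfolding chief_def by blast+

lemma chief_below:
  assumes "normal_sub B U" "normal_sub A U" "B \<subset> A"
  obtains C where "chief U C A" "B \<subseteq> C"
proof -
  let ?S = "{C. normal_sub C U \<and> B \<subseteq> C \<and> C \<subset> A}"
  have "finite ?S"
    using normal_subD[OF assms(2)] sub_finite by (intro finite_subset[of ?S "Pow A"]) auto
  moreover have "B \<in> ?S" using assms by auto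
  ultimately have "\<exists>C\<in>?S. \<forall>Y\<in>?S. C \<le> Y \<longrightarrow> C = Y"
    by (intro finite_has_maximal) auto
  then obtain C where C: "C \<in> ?S" "\<And>Y. Y \<in> ?S \<Longrightarrow> C \<subseteq> Y \<Longrightarrow> C = Y"
    by auto
  have "Y = C \<or> Y = A" if "normal_sub Y U \<and> C \<subseteq> Y \<and> Y \<subseteq> A" for Y
    using that C(1) C(2)[of Y] by auto
  then have "chief U C A"
    unfolding chief_def using assms(2) C(1) by auto
  then show thesis using that C(1) by simp
qed

lemma chief_above:
  assumes "normal_sub B U" "normal_sub A U" "B \<subset> A"
  obtains C where "chief U B C" "C \<subseteq> A"
proof -
  let ?S = "{C. normal_sub C U \<and> B \<subset> C \<and> C \<subseteq> A}"
  have "finite ?S"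
    using normal_subD[OF assms(2)] sub_finite by (intro finite_subset[of ?S "Pow A"]) auto
  moreover have "A \<in> ?S" using assms by auto
  ultimately have "\<exists>C\<in>?S. \<forall>Y\<in>?S. Y \<le> C \<longrightarrow> C = Y"
    by (intro finite_has_minimal) auto
  then obtain C where C: "C \<in> ?S" "\<And>Y. Y \<in> ?S \<Longrightarrow> Y \<subseteq> C \<Longrightarrow> C = Y"
    by auto
  have "Y = B \<or> Y = C" if "normal_sub Y U \<and> B \<subseteq> Y \<and> Y \<subseteq> C" for Y
    using that C(1) C(2)[of Y] by auto
  then have "chief U B C"
    unfolding chief_def using assms(1) C(1) by auto
  then show thesis using that C(1) by simp
qed

section \<open>Congruence modulo a normal subgroup\<close>

lemma cong_mod_refl: "subgroup B G \<Longrightarrow> x \<in> carrier G \<Longrightarrow> cong_mod B x x"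
  by (simp add: cong_mod_def sub_closed)

lemma cong_mod_sym: "subgroup B G \<Longrightarrow> x \<in> carrier G \<Longrightarrow> y \<in> carrier G \<Longrightarrow> cong_mod B x y \<Longrightarrow> cong_mod B y x"
  unfolding cong_mod_def by (metis inv_closed inv_inv inv_mult_group sub_closed(4))

lemma cong_mod_trans:
  assumes "subgroup B G" "x \<in> carrier G" "y \<in> carrier G" "z \<in> carrier G" "cong_mod B x y" "cong_mod B y z"
  shows "cong_mod B x z"
proof -
  have "x \<otimes> inv z = (x \<otimes> inv y) \<otimes> (y \<otimes> inv z)"
    using assms by (simp add: m_assoc)
  then show ?thesis
    using assms unfolding cong_mod_def by (simp add: sub_closed)
qed

lemma cong_mod_mult:
  assumes "normal_sub B U" "x \<in> U" "x' \<in> U" "y \<in> U" "y' \<in> U" "cong_mod B x x'" "cong_mod B y y'"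
  shows "cong_mod B (x \<otimes> y) (x' \<otimes> y')"
proof -
  note B = normal_subD[OF assms(1)]
  note c = sub_closed[OF B(2)]
  have "x \<otimes> y \<otimes> inv (x' \<otimes> y') = conj_by x (y \<otimes> inv y') \<otimes> (x \<otimes> inv x')"
    using assms(2-5) c by (simp add: conj_by_def m_assoc inv_mult_group)
  then show ?thesis
    using assms B unfolding cong_mod_def by (simp add: sub_closed)
qed

lemma cong_mod_pow:
  assumes "normal_sub B U" "x \<in> U" "x' \<in> U" "cong_mod B x x'"
  shows "cong_mod B (x [^] (n::nat)) (x' [^] n)"
proof (induction n)
  case 0
  then show ?case using assms by (simp add: cong_mod_refl normal_subD)
next
  case (Suc n)
  then show ?case
    using assms cong_mod_mult[of B U "x [^] n" "x' [^] n" x x']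
    by (simp add: normal_subD sub_closed)
qed

lemma cong_mod_conj_by:
  assumes "normal_sub B U" "g \<in> U" "x \<in> carrier G" "y \<in> carrier G" "cong_mod B x y"
  shows "cong_mod B (conj_by g x) (conj_by g y)"
proof -
  have g: "g \<in> carrier G" using sub_closed(1)[OF normal_subD(2)[OF assms(1)] assms(2)] .
  have "conj_by g x \<otimes> inv (conj_by g y) = conj_by g (x \<otimes> inv y)"
    using g assms(3,4) by (simp add: conj_by_mult conj_by_inv)
  then show ?thesis
    using assms normal_subD(4)[OF assms(1)] by (simp add: cong_mod_def)
qed

lemma cong_mod_in:
  assumes "subgroup A G" "B \<subseteq> A" "y \<in> A" "x \<in> carrier G" "cong_mod B x y"
  shows "x \<in> A"
proof -
  have y: "y \<in> carrier G" using assms by (simp add: sub_closed)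
  have "(x \<otimes> inv y) \<otimes> y \<in> A"
    using assms unfolding cong_mod_def by (meson sub_closed(3) subsetD)
  then show ?thesis using y assms(4) by (simp add: m_assoc)
qed

lemma acts_trivially_mult:
  assumes "normal_sub B U" "A \<subseteq> U" "subgroup A G" "g \<in> U" "h \<in> U" "acts_trivially g A B" "acts_trivially h A B"
  shows "acts_trivially (g \<otimes> h) A B"
  unfolding acts_trivially_def
proof
  fix a assume a: "a \<in> A"
  note B = normal_subD[OF assms(1)]
  note c = sub_closed[OF B(2)] sub_closed[OF assms(3)]
  have "cong_mod B (conj_by g (conj_by h a)) (conj_by g a)"
    using cong_mod_conj_by[OF assms(1,4)] assms(5,7) a c unfolding acts_trivially_def by simp
  moreover have "cong_mod B (conj_by g a) a"
    using assms(6) a unfolding acts_trivially_def by simp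
  ultimately show "cong_mod B (conj_by (g \<otimes> h) a) a"
    using a assms(4,5) c cong_mod_trans[OF B(1)]
    by (simp add: conj_by_conj_by) (meson conj_by_closed)
qed

lemma acts_trivially_one: "subgroup B G \<Longrightarrow> subgroup A G \<Longrightarrow> acts_trivially \<one> A B"
  unfolding acts_trivially_def by (simp add: cong_mod_refl sub_closed)

lemma acts_trivially_conj_by:
  assumes "normal_sub B U" "normal_sub A U" "g \<in> U" "h \<in> U" "acts_trivially g A B"
  shows "acts_trivially (conj_by h g) A B"
  unfolding acts_trivially_def
proof
  fix a assume a: "a \<in> A"
  note B = normal_subD[OF assms(1)] and A = normal_subD[OF assms(2)]
  note c = sub_closed[OF B(2)] sub_closed[OF A(1)]
  have h: "inv h \<in> U" "conj_by (inv h) a \<in> A"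
    using assms(4) a A(4) c by auto
  have "cong_mod B (conj_by h (conj_by g (conj_by (inv h) a))) (conj_by h (conj_by (inv h) a))"
    using cong_mod_conj_by[OF assms(1,4)] assms(3,5) h c unfolding acts_trivially_def by simp
  then show "cong_mod B (conj_by (conj_by h g) a) a"
    using a h(1) assms(3,4) c by (simp add: conj_by_conj_by conj_by_def[of h g])
qed

text \<open>\<open>C\<^bsub>G\<^esub>(A/B)\<close>.\<close>

definition centralizer_mod :: "'a set \<Rightarrow> 'a set \<Rightarrow> 'a set" where
  "centralizer_mod A B = {g \<in> carrier G. acts_trivially g A B}"

lemma normal_sub_centralizer:
  assumes B: "normal_sub B (carrier G)" and A: "normal_sub A (carrier G)"
  shows "normal_sub (centralizer_mod A B) (carrier G)"
proof -
  have "subgroup (centralizer_mod A B) G"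
    using B A by (intro subgroup_if_closed)
      (auto simp: centralizer_mod_def acts_trivially_one acts_trivially_mult[OF B] normal_subD)
  then show ?thesis
    using acts_trivially_conj_by[OF B A] subgroup_self
    by (auto simp: normal_sub_def centralizer_mod_def)
qed

text \<open>The set \<open>Y\<close> is arbitrary because the normalizer of a product \<open>C P\<close> is needed before that product
  is known to be normal in anything.\<close>

definition set_normalizer :: "'a set \<Rightarrow> 'a set" where
  "set_normalizer Y = {g \<in> carrier G. conj_by g ` Y = Y}"

lemma set_normalizer_subgroup: "Y \<subseteq> carrier G \<Longrightarrow> subgroup (set_normalizer Y) G"
proof (rule subgroup_if_closed)
  assume Y: "Y \<subseteq> carrier G"
  show "set_normalizer Y \<subseteq> carrier G" by (auto simp: set_normalizer_def)
  have "conj_by \<one> ` Y = id ` Y" using Y by (intro image_cong) auto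
  then have "conj_by \<one> ` Y = Y" by simp
  then show "\<one> \<in> set_normalizer Y" by (simp add: set_normalizer_def)
  fix x y assume *: "x \<in> set_normalizer Y" "y \<in> set_normalizer Y"
  have "conj_by (x \<otimes> y) ` Y = conj_by x ` (conj_by y ` Y)"
    unfolding image_image
    using * Y by (intro image_cong) (auto simp: set_normalizer_def conj_by_conj_by)
  then show "x \<otimes> y \<in> set_normalizer Y" using * by (simp add: set_normalizer_def)
qed

lemma set_normalizer_iff: "Y \<subseteq> carrier G \<Longrightarrow> g \<in> set_normalizer Y \<longleftrightarrow> g \<in> carrier G \<and> (\<forall>x\<in>Y. conj_by g x \<in> Y)"
proof
  assume Y: "Y \<subseteq> carrier G"
  show "g \<in> set_normalizer Y" if g: "g \<in> carrier G \<and> (\<forall>x\<in>Y. conj_by g x \<in> Y)"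
  proof -
    have "conj_by g ` Y \<subseteq> Y" using g by auto
    moreover have "card (conj_by g ` Y) = card Y"
      using g Y inj_conj_by card_image by blast
    ultimately have "conj_by g ` Y = Y"
      using Y finite_sub card_subset_eq by metis
    then show ?thesis using g by (simp add: set_normalizer_def)
  qed
qed (auto simp: set_normalizer_def)

lemma conj_by_image_subgroup:
  assumes "subgroup H G" "g \<in> carrier G"
  shows "subgroup (conj_by g ` H) G" "card (conj_by g ` H) = card H"
proof -
  note c = sub_closed[OF assms(1)]
  show "subgroup (conj_by g ` H) G"
  proof (rule subgroup_if_closed)
    show "conj_by g ` H \<subseteq> carrier G" using c assms by auto
    show "\<one> \<in> conj_by g ` H" using c(2) assms(2) by (simp add: rev_image_eqI)
    fix x y assume "x \<in> conj_by g ` H" "y \<in> conj_by g ` H"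
    then obtain h k where *: "h \<in> H" "k \<in> H" "x = conj_by g h" "y = conj_by g k"
      by blast
    then have "x \<otimes> y = conj_by g (h \<otimes> k)"
      using c assms(2) by (simp add: conj_by_mult)
    then show "x \<otimes> y \<in> conj_by g ` H"
      using c * by blast
  qed
  show "card (conj_by g ` H) = card H"
    by (rule card_image, rule inj_conj_by[OF assms(2) subgroup.subset[OF assms(1)]])
qed

section \<open>Sections of prime order\<close>

lemma cong_mod_iff_coset:
  assumes "subgroup B G" "x \<in> carrier G" "y \<in> carrier G"
  shows "cong_mod B x y \<longleftrightarrow> B #> x = B #> y"
proof
  assume "cong_mod B x y"
  then have "x \<otimes> inv y \<in> B" by (simp add: cong_mod_def)
  then have "B #> (x \<otimes> inv y) = B"
    using assms by (simp add: coset_join2 sub_closed)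
  then show "B #> x = B #> y"
    using assms by (intro coset_mult_inv1) (auto simp: sub_closed)
next
  assume "B #> x = B #> y"
  then have "B #> (x \<otimes> inv y) = B"
    using assms by (intro coset_mult_inv2) (auto simp: sub_closed)
  then show "cong_mod B x y"
    unfolding cong_mod_def using assms by (metis inv_closed m_closed rcos_self)
qed

lemma int_pow_nat:
  assumes "x \<in> carrier G"
  shows "\<exists>j::nat. x [^] (k::int) = x [^] j"
proof -
  have pos: "ord x > 0"
    using assms fin ord_ge_1 by (metis less_eq_Suc_le One_nat_def)
  let ?j = "nat (k mod int (ord x))"
  have "int ?j = k mod int (ord x)"
    using pos by simp
  then have "x [^] k = x [^] (int ?j)"
    by (subst int_pow_eq[OF assms]) (simp add: mod_eq_dvd_iff[symmetric])
  then have "x [^] k = x [^] ?j"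
    by (simp only: int_pow_int)
  then show ?thesis
    by blast
qed

lemma order_mod:
  assumes B: "subgroup B G" and y: "y \<in> carrier G"
  obtains d :: nat where "d > 0" "\<And>j::nat. y [^] j \<in> B \<longleftrightarrow> d dvd j"
proof -
  let ?P = "\<lambda>d::nat. d > 0 \<and> y [^] d \<in> B"
  have "?P (order G)"
    using pow_order_eq_1[OF y] sub_closed(2)[OF B] fin order_gt_0_iff_finite by simp
  then have d: "?P (LEAST d. ?P d)" by (rule LeastI)
  define d where "d = (LEAST d. ?P d)"
  have least: "?P j \<Longrightarrow> d \<le> j" for j
    unfolding d_def by (rule Least_le)
  have dd: "d > 0" "y [^] d \<in> B" using d unfolding d_def by auto
  have mul: "y [^] (d * k) \<in> B" for k
    using dd y sub_closed(5)[OF B] by (simp add: nat_pow_pow[symmetric])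
  have "d dvd j" if "y [^] j \<in> B" for j
  proof -
    have "y [^] (d * (j div d)) \<otimes> y [^] (j mod d) = y [^] j"
      using y by (simp add: nat_pow_mult)
    then have "y [^] (j mod d) = inv (y [^] (d * (j div d))) \<otimes> y [^] j"
      using y by (metis inv_solve_left nat_pow_closed)
    then have "y [^] (j mod d) \<in> B"
      using that mul sub_closed[OF B] by simp
    then have "\<not> j mod d > 0"
      using least[of "j mod d"] mod_less_divisor[OF dd(1), of j] by linarith
    then show ?thesis by auto
  qed
  then show thesis
    using that[OF dd(1)] mul by (metis dvd_def)
qed

text \<open>The preimage \<open>B\<langle>y\<rangle>\<close> of the cyclic subgroup generated by \<open>y\<close> modulo \<open>B\<close>.\<close>

definition adjoin :: "'a set \<Rightarrow> 'a \<Rightarrow> 'a set" where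
  "adjoin B y = {a \<in> carrier G. \<exists>j::nat. cong_mod B a (y [^] j)}"

lemma card_adjoin:
  assumes B: "subgroup B G" and y: "y \<in> carrier G"
    and d: "d > 0" "\<And>j::nat. y [^] j \<in> B \<longleftrightarrow> d dvd j"
  shows "card (adjoin B y) = d * card B"
proof -
  note c = sub_closed[OF B]
  have red: "\<exists>k<d. cong_mod B a (y [^] k)" if a: "a \<in> carrier G" "cong_mod B a (y [^] j)" for a and j :: nat
  proof -
    have eq: "y [^] (d * (j div d)) \<otimes> y [^] (j mod d) = y [^] j"
      using y by (simp add: nat_pow_mult)
    have "y [^] j \<otimes> inv (y [^] (j mod d)) = y [^] (d * (j div d))"
      using y by (simp flip: eq add: m_assoc)
    then have "cong_mod B (y [^] j) (y [^] (j mod d))"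
      unfolding cong_mod_def using d(2) by simp
    then have "cong_mod B a (y [^] (j mod d))"
      using cong_mod_trans[OF B _ _ _ a(2)] a(1) y by simp
    then show ?thesis using mod_less_divisor[OF d(1)] by blast
  qed
  have "bij_betw (\<lambda>(k, b). b \<otimes> y [^] k) ({..<d} \<times> B) (adjoin B y)"
    unfolding bij_betw_def
  proof
    show "inj_on (\<lambda>(k, b). b \<otimes> y [^] k) ({..<d} \<times> B)"
    proof -
      have "k = k' \<and> b = b'"
        if *: "k' \<le> k" "k < d" "b \<in> B" "b' \<in> B" "b \<otimes> y [^] k = b' \<otimes> y [^] k'" for k k' b b'
      proof -
        have "y [^] (k - k') \<otimes> y [^] k' = y [^] k"
          using y *(1) by (simp add: nat_pow_mult)
        then have "b \<otimes> y [^] (k - k') \<otimes> y [^] k' = b' \<otimes> y [^] k'"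
          using * y c by (simp add: m_assoc)
        then have "b \<otimes> y [^] (k - k') = b'"
          using y c(1)[OF *(3)] c(1)[OF *(4)] by (metis m_closed nat_pow_closed right_cancel)
        then have "y [^] (k - k') = inv b \<otimes> b'"
          using y c(1)[OF *(3)] c(1)[OF *(4)] by (metis inv_solve_left nat_pow_closed)
        then have "d dvd k - k'"
          using d(2)[of "k - k'"] c(3)[OF c(4)[OF *(3)] *(4)] by simp
        then have "k = k'"
          using * by (meson dvd_imp_le diff_less_mono2 less_imp_diff_less linorder_not_less
              zero_less_diff le_neq_implies_less)
        then show ?thesis
          using * y c by simp
      qed
      note wlog = this
      show ?thesis
      proof (rule inj_onI)
        fix z z' assume z: "z \<in> {..<d} \<times> B" "z' \<in> {..<d} \<times> B"
          and eq: "(\<lambda>(k, b). b \<otimes> y [^] k) z = (\<lambda>(k, b). b \<otimes> y [^] k) z'"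
        obtain k b k' b' where zz: "z = (k, b)" "z' = (k', b')" by (cases z, cases z')
        then have *: "k < d" "b \<in> B" "k' < d" "b' \<in> B" "b \<otimes> y [^] k = b' \<otimes> y [^] k'"
          using z eq by auto
        have "k = k' \<and> b = b'"
          using wlog[OF _ _ *(2,4,5)] wlog[OF _ _ *(4,2) *(5)[symmetric]] *(1,3)
          by (metis nle_le)
        then show "z = z'" using zz by simp
      qed
    qed
    show "(\<lambda>(k, b). b \<otimes> y [^] k) ` ({..<d} \<times> B) = adjoin B y"
    proof (intro equalityI subsetI)
      fix x assume "x \<in> (\<lambda>(k, b). b \<otimes> y [^] k) ` ({..<d} \<times> B)"
      then obtain z where "z \<in> {..<d} \<times> B" "x = (\<lambda>(k, b). b \<otimes> y [^] k) z" by blast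
      then have "snd z \<in> B \<and> x = snd z \<otimes> y [^] fst z" by (cases z) auto
      then obtain k :: nat and b where *: "b \<in> B" "x = b \<otimes> y [^] k" by blast
      then have "cong_mod B x (y [^] k)"
        unfolding cong_mod_def using y c by (simp add: m_assoc)
      then show "x \<in> adjoin B y"
        using * y c unfolding adjoin_def by auto
    next
      fix x assume "x \<in> adjoin B y"
      then obtain k :: nat where k: "x \<in> carrier G" "k < d" "cong_mod B x (y [^] k)"
        using red unfolding adjoin_def by blast
      then have "x = (x \<otimes> inv (y [^] k)) \<otimes> y [^] k"
        using y by (simp add: m_assoc)
      then show "x \<in> (\<lambda>(k, b). b \<otimes> y [^] k) ` ({..<d} \<times> B)"
        using k unfolding cong_mod_def by force
    qed
  qed
  then show ?thesis
    using bij_betw_same_card[of _ "{..<d} \<times> B" "adjoin B y"] by (auto simp: card_cartesian_product)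
qed

lemma adjoin_subgroup:
  assumes "normal_sub B U" "y \<in> U"
  shows "subgroup (adjoin B y) G" "B \<subseteq> adjoin B y" "y \<in> adjoin B y" "adjoin B y \<subseteq> U"
    "\<And>A. subgroup A G \<Longrightarrow> B \<subseteq> A \<Longrightarrow> y \<in> A \<Longrightarrow> adjoin B y \<subseteq> A"
proof -
  note B = normal_subD[OF assms(1)]
  note c = sub_closed[OF B(2)] sub_closed[OF B(1)]
  show least: "adjoin B y \<subseteq> A" if "subgroup A G" "B \<subseteq> A" "y \<in> A" for A
    using cong_mod_in[OF that(1,2) sub_closed(5)[OF that(1,3)]] by (auto simp: adjoin_def)
  show cU: "adjoin B y \<subseteq> U"
    using least B assms by blast
  have "cong_mod B b (y [^] (0::nat))" if "b \<in> B" for b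
    using that c by (simp add: cong_mod_def)
  then show BC: "B \<subseteq> adjoin B y"
    unfolding adjoin_def using c(6) by blast
  have "cong_mod B y (y [^] (1::nat))"
    using assms(2) c B(1) by (simp add: cong_mod_refl)
  then show "y \<in> adjoin B y"
    unfolding adjoin_def using c(1)[OF assms(2)] by blast
  show "subgroup (adjoin B y) G"
  proof (rule subgroup_if_closed)
    show "adjoin B y \<subseteq> carrier G" by (auto simp: adjoin_def)
    show "\<one> \<in> adjoin B y" using BC c(7) by blast
    fix a a' assume a: "a \<in> adjoin B y" "a' \<in> adjoin B y"
    then obtain i j :: nat where ij: "cong_mod B a (y [^] i)" "cong_mod B a' (y [^] j)"
      unfolding adjoin_def by blast
    have "cong_mod B (a \<otimes> a') (y [^] i \<otimes> y [^] j)"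
      using ij cong_mod_mult[OF assms(1), of a "y [^] i" a' "y [^] j"] a cU assms(2) c(5) by auto
    then have "cong_mod B (a \<otimes> a') (y [^] (i + j))"
      using assms(2) c by (simp add: nat_pow_mult)
    then show "a \<otimes> a' \<in> adjoin B y"
      using a unfolding adjoin_def by blast
  qed
qed

lemma adjoin_normal:
  assumes B: "normal_sub B U" and y: "y \<in> U" and p: "\<And>u. u \<in> U \<Longrightarrow> conj_by u y \<in> adjoin B y"
  shows "normal_sub (adjoin B y) U"
proof -
  note C = adjoin_subgroup[OF B y]
  note BB = normal_subD[OF B]
  note c = sub_closed[OF BB(2)]
  have "conj_by u a \<in> adjoin B y" if u: "u \<in> U" and a: "a \<in> adjoin B y" for u a
  proof -
    obtain j :: nat where j: "cong_mod B a (y [^] j)" "a \<in> carrier G"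
      using a unfolding adjoin_def by blast
    have "cong_mod B (conj_by u a) (conj_by u (y [^] j))"
      using cong_mod_conj_by[OF B u] j y c by blast
    moreover have "conj_by u (y [^] j) \<in> adjoin B y"
      using sub_closed(5)[OF C(1) p[OF u]] u y c by (simp add: conj_by_pow)
    ultimately show ?thesis
      using cong_mod_in[OF C(1,2), of "conj_by u (y [^] j)" "conj_by u a"] j u c by simp
  qed
  then show ?thesis
    using C BB by (auto simp: normal_sub_def)
qed

text \<open>A cyclic chief factor has prime order: the powers of a generator \<open>y\<close> with exponent a prime
  divisor of its order generate a smaller normal subgroup.\<close>

lemma chief_cyclic_prime:
  assumes ch: "chief U B A" and y: "y \<in> A" and A: "A \<subseteq> adjoin B y"
  obtains q where "Factorial_Ring.prime (q::nat)" "card A = q * card B"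
proof -
  note ch = chiefD[OF ch]
  note NB = normal_subD[OF ch(1)] and NA = normal_subD[OF ch(2)]
  note c = sub_closed[OF NA(1)]
  note cU = sub_closed[OF NA(2)]
  have yU: "y \<in> U" using y NA by blast
  then have yG: "y \<in> carrier G" using cU by simp
  have Aeq: "A = adjoin B y"
    using A adjoin_subgroup(5)[OF ch(1) yU NA(1)] ch(3) y by blast
  obtain d :: nat where d: "d > 0" "\<And>j::nat. y [^] j \<in> B \<longleftrightarrow> d dvd j"
    using order_mod[OF NB(1) yG] by blast
  have card: "card A = d * card B"
    unfolding Aeq by (rule card_adjoin[OF NB(1) yG d])
  have "d \<noteq> 1"
    using card ch(3) card_subset_eq[of A B] sub_finite[OF NA(1)] by auto
  then obtain q where q: "Factorial_Ring.prime q" "q dvd d"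
    using prime_factor_nat by blast
  let ?Y = "adjoin B (y [^] q)"
  have yq: "y [^] q \<in> A" "y [^] q \<in> U" using c y NA by auto
  note Y = adjoin_subgroup[OF ch(1) yq(2)]
  have "normal_sub ?Y U"
  proof (rule adjoin_normal[OF ch(1) yq(2)])
    fix u assume u: "u \<in> U"
    have "conj_by u y \<in> A" using u y NA by blast
    then obtain k :: nat where k: "cong_mod B (conj_by u y) (y [^] k)"
      using A unfolding adjoin_def by blast
    have "cong_mod B (conj_by u y [^] q) ((y [^] k) [^] q)"
      by (rule cong_mod_pow[OF ch(1) _ _ k]) (use u yU cU(5) \<open>conj_by u y \<in> A\<close> NA(3) in auto)
    then have "cong_mod B (conj_by u (y [^] q)) ((y [^] q) [^] k)"
      using u yG cU by (simp add: conj_by_pow nat_pow_pow mult.commute)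
    then show "conj_by u (y [^] q) \<in> ?Y"
      unfolding adjoin_def using u yG cU by auto
  qed
  then have "?Y = B \<or> ?Y = A"
    using ch(4) Y(2) Y(5)[OF NA(1)] ch(3) yq by blast
  then show thesis
  proof
    assume "?Y = B"
    then have "d dvd q"
      using Y(3) d(2) by simp
    then have "d = q"
      using q \<open>d \<noteq> 1\<close> by (metis prime_nat_iff)
    then show thesis using that q card by blast
  next
    assume "?Y = A"
    then obtain j :: nat where "cong_mod B y ((y [^] q) [^] j)"
      using y unfolding adjoin_def by blast
    then have j: "cong_mod B y (y [^] (q * j))"
      using yG by (simp add: nat_pow_pow)
    have "q * j \<noteq> 0"
    proof
      assume "q * j = 0"
      then have "y [^] (1::nat) \<in> B"
        using j yG by (auto simp: cong_mod_def)
      then show False using d(2)[of 1] \<open>d \<noteq> 1\<close> by simp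
    qed
    then obtain i where i: "q * j = Suc i"
      using not0_implies_Suc by blast
    have "y \<otimes> inv (y [^] (Suc i)) = inv (y [^] i)"
      using yG by (simp add: inv_mult_group m_assoc[symmetric])
    then have "inv (inv (y [^] i)) \<in> B"
      using j i sub_closed(4)[OF NB(1)] unfolding cong_mod_def by metis
    then have "d dvd i"
      using d(2) yG by simp
    then have "q dvd i" "q dvd Suc i"
      using q dvd_trans i by (blast, metis dvd_triv_left)
    then have "q dvd 1"
      by (metis Suc_eq_plus1 dvd_add_right_iff)
    then show thesis using q by simp
  qed
qed

text \<open>A section of prime order is generated by any element outside the bottom.\<close>

lemma prime_factor_adjoin:
  assumes B: "normal_sub B U" and A: "subgroup A G" "B \<subseteq> A" "A \<subseteq> U"
    and q: "Factorial_Ring.prime (q::nat)" "card A = q * card B" and y: "y \<in> A" "y \<notin> B"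
  shows "A = adjoin B y" "y [^] q \<in> B" "\<And>j::nat. y [^] j \<in> B \<longleftrightarrow> q dvd j"
proof -
  note NB = normal_subD[OF B]
  have yU: "y \<in> U" using y A by blast
  then have yG: "y \<in> carrier G" using NB sub_closed by blast
  note C = adjoin_subgroup[OF B yU]
  obtain d :: nat where d: "d > 0" "\<And>j::nat. y [^] j \<in> B \<longleftrightarrow> d dvd j"
    using order_mod[OF NB(1) yG] by blast
  have card: "card (adjoin B y) = d * card B"
    by (rule card_adjoin[OF NB(1) yG d])
  have "card (adjoin B y) dvd card A"
    using sub_card_dvd[OF C(1) A(1)] C(5)[OF A(1,2) y(1)] .
  then have "d dvd q"
    using card q(2) sub_pos[OF NB(1)] by simp
  moreover have "d \<noteq> 1"
    using d(2)[of 1] y yG by auto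
  ultimately have dq: "d = q"
    using q(1) by (metis prime_nat_iff)
  show "A = adjoin B y"
    using card_subset_eq[OF sub_finite[OF A(1)] C(5)[OF A(1,2) y(1)]] card dq q(2) by simp
  show "\<And>j::nat. y [^] j \<in> B \<longleftrightarrow> q dvd j" "y [^] q \<in> B" using d dq by auto
qed

text \<open>A group acts on a normal section of prime order by power maps, since the section is cyclic.\<close>

lemma prime_factor_power:
  assumes B: "normal_sub B U" and A: "normal_sub A U" "B \<subset> A"
    and q: "Factorial_Ring.prime (q::nat)" "card A = q * card B"
    and u: "u \<in> U"
  obtains k :: nat where "\<And>a. a \<in> A \<Longrightarrow> cong_mod B (conj_by u a) (a [^] k)" "\<not> q dvd k"
    "\<And>a j. a \<in> A \<Longrightarrow> q dvd j \<Longrightarrow> a [^] j \<in> B"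
proof -
  note NB = normal_subD[OF B] and NA = normal_subD[OF A(1)]
  note cA = sub_closed[OF NA(1)] and cU = sub_closed[OF NA(2)]
  obtain y where y: "y \<in> A" "y \<notin> B" using A(2) by blast
  note P = prime_factor_adjoin[OF B NA(1) _ NA(3) q y]
  have Aeq: "A = adjoin B y" and yq: "y [^] q \<in> B" using P A(2) by auto
  have "conj_by u y \<in> adjoin B y" using u y NA Aeq by blast
  then obtain k :: nat where k: "cong_mod B (conj_by u y) (y [^] k)"
    unfolding adjoin_def by blast
  have main: "cong_mod B (conj_by u a) (a [^] k)" if a: "a \<in> A" for a
  proof -
    obtain j :: nat where j: "cong_mod B a (y [^] j)" using a Aeq unfolding adjoin_def by blast
    have mem: "a \<in> U" "y \<in> U" "y [^] j \<in> U" "conj_by u y \<in> U" "y [^] k \<in> U" "a [^] k \<in> U" "conj_by u a \<in> U"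
      "conj_by u (y [^] j) \<in> U"
      using a y u NA(3,4) cU cA(5) by (auto simp: subset_iff)
    have 1: "cong_mod B (conj_by u a) (conj_by u (y [^] j))"
      by (rule cong_mod_conj_by[OF B u _ _ j]) (use mem cU(1) in auto)
    have "cong_mod B (conj_by u y [^] j) ((y [^] k) [^] j)"
      using cong_mod_pow[OF B _ _ k] mem by blast
    then have 2: "cong_mod B (conj_by u (y [^] j)) ((y [^] j) [^] k)"
      using mem u cU by (simp add: conj_by_pow nat_pow_pow mult.commute)
    have 3: "cong_mod B ((y [^] j) [^] k) (a [^] k)"
      by (rule cong_mod_pow[OF B mem(3,1) cong_mod_sym[OF NB(1) _ _ j]]) (use mem cU(1) in auto)
    show ?thesis
      by (rule cong_mod_trans[OF NB(1) _ _ _ 1 cong_mod_trans[OF NB(1) _ _ _ 2 3]]) (use mem cU in auto)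
  qed
  have pw: "a [^] j \<in> B" if a: "a \<in> A" "q dvd j" for a j
  proof (cases "a \<in> B")
    case True
    then show ?thesis using sub_closed(5)[OF NB(1)] by blast
  next
    case False
    then show ?thesis
      using prime_factor_adjoin(3)[OF B NA(1) _ NA(3) q a(1) False] A(2) a by auto
  qed
  have "\<not> q dvd k"
  proof
    assume "q dvd k"
    then have "y [^] k \<in> B" using pw y by blast
    then have "conj_by u y \<in> B"
      using cong_mod_in[OF NB(1) _ _ _ k] y u cA(1) cU(1) by auto
    then have "conj_by (inv u) (conj_by u y) \<in> B"
      using NB(4) cU(4)[OF u] by simp
    then show False using y u cA cU by simp
  qed
  then show thesis using that main pw by blast
qed

text \<open>Power maps commute.\<close>

lemma prime_factor_comm:
  assumes B: "normal_sub B U" and A: "normal_sub A U" "B \<subset> A"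
    and q: "Factorial_Ring.prime (q::nat)" "card A = q * card B"
    and u: "u \<in> U" and v: "v \<in> U"
  shows "acts_trivially (u \<otimes> v \<otimes> inv (v \<otimes> u)) A B"
  unfolding acts_trivially_def
proof
  fix a' assume a': "a' \<in> A"
  note NB = normal_subD[OF B] and NA = normal_subD[OF A(1)]
  note cA = sub_closed[OF NA(1)] and cU = sub_closed[OF NA(2)]
  obtain k :: nat where k: "\<And>a. a \<in> A \<Longrightarrow> cong_mod B (conj_by u a) (a [^] k)"
    using prime_factor_power[OF B A q u] by metis
  obtain l :: nat where l: "\<And>a. a \<in> A \<Longrightarrow> cong_mod B (conj_by v a) (a [^] l)"
    using prime_factor_power[OF B A q v] by metis
  define a where "a = conj_by (inv (v \<otimes> u)) a'"
  have a: "a \<in> A" using a' u v NA cU unfolding a_def by auto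
  note mem = NA(4)[OF u a] NA(4)[OF v a] NA(4)[OF u NA(4)[OF v a]] NA(4)[OF v NA(4)[OF u a]]
    cA(5)[OF a] cA(5)[OF cA(5)[OF a]] cA(5)[OF NA(4)[OF v a]] cA(5)[OF NA(4)[OF u a]]
  have pp: "(a [^] k) [^] l = (a [^] l) [^] k" using a cA by (simp add: nat_pow_pow mult.commute)
  have 1: "cong_mod B (conj_by u (conj_by v a)) ((a [^] l) [^] k)"
    by (rule cong_mod_trans[OF NB(1) _ _ _ k[OF NA(4)[OF v a]] cong_mod_pow[OF B _ _ l[OF a]]])
      (use mem cA(1) NA(3) in auto)
  have 2: "cong_mod B (conj_by v (conj_by u a)) ((a [^] k) [^] l)"
    by (rule cong_mod_trans[OF NB(1) _ _ _ l[OF NA(4)[OF u a]] cong_mod_pow[OF B _ _ k[OF a]]])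
      (use mem cA(1) NA(3) in auto)
  have "cong_mod B (conj_by u (conj_by v a)) (conj_by v (conj_by u a))"
    by (rule cong_mod_trans[OF NB(1) _ _ _ 1 cong_mod_sym[OF NB(1) _ _ 2[unfolded pp]]])
      (use mem cA(1) in auto)
  moreover have "conj_by v (conj_by u a) = a'"
    unfolding a_def using u v a' cU(1,3,4) cA(1)
    by (simp add: conj_by_conj_by[symmetric] m_assoc inv_mult_group)
  moreover have "conj_by u (conj_by v a) = conj_by (u \<otimes> v \<otimes> inv (v \<otimes> u)) a'"
    unfolding a_def using u v a' cU(1,3,4) cA(1) by (simp add: conj_by_conj_by)
  ultimately show "cong_mod B (conj_by (u \<otimes> v \<otimes> inv (v \<otimes> u)) a') a'" by simp
qed

text \<open>By Fermat's theorem the \<open>(q - 1)\<close>-th power of a power map on a group of order \<open>q\<close> is trivial.\<close>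

lemma prime_factor_exp:
  assumes B: "normal_sub B U" and A: "normal_sub A U" "B \<subset> A"
    and q: "Factorial_Ring.prime (q::nat)" "card A = q * card B"
    and u: "u \<in> U"
  shows "acts_trivially (u [^] (q - 1)) A B"
  unfolding acts_trivially_def
proof
  fix a assume a: "a \<in> A"
  note NB = normal_subD[OF B] and NA = normal_subD[OF A(1)]
  note cA = sub_closed[OF NA(1)] and cU = sub_closed[OF NA(2)]
  obtain k :: nat where k: "\<And>a. a \<in> A \<Longrightarrow> cong_mod B (conj_by u a) (a [^] k)" "\<not> q dvd k"
    "\<And>a j. a \<in> A \<Longrightarrow> q dvd j \<Longrightarrow> a [^] j \<in> B"
    using prime_factor_power[OF B A q u] by metis
  have *: "cong_mod B (conj_by (u [^] n) a) (a [^] (k ^ n))" for n :: nat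
  proof (induction n)
    case 0
    then show ?case using a cA NB by (simp add: cong_mod_refl)
  next
    case (Suc n)
    let ?b = "conj_by (u [^] n) a"
    have b: "?b \<in> A" using a NA(4)[OF cU(5)[OF u]] by simp
    have 1: "cong_mod B (conj_by u ?b) (?b [^] k)" using k(1)[OF b] .
    have 2: "cong_mod B (?b [^] k) ((a [^] (k ^ n)) [^] k)"
      using cong_mod_pow[OF B _ _ Suc.IH] b a cA(5) NA(3) by auto
    have "cong_mod B (conj_by u ?b) ((a [^] (k ^ n)) [^] k)"
      using cong_mod_trans[OF NB(1) _ _ _ 1 2] NA(4)[OF u b] b a cA(1,5) by auto
    moreover have "conj_by u ?b = conj_by (u [^] Suc n) a"
      using u a cU cA by (subst nat_pow_Suc2) (auto simp: conj_by_conj_by)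
    ultimately show ?case
      using a cA by (simp add: nat_pow_pow mult.commute)
  qed
  have "[k ^ (q - 1) = 1] (mod q)"
    using fermat_theorem q k by blast
  moreover have "k ^ (q - 1) \<ge> 1"
    using k(2) by (cases "k = 0") auto
  ultimately have "q dvd k ^ (q - 1) - 1"
    using cong_altdef_nat cong_sym by blast
  then have "a [^] (k ^ (q - 1) - 1) \<in> B" using k(3) a by blast
  moreover have "a [^] (k ^ (q - 1) - 1) = a [^] (k ^ (q - 1)) \<otimes> inv a"
  proof -
    have "a [^] (k ^ (q - 1)) = a [^] (k ^ (q - 1) - 1) \<otimes> a"
      using \<open>k ^ (q - 1) \<ge> 1\<close> by (metis le_add_diff_inverse2 Suc_eq_plus1 nat_pow_Suc)
    then show ?thesis using a cA by (simp add: m_assoc)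
  qed
  ultimately have "cong_mod B (a [^] (k ^ (q - 1))) a" by (simp add: cong_mod_def)
  then show "cong_mod B (conj_by (u [^] (q - 1)) a) a"
    using cong_mod_trans[OF NB(1) _ _ _ *[of "q - 1"]] a u cA(1,5) cU(1,5) by auto
qed

section \<open>Supersolvability and chief factors\<close>

text \<open>The series of the definition with its cyclic factors expressed by generators. Natural exponents
  suffice in a finite group.\<close>

lemma supersolvableE:
  assumes U: "subgroup U G" and ss: "supersolvable (G\<lparr>carrier := U\<rparr>)"
  obtains n and N :: "nat \<Rightarrow> 'a set" where "N 0 = {\<one>}" "N n = U"
    "\<And>i. i \<le> n \<Longrightarrow> normal_sub (N i) U" "\<And>i. i < n \<Longrightarrow> N i \<subseteq> N (Suc i)"
    "\<And>i. i < n \<Longrightarrow> \<exists>c\<in>N (Suc i). \<forall>y\<in>N (Suc i). \<exists>j::nat. cong_mod (N i) y (c [^] j)"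
proof -
  obtain n N where N: "N 0 = {\<one>}" "N n = U" "\<forall>i\<le>n. N i \<lhd> G\<lparr>carrier := U\<rparr>"
    and cy: "\<forall>i<n. N i \<subseteq> N (Suc i) \<and> cyclic_group (G\<lparr>carrier := N (Suc i)\<rparr> Mod N i)"
    using ss unfolding supersolvable_def by auto
  have nor: "normal_sub (N i) U" if "i \<le> n" for i
    using N(3) that normal_sub_iff[OF U] by blast
  have "\<exists>c\<in>N (Suc i). \<forall>y\<in>N (Suc i). \<exists>j::nat. cong_mod (N i) y (c [^] j)" if i: "i < n" for i
  proof -
    let ?H = "G\<lparr>carrier := N (Suc i)\<rparr>"
    note S = normal_subD[OF nor, of "Suc i"] and T = normal_subD[OF nor, of i]
    have sub: "subgroup (N (Suc i)) G" "subgroup (N i) G" using S T i by auto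
    have "normal_sub (N i) (N (Suc i))"
      using normal_sub_restrict[OF nor[of i] sub(1)] S(3) cy i by auto
    then interpret N: normal "N i" ?H
      using normal_sub_iff[OF sub(1)] by blast
    interpret F: group "?H Mod N i"
      by (rule N.factorgroup_is_group)
    obtain C where C: "C \<in> carrier (?H Mod N i)" "carrier (?H Mod N i) = range (\<lambda>k::int. C [^]\<^bsub>?H Mod N i\<^esub> k)"
      using cy i F.cyclic_group by blast
    then obtain c where c: "c \<in> N (Suc i)" "C = N i #>\<^bsub>?H\<^esub> c"
      by (auto simp: FactGroup_def RCOSETS_def)
    have "\<exists>j::nat. cong_mod (N i) y (c [^] j)" if y: "y \<in> N (Suc i)" for y
    proof -
      have "N i #>\<^bsub>?H\<^esub> y \<in> carrier (?H Mod N i)"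
        using y by (auto simp: FactGroup_def RCOSETS_def)
      then obtain k :: int where "N i #>\<^bsub>?H\<^esub> y = C [^]\<^bsub>?H Mod N i\<^esub> k"
        using C(2) by blast
      then have "N i #>\<^bsub>?H\<^esub> y = N i #>\<^bsub>?H\<^esub> (c [^]\<^bsub>?H\<^esub> k)"
        using c N.FactGroup_int_pow[of c k] by simp
      then have "N i #> y = N i #> (c [^] k)"
        using int_pow_consistent[OF sub(1) c(1)] by (simp add: r_coset_def)
      then have "cong_mod (N i) y (c [^] k)"
        using y c sub_closed[OF sub(1)] by (subst cong_mod_iff_coset[OF sub(2)]) auto
      then show ?thesis
        using int_pow_nat[of c k] c sub_closed(1)[OF sub(1)] by metis
    qed
    then show ?thesis using c by blast
  qed
  then show thesis using that[of N n] N cy nor by blast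
qed

text \<open>Let \<open>i\<close> be the first index such that \<open>N i \<inter> A\<close> is not contained in \<open>B\<close>. Since \<open>A/B\<close> is a
  chief factor, \<open>A/B\<close> is a quotient of \<open>(N i \<inter> A)/(N (i - 1) \<inter> A)\<close>, hence cyclic.\<close>

lemma supersolvable_chief_prime:
  assumes U: "subgroup U G" and ss: "supersolvable (G\<lparr>carrier := U\<rparr>)"
    and V: "subgroup V G" "V \<subseteq> U" and ch: "chief V B A"
  obtains q where "Factorial_Ring.prime (q::nat)" "card A = q * card B"
proof -
  obtain n and N :: "nat \<Rightarrow> 'a set" where N: "N 0 = {\<one>}" "N n = U"
    "\<And>i. i \<le> n \<Longrightarrow> normal_sub (N i) U" "\<And>i. i < n \<Longrightarrow> N i \<subseteq> N (Suc i)"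
    "\<And>i. i < n \<Longrightarrow> \<exists>c\<in>N (Suc i). \<forall>y\<in>N (Suc i). \<exists>j::nat. cong_mod (N i) y (c [^] j)"
    using supersolvableE[OF U ss] by metis
  note chD = chiefD[OF ch]
  note NB = normal_subD[OF chD(1)] and NA = normal_subD[OF chD(2)]
  let ?Q = "\<lambda>i. \<not> N i \<inter> A \<subseteq> B"
  have "?Q n"
    using N(2) chD(3) NA(3) V(2) by blast
  then obtain m where m: "?Q m" "\<And>i. i < m \<Longrightarrow> \<not> ?Q i" "m \<le> n"
    using exists_least_iff[of ?Q] by (metis not_le)
  have "m \<noteq> 0"
    using m(1) N(1) sub_closed(2)[OF NB(1)] by (cases m) auto
  then obtain i where i: "m = Suc i" using not0_implies_Suc by blast
  have iN: "N i \<inter> A \<subseteq> B" "i < n" "normal_sub (N i) U" "normal_sub (N m) U"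
    using m i N(3) by auto
  let ?Y = "N m \<inter> A"
  have Y: "normal_sub ?Y V"
    using normal_sub_Int2[OF normal_sub_Int[OF iN(4) V] chD(2)] NA(3)
    by (metis Int_absorb1 Int_assoc Int_commute)
  note NY = normal_subD[OF Y] and NI = normal_subD[OF iN(3)] and NM = normal_subD[OF iN(4)]
  obtain c where c: "c \<in> N m" "\<forall>y\<in>N m. \<exists>j::nat. cong_mod (N i) y (c [^] j)"
    using N(5)[OF iN(2)] i by blast
  have cU: "c \<in> U" using c NM(3) by blast
  have cG: "c \<in> carrier G" using sub_closed(1)[OF U cU] .
  have YU: "?Y \<subseteq> U" using NM by blast
  note D = normal_mult_subgroup[OF iN(3) NY(1) YU]
  obtain d :: nat where d: "d > 0" "\<And>j::nat. c [^] j \<in> N i <#> ?Y \<longleftrightarrow> d dvd j"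
    using order_mod[OF D(1) cG] by blast
  then obtain h y where hy: "h \<in> N i" "y \<in> ?Y" "c [^] d = h \<otimes> y"
    using set_mult_iff[of "c [^] d" "N i" ?Y] by (metis dvd_refl)
  have hyG: "h \<in> carrier G" "y \<in> carrier G"
    using hy sub_closed(1) NI(1) NY(1) by blast+
  have yU: "y \<in> U" using hy YU by blast
  have cd: "cong_mod (N i) (c [^] d) y"
    unfolding cong_mod_def hy(3) using hy(1) hyG by (simp add: m_assoc)
  have key: "\<exists>j::nat. cong_mod B x (y [^] j)" if x: "x \<in> ?Y" for x
  proof -
    have xG: "x \<in> carrier G" "x \<in> U" using x YU sub_closed(1)[OF NY(1) x] by auto
    obtain k :: nat where k: "cong_mod (N i) x (c [^] k)" using c x by blast
    have "cong_mod (N i) (c [^] k) x"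
      using cong_mod_sym[OF NI(1) xG(1) _ k] cG by simp
    then have "c [^] k \<in> N i <#> ?Y"
      using cong_mod_in[OF D(1,2) _ _ , of x "c [^] k"] D(3) x cG by auto
    then obtain j where j: "k = d * j" using d(2) by blast
    have "cong_mod (N i) ((c [^] d) [^] j) (y [^] j)"
      using cong_mod_pow[OF iN(3) sub_closed(5)[OF U cU] yU cd] .
    then have "cong_mod (N i) x (y [^] j)"
      using cong_mod_trans[OF NI(1) xG(1) _ _ k] j cG hyG by (simp add: nat_pow_pow)
    moreover have "x \<otimes> inv (y [^] j) \<in> A"
      using x hy(2) sub_closed[OF NA(1)] by simp
    ultimately have "cong_mod B x (y [^] j)"
      using iN(1) unfolding cong_mod_def by blast
    then show ?thesis ..
  qed
  have "?Y <#> B = A"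
  proof (rule chD(4))
    show "normal_sub (?Y <#> B) V" by (rule normal_sub_mult[OF Y chD(1)])
    show "B \<subseteq> ?Y <#> B" using mult_sub_incl[OF NY(1) NB(1)] by blast
    show "?Y <#> B \<subseteq> A" using mult_sub_least[OF NA(1)] chD(3) by blast
    show "?Y <#> B \<noteq> B" using mult_sub_incl[OF NY(1) NB(1)] m(1) by blast
  qed
  have "A \<subseteq> adjoin B y"
  proof
    fix a assume a: "a \<in> A"
    then obtain x b where xb: "x \<in> ?Y" "b \<in> B" "a = x \<otimes> b"
      using \<open>?Y <#> B = A\<close> set_mult_iff[of a ?Y B] by blast
    obtain j :: nat where j: "cong_mod B x (y [^] j)" using key xb by blast
    have "cong_mod B b \<one>"
      using xb(2) sub_closed[OF NB(1)] by (simp add: cong_mod_def)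
    then have "cong_mod B (x \<otimes> b) (y [^] j \<otimes> \<one>)"
      using j xb hy(2) NY(3) NB(2,3) sub_closed[OF NB(2)]
      by (intro cong_mod_mult[OF chD(1)]) auto
    then have "cong_mod B a (y [^] j)"
      using xb(3) hyG by simp
    then show "a \<in> adjoin B y"
      unfolding adjoin_def using sub_closed(1)[OF NA(1) a] by blast
  qed
  then show thesis
    using chief_cyclic_prime[OF ch] hy that by blast
qed

text \<open>The factors of a chief series have prime order, hence are cyclic.\<close>

lemma supersolvableI:
  assumes U: "subgroup U G"
    and pr: "\<And>A B. chief U B A \<Longrightarrow> \<exists>q::nat. Factorial_Ring.prime q \<and> card A = q * card B"
  shows "supersolvable (G\<lparr>carrier := U\<rparr>)"
proof -
  let ?S = "\<lambda>A n N. N 0 = {\<one>} \<and> N n = A \<and> (\<forall>i\<le>n. normal_sub (N i) U) \<and>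
    (\<forall>i<n. N i \<subseteq> N (Suc i) \<and> cyclic_group (G\<lparr>carrier := N (Suc i)\<rparr> Mod N i))"
  have "\<exists>n (N :: nat \<Rightarrow> 'a set). ?S A n N" if "normal_sub A U" for A
    using that
  proof (induction "card A" arbitrary: A rule: less_induct)
    case less
    note NA = normal_subD[OF less.prems]
    show ?case
    proof (cases "A = {\<one>}")
      case True
      then have "?S A 0 (\<lambda>_. A)" using less.prems by simp
      then show ?thesis by (intro exI)
    next
      case False
      then have "{\<one>} \<subset> A" using sub_closed(2)[OF NA(1)] by blast
      then obtain B where B: "chief U B A"
        by (rule chief_below[OF normal_sub_one[OF U] less.prems])
      note chD = chiefD[OF B]
      note NB = normal_subD[OF chD(1)]
      have "card B < card A"
        using psubset_card_mono[OF sub_finite[OF NA(1)] chD(3)] .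
      from less.hyps[OF this chD(1)] obtain n N where N: "?S B n N"
        by (elim exE)
      obtain q :: nat where q: "Factorial_Ring.prime q" "card A = q * card B"
        using pr[OF B] by blast
      obtain y where y: "y \<in> A" "y \<notin> B" using chD(3) by blast
      have BA: "normal_sub B A"
        using normal_sub_restrict[OF chD(1) NA(1,3)] chD(3) by blast
      have Ac: "A = adjoin B y"
        using prime_factor_adjoin(1)[OF BA NA(1) _ _ q y] chD(3) by blast
      let ?H = "G\<lparr>carrier := A\<rparr>"
      interpret N: normal B ?H
        using normal_sub_iff[OF NA(1)] BA by blast
      interpret F: group "?H Mod B"
        by (rule N.factorgroup_is_group)
      let ?C = "B #>\<^bsub>?H\<^esub> y"
      have C: "?C \<in> carrier (?H Mod B)"
        using y by (auto simp: FactGroup_def RCOSETS_def)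
      have "carrier (?H Mod B) \<subseteq> range (\<lambda>k::int. ?C [^]\<^bsub>?H Mod B\<^esub> k)"
      proof
        fix D assume "D \<in> carrier (?H Mod B)"
        then obtain a where a: "a \<in> A" "D = B #> a"
          by (auto simp: FactGroup_def RCOSETS_def r_coset_def)
        then obtain j :: nat where "cong_mod B a (y [^] j)"
          using Ac unfolding adjoin_def by blast
        then have "D = B #> (y [^] (int j))"
          using a y cong_mod_iff_coset[OF NB(1)] sub_closed[OF NA(1)] by (simp add: int_pow_int)
        also have "\<dots> = B #>\<^bsub>?H\<^esub> (y [^]\<^bsub>?H\<^esub> int j)"
          using int_pow_consistent[OF NA(1) y(1)] by (simp add: r_coset_def)
        also have "\<dots> = ?C [^]\<^bsub>?H Mod B\<^esub> int j"
          using y N.FactGroup_int_pow[of y "int j"] by simp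
        finally show "D \<in> range (\<lambda>k::int. ?C [^]\<^bsub>?H Mod B\<^esub> k)" by blast
      qed
      then have "cyclic_group (?H Mod B)"
        using F.cyclic_group C F.int_pow_closed[OF C] by blast
      then have "?S A (Suc n) (\<lambda>i. if i \<le> n then N i else A)"
        using N chD(1,3) less.prems by (auto simp: le_Suc_eq less_Suc_eq)
      then show ?thesis by (intro exI)
    qed
  qed
  from this[OF normal_sub_self[OF U]] obtain n N where "?S U n N"
    by (elim exE)
  then show ?thesis
    unfolding supersolvable_def normal_sub_iff[OF U] by (intro exI[of _ n] exI[of _ N]) simp
qed

lemma supersolvable_subgroup:
  assumes "subgroup U G" "supersolvable (G\<lparr>carrier := U\<rparr>)" "subgroup V G" "V \<subseteq> U"
  shows "supersolvable (G\<lparr>carrier := V\<rparr>)"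
  using supersolvableI[OF assms(3)] supersolvable_chief_prime[OF assms] by metis

text \<open>Write \<open>conj_by x a = c a\<close> with \<open>c\<close> in the next smaller term of the chain. By induction \<open>x\<close> fixes \<open>c\<close>
  modulo \<open>L\<close>, so \<open>x\<^sup>n\<close> sends \<open>a\<close> to \<open>c\<^sup>n a\<close>, and \<open>c\<^sup>n \<in> L\<close> forces \<open>c \<in> L\<close>.\<close>

lemma stability:
  assumes L: "normal_sub L U" and K: "normal_sub K U" and LK: "L \<subseteq> K" and x: "x \<in> U"
    and triv: "\<And>B A. chief U B A \<Longrightarrow> L \<subseteq> B \<Longrightarrow> A \<subseteq> K \<Longrightarrow> acts_trivially x A B"
    and n: "acts_trivially (x [^] (n::nat)) K L" and m: "card K = m * card L" "coprime n m"
  shows "acts_trivially x K L"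
proof -
  note NL = normal_subD[OF L] and NK = normal_subD[OF K]
  note cU = sub_closed[OF NL(2)]
  have "acts_trivially x A L" if "normal_sub A U" "L \<subseteq> A" "A \<subseteq> K" for A
    using that
  proof (induction "card A" arbitrary: A rule: less_induct)
    case less
    note NA = normal_subD[OF less.prems(1)]
    note cA = sub_closed[OF NA(1)]
    show ?case
    proof (cases "A = L")
      case True
      have "conj_by x a \<otimes> inv a \<in> L" if "a \<in> L" for a
        using that NL(4)[OF x that] sub_closed[OF NL(1)] by simp
      then show ?thesis
        unfolding True acts_trivially_def cong_mod_def by blast
    next
      case False
      then have "L \<subset> A" using less.prems by blast
      then obtain B where B: "chief U B A" "L \<subseteq> B"
        using chief_below[OF L less.prems(1)] by blast
      note chD = chiefD[OF B(1)]
      note NB = normal_subD[OF chD(1)]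
      have "card B < card A"
        using psubset_card_mono[OF sub_finite[OF NA(1)] chD(3)] .
      then have IH: "acts_trivially x B L"
        using less.hyps[OF _ chD(1) B(2)] chD(3) less.prems(3) by blast
      have tr: "acts_trivially x A B"
        using triv B less.prems(3) by blast
      show ?thesis
        unfolding acts_trivially_def
      proof
        fix a assume a: "a \<in> A"
        define c where "c = conj_by x a \<otimes> inv a"
        have c: "c \<in> B" using tr a unfolding c_def acts_trivially_def cong_mod_def by blast
        have mem: "a \<in> U" "c \<in> U" "conj_by x c \<in> U" "conj_by x a \<in> U" "a \<in> carrier G" "c \<in> carrier G"
          "x \<in> carrier G" "c \<in> K"
          using a c x NA(3) NB(3) cU(1) less.prems(3) chD(3) sub_conj_by[OF NL(2) x] by auto
        have ca: "conj_by x a = c \<otimes> a"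
          unfolding c_def using mem by (simp add: m_assoc)
        have xc: "cong_mod L (conj_by x c) c" using IH c unfolding acts_trivially_def by blast
        have iter: "cong_mod L (conj_by (x [^] j) a) (c [^] j \<otimes> a)" for j :: nat
        proof (induction j)
          case 0
          then show ?case using mem cong_mod_refl[OF NL(1)] by simp
        next
          case (Suc j)
          have "cong_mod L (conj_by x (conj_by (x [^] j) a)) (conj_by x (c [^] j \<otimes> a))"
            using cong_mod_conj_by[OF L x _ _ Suc] mem by simp
          moreover have "conj_by x (c [^] j \<otimes> a) = conj_by x c [^] j \<otimes> (c \<otimes> a)"
            using mem by (simp add: conj_by_mult conj_by_pow ca)
          moreover have "cong_mod L (conj_by x c [^] j \<otimes> (c \<otimes> a)) (c [^] j \<otimes> (c \<otimes> a))"
            using mem cU cong_mod_pow[OF L mem(3,2) xc] cong_mod_refl[OF NL(1)]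
            by (intro cong_mod_mult[OF L]) auto
          ultimately have "cong_mod L (conj_by x (conj_by (x [^] j) a)) (c [^] j \<otimes> (c \<otimes> a))"
            using cong_mod_trans[OF NL(1), of "conj_by x (conj_by (x [^] j) a)" "conj_by x (c [^] j \<otimes> a)"] mem
            by simp
          moreover have "conj_by x (conj_by (x [^] j) a) = conj_by (x [^] Suc j) a"
            using mem by (subst nat_pow_Suc2) (auto simp: conj_by_conj_by)
          ultimately show ?case using mem by (simp add: m_assoc)
        qed
        have "cong_mod L (conj_by (x [^] n) a) a"
          using n a less.prems(3) unfolding acts_trivially_def by blast
        then have "cong_mod L (c [^] n \<otimes> a) a"
          using cong_mod_trans[OF NL(1) _ _ _ cong_mod_sym[OF NL(1) _ _ iter[of n]]] mem by simp
        then have cn: "c [^] n \<in> L"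
          using mem by (simp add: cong_mod_def m_assoc)
        obtain d :: nat where d: "d > 0" "\<And>j::nat. c [^] j \<in> L \<longleftrightarrow> d dvd j"
          using order_mod[OF NL(1) mem(6)] by blast
        note C = adjoin_subgroup[OF L mem(2)]
        have "card (adjoin L c) dvd card K"
          using sub_card_dvd[OF C(1) NK(1) C(5)[OF NK(1) _ mem(8)]] less.prems by blast
        then have "d dvd m"
          unfolding card_adjoin[OF NL(1) mem(6) d] m(1) using sub_pos[OF NL(1)] by simp
        moreover have "d dvd n" using cn d by blast
        ultimately have "d = 1"
          using m(2) by (metis coprime_common_divisor_nat)
        then have "c \<in> L"
          using d(2)[of 1] mem by simp
        then show "cong_mod L (conj_by x a) a"
          unfolding c_def cong_mod_def .
      qed
    qed
  qed
  then show ?thesis using K LK by blast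
qed

section \<open>Fixed points and Sylow subgroups\<close>

lemma pow_card: "subgroup Q G \<Longrightarrow> x \<in> Q \<Longrightarrow> x [^] (card Q) = \<one>"
proof -
  assume Q: "subgroup Q G" "x \<in> Q"
  interpret Q: group "G\<lparr>carrier := Q\<rparr>"
    using Q subgroup_imp_group by blast
  show ?thesis
    using Q.pow_order_eq_1[of x] Q(2) nat_pow_consistent[of x "card Q" Q] by (simp add: order_def)
qed

text \<open>The orbit of a point has as many elements as its stabilizer has cosets, so it is a single
  point or has length divisible by \<open>p\<close>.\<close>

lemma fixed_points:
  assumes Q: "subgroup Q G" and p: "Factorial_Ring.prime (p::nat)" "card Q = p ^ k" and E: "finite E"
    and act: "\<And>g x. g \<in> Q \<Longrightarrow> x \<in> E \<Longrightarrow> f g x \<in> E" "\<And>x. x \<in> E \<Longrightarrow> f \<one> x = x"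
      "\<And>g h x. g \<in> Q \<Longrightarrow> h \<in> Q \<Longrightarrow> x \<in> E \<Longrightarrow> f (g \<otimes> h) x = f g (f h x)"
  shows "p dvd card {x \<in> E. \<exists>g\<in>Q. f g x \<noteq> x}"
proof -
  note c = sub_closed[OF Q]
  let ?O = "\<lambda>x. (\<lambda>g. f g x) ` Q"
  let ?N = "{x \<in> E. \<exists>g\<in>Q. f g x \<noteq> x}"
  have inv: "f (inv g) (f g x) = x" if "g \<in> Q" "x \<in> E" for g x
    using that act(2)[of x] act(3)[of "inv g" g x] c(1)[OF that(1)] c(4)[OF that(1)] by simp
  have card: "card (?O x) dvd p ^ k" if x: "x \<in> E" for x
  proof -
    let ?S = "{g \<in> Q. f g x = x}"
    have "card {g \<in> Q. f g x = z} = card ?S" if z: "z \<in> ?O x" for z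
    proof -
      obtain h where h: "h \<in> Q" "z = f h x" using z by blast
      have "bij_betw (\<lambda>s. h \<otimes> s) ?S {g \<in> Q. f g x = z}"
      proof (rule bij_betwI[where g = "\<lambda>s. inv h \<otimes> s"])
        show "(\<otimes>) h \<in> ?S \<rightarrow> {g \<in> Q. f g x = z}"
          using h x act(3) c(3) by auto
        show "(\<otimes>) (inv h) \<in> {g \<in> Q. f g x = z} \<rightarrow> ?S"
          using h x act(3)[OF c(4)[OF h(1)]] inv[OF h(1) x] c(3)[OF c(4)[OF h(1)]] by auto
      qed (use h c in auto)
      then show ?thesis by (simp add: bij_betw_same_card)
    qed
    then have "card Q = card (?O x) * card ?S"
      by (rule card_fibres[OF sub_finite[OF Q]])
    then show ?thesis using p(2) by simp
  qed
  have self: "x \<in> ?O x" if "x \<in> E" for x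
    using act(2)[OF that] c(2) by (metis imageI)
  have sub: "?O y \<subseteq> ?O x" if xy: "x \<in> E" "y \<in> ?O x" for x y
  proof -
    obtain h where h: "h \<in> Q" "y = f h x" using xy by blast
    show ?thesis
    proof
      fix z assume "z \<in> ?O y"
      then obtain g where "g \<in> Q" "z = f g y" by blast
      then have "z = f (g \<otimes> h) x" "g \<otimes> h \<in> Q" using h act(3)[of g h x] xy(1) c(3)[of g h] by auto
      then show "z \<in> ?O x" by blast
    qed
  qed
  have sym: "x \<in> ?O y" if xy: "x \<in> E" "y \<in> ?O x" for x y
  proof -
    obtain h where h: "h \<in> Q" "y = f h x" using xy by blast
    then have "x = f (inv h) y" using inv[OF h(1) xy(1)] by simp
    then show ?thesis using c(4)[OF h(1)] by blast
  qed
  have eq: "?O y = ?O x" if "x \<in> E" "y \<in> ?O x" for x y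
  proof -
    have "y \<in> E" using that act(1) by blast
    then show ?thesis using sub[OF that] sub[OF _ sym[OF that]] by blast
  qed
  have "?N = \<Union> (?O ` ?N)"
  proof
    show "?N \<subseteq> \<Union> (?O ` ?N)" using self by blast
    show "\<Union> (?O ` ?N) \<subseteq> ?N"
    proof
      fix y assume "y \<in> \<Union> (?O ` ?N)"
      then obtain x where x: "x \<in> ?N" "y \<in> ?O x" by blast
      have y: "y \<in> E" using x act(1) by blast
      moreover have "\<exists>g\<in>Q. f g y \<noteq> y"
      proof (rule ccontr)
        assume "\<not> ?thesis"
        then have "?O y \<subseteq> {y}" by auto
        moreover have "?O y = ?O x" using eq[of x y] x by simp
        ultimately have *: "?O x \<subseteq> {y}" by simp
        moreover have "x \<in> ?O x" using self[of x] x by simp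
        ultimately have "x = y" by blast
        then show False using x * by auto
      qed
      ultimately show "y \<in> ?N" by blast
    qed
  qed
  moreover have "p dvd card (\<Union> (?O ` ?N))"
  proof (rule dvd_partition)
    show "finite (\<Union> (?O ` ?N))" using E sub_finite[OF Q] by simp
    show "\<forall>c\<in>?O ` ?N. p dvd card c"
    proof
      fix c assume "c \<in> ?O ` ?N"
      then obtain x where x: "x \<in> ?N" "c = ?O x" by blast
      obtain i where i: "card c = p ^ i"
        using card[of x] x divides_primepow_nat[OF p(1)] by blast
      have "i \<noteq> 0"
      proof
        assume "i = 0"
        then have "card c = 1" using i by simp
        then obtain z where "c = {z}" using card_1_singletonE by blast
        moreover have "x \<in> c" using self[of x] x by simp
        ultimately have "?O x = {x}" using x(2) by simp
        then show False using x(1) by auto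
      qed
      then show "p dvd card c" using i by simp
    qed
    show "\<forall>c1\<in>?O ` ?N. \<forall>c2\<in>?O ` ?N. c1 \<noteq> c2 \<longrightarrow> c1 \<inter> c2 = {}"
    proof (intro ballI impI, rule ccontr)
      fix c1 c2 assume *: "c1 \<in> ?O ` ?N" "c2 \<in> ?O ` ?N" "c1 \<noteq> c2" "c1 \<inter> c2 \<noteq> {}"
      then obtain x1 x2 z where "x1 \<in> E" "x2 \<in> E" "c1 = ?O x1" "c2 = ?O x2" "z \<in> ?O x1" "z \<in> ?O x2"
        by blast
      then show False using eq[of x1 z] eq[of x2 z] *(3) by simp
    qed
  qed
  ultimately show ?thesis by simp
qed

definition is_sylow :: "nat \<Rightarrow> 'a set \<Rightarrow> 'a set \<Rightarrow> bool" where
  "is_sylow p P U \<longleftrightarrow> subgroup P G \<and> P \<subseteq> U \<and> card P = p ^ multiplicity p (card U)"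

lemma sylow_ex:
  assumes "subgroup U G" "Factorial_Ring.prime p"
  obtains P where "is_sylow p P U"
proof -
  interpret U: group "G\<lparr>carrier := U\<rparr>"
    using assms subgroup_imp_group by blast
  obtain m where "card U = p ^ multiplicity p (card U) * m"
    using multiplicity_dvd dvd_def by metis
  then have "\<exists>H. subgroup H (G\<lparr>carrier := U\<rparr>) \<and> card H = p ^ multiplicity p (card U)"
    using assms(2) sub_finite[OF assms(1)] by (intro sylow_thm[where m = m]) (auto simp: order_def)
  then obtain H where H: "subgroup H (G\<lparr>carrier := U\<rparr>)" "card H = p ^ multiplicity p (card U)"
    by blast
  show thesis
    using that[of H] incl_subgroup[OF assms(1) H(1)] subgroup.subset[OF H(1)] H(2)
    by (simp add: is_sylow_def)
qed

lemma sylow_mono: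
  assumes "is_sylow p P U" "subgroup V G" "P \<subseteq> V" "V \<subseteq> U" "subgroup U G" "Factorial_Ring.prime p"
  shows "is_sylow p P V"
proof -
  have P: "subgroup P G" "card P = p ^ multiplicity p (card U)"
    using assms(1) by (auto simp: is_sylow_def)
  have "card P dvd card V" using sub_card_dvd[OF P(1) assms(2,3)] .
  then have "multiplicity p (card U) \<le> multiplicity p (card V)"
    using P(2) sub_pos[OF assms(2)] assms(6) by (intro multiplicity_geI) auto
  moreover have "multiplicity p (card V) \<le> multiplicity p (card U)"
    using sub_card_dvd[OF assms(2,5,4)] sub_pos[OF assms(5)] by (intro dvd_imp_multiplicity_le) auto
  ultimately show ?thesis using P assms(3) by (simp add: is_sylow_def)
qed

text \<open>A \<open>p\<close>-subgroup \<open>Q\<close> acts on the left cosets of the Sylow subgroup \<open>P\<close>, whose number is prime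
  to \<open>p\<close>; a coset \<open>u P\<close> that \<open>Q\<close> fixes gives \<open>Q \<le> u P u\<^sup>-\<^sup>1\<close>.\<close>

lemma sylow_conj:
  assumes U: "subgroup U G" and P: "is_sylow p P U" and p: "Factorial_Ring.prime p"
    and Q: "subgroup Q G" "Q \<subseteq> U" "card Q = p ^ k"
  obtains u where "u \<in> U" "Q \<subseteq> conj_by u ` P"
proof -
  have PG: "subgroup P G" "P \<subseteq> U" "card P = p ^ multiplicity p (card U)"
    using P by (auto simp: is_sylow_def)
  note cU = sub_closed[OF U] and cP = sub_closed[OF PG(1)] and cQ = sub_closed[OF Q(1)]
  let ?g = "\<lambda>u. (\<otimes>) u ` P"
  let ?E = "?g ` U"
  have mem: "x \<in> ?g u \<longleftrightarrow> inv u \<otimes> x \<in> P" if "u \<in> U" "x \<in> U" for u x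
  proof
    show "inv u \<otimes> x \<in> P" if "x \<in> ?g u" using that \<open>u \<in> U\<close> cP cU by auto
    show "x \<in> ?g u" if "inv u \<otimes> x \<in> P"
      using that imageI[OF that, of "(\<otimes>) u"] \<open>u \<in> U\<close> \<open>x \<in> U\<close> cU by simp
  qed
  have gU: "?g u \<subseteq> U" if "u \<in> U" for u
    using that PG(2) cU by auto
  have eq: "?g u = ?g v" if uv: "u \<in> U" "v \<in> U" "inv u \<otimes> v \<in> P" for u v
  proof -
    have "?g v \<subseteq> ?g u" if uv: "u \<in> U" "v \<in> U" "inv u \<otimes> v \<in> P" for u v
    proof
      fix x assume x: "x \<in> ?g v"
      then have "inv u \<otimes> v \<otimes> (inv v \<otimes> x) \<in> P"
        using mem[OF uv(2)] gU[OF uv(2)] uv cP by blast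
      then show "x \<in> ?g u"
        using mem[OF uv(1)] gU[OF uv(2)] x uv cU by (auto simp: m_assoc)
    qed
    moreover have "inv v \<otimes> u \<in> P"
      using cP(4)[OF uv(3)] uv cU by (simp add: inv_mult_group)
    ultimately show ?thesis using uv by blast
  qed
  have "card {v \<in> U. ?g v = z} = card P" if z: "z \<in> ?E" for z
  proof -
    obtain u where u: "u \<in> U" "z = ?g u" using z by blast
    have "{v \<in> U. ?g v = z} = z"
    proof
      show "{v \<in> U. ?g v = z} \<subseteq> z"
      proof
        fix v assume v: "v \<in> {v \<in> U. ?g v = z}"
        then have "v \<in> ?g v" using mem[of v v] cU cP(2) by simp
        then show "v \<in> z" using v by blast
      qed
      show "z \<subseteq> {v \<in> U. ?g v = z}"
        using u mem[OF u(1)] gU[OF u(1)] eq[OF u(1)] by blast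
    qed
    moreover have "card z = card P"
      unfolding u(2)
      using u(1) cU(1) by (intro card_image inj_on_subset[OF inj_on_cmult]) (auto simp: cP)
    ultimately show ?thesis by simp
  qed
  then have "card U = card ?E * card P"
    by (rule card_fibres[OF sub_finite[OF U]])
  then have ndvd: "\<not> p dvd card ?E"
    using not_dvd_cofactor[OF p sub_pos[OF U]] PG(3) by (metis dvd_refl)
  have ex: "\<exists>u\<in>U. \<forall>g\<in>Q. ?g (g \<otimes> u) = ?g u"
  proof (rule ccontr)
    assume non: "\<not> ?thesis"
    let ?f = "\<lambda>g. (`) ((\<otimes>) g)"
    have fg: "?f g (?g u) = ?g (g \<otimes> u)" if "g \<in> Q" "u \<in> U" for g u
      unfolding image_image using that cQ(1) cU(1) cP(1) by (intro image_cong) (auto simp: m_assoc)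
    have gu: "g \<otimes> u \<in> U" if "g \<in> Q" "u \<in> U" for g u
      using that Q(2) cU(3) by blast
    have "p dvd card {x \<in> ?E. \<exists>g\<in>Q. ?f g x \<noteq> x}"
    proof (rule fixed_points[OF Q(1) p Q(3), where f = ?f])
      show "finite ?E" using sub_finite[OF U] by simp
      show "?f g x \<in> ?E" if gx: "g \<in> Q" "x \<in> ?E" for g x
      proof -
        obtain u where "u \<in> U" "x = ?g u" using gx by blast
        then show ?thesis using fg[OF gx(1)] gu[OF gx(1)] by auto
      qed
      show "?f \<one> x = x" if x: "x \<in> ?E" for x
      proof -
        obtain u where u: "u \<in> U" "x = ?g u" using x by blast
        then show ?thesis using fg[OF cQ(2)] cU(1) by simp
      qed
      show "?f (g \<otimes> h) x = ?f g (?f h x)" if gx: "g \<in> Q" "h \<in> Q" "x \<in> ?E" for g h x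
      proof -
        obtain u where u: "u \<in> U" "x = ?g u" using gx by blast
        then show ?thesis
          using fg[OF cQ(3)[OF gx(1,2)] u(1)] fg[OF gx(2) u(1)] fg[OF gx(1) gu[OF gx(2) u(1)]]
            gx cQ(1) cU(1) by (simp add: m_assoc)
      qed
    qed
    moreover have "{x \<in> ?E. \<exists>g\<in>Q. ?f g x \<noteq> x} = ?E"
      using non fg by auto
    ultimately show False using ndvd by simp
  qed
  then obtain u where u: "u \<in> U" "\<forall>g\<in>Q. ?g (g \<otimes> u) = ?g u" by blast
  have "Q \<subseteq> conj_by u ` P"
  proof
    fix g assume g: "g \<in> Q"
    have guU: "g \<otimes> u \<in> U" using g Q(2) u(1) cU(3) by blast
    have "g \<otimes> u \<in> ?g (g \<otimes> u)" using mem[OF guU guU] guU cU(1) cP(2) by simp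
    then have *: "inv u \<otimes> (g \<otimes> u) \<in> P" using u g mem[OF u(1) guU] by simp
    have "g = conj_by u (inv u \<otimes> (g \<otimes> u))"
      using u(1) cU(1) cQ(1)[OF g] by (simp add: conj_by_def m_assoc)
    then show "g \<in> conj_by u ` P" using * by blast
  qed
  then show thesis using that u by blast
qed

lemma sylow_conj_eq:
  assumes U: "subgroup U G" and P: "is_sylow p P U" "is_sylow p Q U" and p: "Factorial_Ring.prime p"
  obtains u where "u \<in> U" "Q = conj_by u ` P"
proof -
  have Q: "subgroup Q G" "Q \<subseteq> U" "card Q = p ^ multiplicity p (card U)"
    and PG: "subgroup P G" "P \<subseteq> U" "card P = p ^ multiplicity p (card U)"
    using P by (auto simp: is_sylow_def)
  obtain u where u: "u \<in> U" "Q \<subseteq> conj_by u ` P"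
    using sylow_conj[OF U P(1) p Q] by blast
  have uG: "u \<in> carrier G" using sub_closed(1)[OF U u(1)] .
  note c = conj_by_image_subgroup[OF PG(1) uG]
  have "Q = conj_by u ` P"
    using card_subset_eq[OF sub_finite[OF c(1)] u(2)] c(2) Q PG by simp
  then show thesis using that u by blast
qed

text \<open>The Frattini argument, for conjugation by a single element.\<close>

lemma frattini:
  assumes N: "normal_sub N U" and P: "is_sylow p P N" and p: "Factorial_Ring.prime p" and g: "g \<in> U"
  obtains n where "n \<in> N" "conj_by g ` P = conj_by n ` P"
proof -
  note NN = normal_subD[OF N]
  have PG: "subgroup P G" "P \<subseteq> N" "card P = p ^ multiplicity p (card N)"
    using P by (auto simp: is_sylow_def)
  note c = conj_by_image_subgroup[OF PG(1) sub_closed(1)[OF NN(2) g]]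
  have "is_sylow p (conj_by g ` P) N"
    unfolding is_sylow_def using c PG NN(4)[OF g] by auto
  then show thesis
    using sylow_conj_eq[OF NN(1) P _ p] that by blast
qed

lemma sylow_index:
  assumes "is_sylow p P U" "subgroup U G" "subgroup V G" "P \<subseteq> V" "card U = m * card V" "Factorial_Ring.prime p"
  shows "\<not> p dvd m"
proof (rule not_dvd_cofactor[OF assms(6) sub_pos[OF assms(2)] assms(5)])
  show "p ^ multiplicity p (card U) dvd card V"
    using sub_card_dvd[OF _ assms(3,4)] assms(1) unfolding is_sylow_def by auto
qed

lemma sub_index:
  assumes "subgroup A G" "subgroup B G" "A \<subseteq> B"
  obtains m where "card B = m * card A" "m > 0"
proof -
  obtain m where m: "card B = m * card A"
    using sub_card_dvd[OF assms] by (metis dvd_def mult.commute)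
  moreover have "m \<noteq> 0" using m sub_pos[OF assms(2)] by auto
  ultimately show thesis using that by blast
qed

lemma index_prime_power:
  assumes "subgroup U G" "subgroup V G" "V \<subseteq> U" "Factorial_Ring.prime p"
    and "\<And>s. Factorial_Ring.prime s \<Longrightarrow> s \<noteq> p \<Longrightarrow> \<exists>S. is_sylow s S U \<and> S \<subseteq> V"
  obtains k where "card U = p ^ k * card V"
proof -
  obtain m where m: "card U = m * card V" "m > 0"
    using sub_index[OF assms(2,1,3)] by blast
  have "\<exists>k. m = p ^ k"
    using prime_power_eq[OF assms(4) m(2)] sylow_index[OF _ assms(1,2) _ m(1)] assms(5) by blast
  then show thesis using m that by blast
qed

lemma sub_eq_if_sylow:
  assumes "subgroup U G" "subgroup V G" "V \<subseteq> U"
    and "\<And>s. Factorial_Ring.prime s \<Longrightarrow> \<exists>S. is_sylow s S U \<and> S \<subseteq> V"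
  shows "V = U"
proof -
  obtain m where m: "card U = m * card V" "m > 0"
    using sub_index[OF assms(2,1,3)] by blast
  have "m = 1"
    using prime_factor_nat[of m] sylow_index[OF _ assms(1,2) _ m(1)] assms(4) by blast
  then show ?thesis
    using card_subset_eq[OF sub_finite[OF assms(1)] assms(3)] m by simp
qed

lemma sylow_mult:
  assumes C: "normal_sub C U" and p: "Factorial_Ring.prime p" and card: "card U = p ^ k * card C"
    and P: "is_sylow p P U"
  shows "C <#> P = U"
proof -
  note NC = normal_subD[OF C]
  have PG: "subgroup P G" "P \<subseteq> U" using P by (auto simp: is_sylow_def)
  note Y = normal_mult_subgroup[OF C PG]
  obtain m where m: "card U = m * card (C <#> P)" "m > 0"
    using sub_index[OF Y(1) NC(2) Y(4)] by blast
  obtain l where l: "card (C <#> P) = l * card C"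
    using sub_index[OF NC(1) Y(1,2)] by blast
  have "m * l = p ^ k"
    using m l card sub_pos[OF NC(1)] by (simp add: mult.assoc[symmetric])
  then obtain i where "m = p ^ i"
    using divides_primepow_nat[OF p] by (metis dvd_triv_left)
  moreover have "\<not> p dvd m"
    using sylow_index[OF P NC(2) Y(1,3) m(1) p] .
  ultimately have "m = 1" by (cases i) auto
  then show ?thesis
    using card_subset_eq[OF sub_finite[OF NC(2)] Y(4)] m by simp
qed

text \<open>The \<open>p\<close>-group \<open>P\<close> permutes the \<open>p\<^sup>k\<close> cosets of \<open>L\<close> in \<open>K\<close> and fixes the coset \<open>L\<close>, hence at least
  \<open>p\<close> of them.\<close>

lemma fixed_point_mod:
  assumes L: "normal_sub L U" and K: "normal_sub K U" "L \<subset> K"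
    and p: "Factorial_Ring.prime p" "card K = p ^ k * card L"
    and P: "subgroup P G" "P \<subseteq> U" "card P = p ^ i"
  obtains y where "y \<in> K" "y \<notin> L" "\<And>g. g \<in> P \<Longrightarrow> cong_mod L (conj_by g y) y"
proof -
  note NL = normal_subD[OF L] and NK = normal_subD[OF K(1)]
  note cU = sub_closed[OF NL(2)] and cK = sub_closed[OF NK(1)] and cP = sub_closed[OF P(1)]
    and cL = sub_closed[OF NL(1)]
  let ?c = "\<lambda>y. {x \<in> K. cong_mod L x y}"
  let ?E = "?c ` K"
  have eq: "?c x = ?c y" if xy: "x \<in> K" "y \<in> K" "cong_mod L x y" for x y
    using cong_mod_trans[OF NL(1) _ _ _ _ xy(3)]
      cong_mod_trans[OF NL(1) _ _ _ _ cong_mod_sym[OF NL(1) _ _ xy(3)]] xy(1,2) cK(1) by auto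
  have eq': "cong_mod L x y" if "x \<in> K" "?c x = ?c y" for x y
    using that cong_mod_refl[OF NL(1) cK(1)[OF that(1)]] by blast
  have cc: "card (?c y) = card L" if y: "y \<in> K" for y
  proof -
    have "bij_betw (\<lambda>l. l \<otimes> y) L (?c y)"
    proof (rule bij_betwI[where g = "\<lambda>x. x \<otimes> inv y"])
      show "(\<lambda>l. l \<otimes> y) \<in> L \<rightarrow> ?c y"
        using y K(2) cK cL by (auto simp: cong_mod_def m_assoc)
    qed (use y cK cL in \<open>auto simp: cong_mod_def m_assoc\<close>)
    then show ?thesis by (simp add: bij_betw_same_card)
  qed
  have "card {x \<in> K. ?c x = z} = card L" if z: "z \<in> ?E" for z
  proof -
    obtain y where y: "y \<in> K" "z = ?c y" using z by blast
    have "{x \<in> K. ?c x = z} = ?c y"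
      using y eq eq' by blast
    then show ?thesis using cc y by simp
  qed
  then have "card K = card ?E * card L"
    by (rule card_fibres[OF sub_finite[OF NK(1)]])
  then have cE: "card ?E = p ^ k"
    using p(2) sub_pos[OF NL(1)] by simp
  have "k \<noteq> 0"
    using p(2) psubset_card_mono[OF sub_finite[OF NK(1)] K(2)] by (cases k) auto
  let ?f = "\<lambda>g. (`) (conj_by g)"
  have fg: "?f g (?c y) = ?c (conj_by g y)" if g: "g \<in> P" and y: "y \<in> K" for g y
  proof
    have gU: "g \<in> U" "inv g \<in> U" using g P(2) cU by auto
    show "?f g (?c y) \<subseteq> ?c (conj_by g y)"
      using NK(4)[OF gU(1)] cong_mod_conj_by[OF L gU(1) cK(1) cK(1)] y by blast
    show "?c (conj_by g y) \<subseteq> ?f g (?c y)"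
    proof
      fix x assume x: "x \<in> ?c (conj_by g y)"
      then have "cong_mod L (conj_by (inv g) x) (conj_by (inv g) (conj_by g y))"
        using cong_mod_conj_by[OF L gU(2) cK(1) cK(1)] NK(4)[OF gU(1) y] by blast
      then have "conj_by (inv g) x \<in> ?c y"
        using x NK(4)[OF gU(2)] y gU cU(1) cK(1) by simp
      then have "conj_by g (conj_by (inv g) x) \<in> ?f g (?c y)" by blast
      then show "x \<in> ?f g (?c y)" using x gU cU(1) cK(1) by simp
    qed
  qed
  let ?N = "{x \<in> ?E. \<exists>g\<in>P. ?f g x \<noteq> x}"
  have PK: "conj_by g y \<in> K" if "g \<in> P" "y \<in> K" for g y
    using that P(2) NK(4) by blast
  have N: "p dvd card ?N"
  proof (rule fixed_points[OF P(1) p(1) P(3), where f = ?f])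
    show "finite ?E" using sub_finite[OF NK(1)] by simp
    show "?f g x \<in> ?E" if gx: "g \<in> P" "x \<in> ?E" for g x
    proof -
      obtain y where "y \<in> K" "x = ?c y" using gx by blast
      then show ?thesis using fg[OF gx(1)] PK[OF gx(1)] by auto
    qed
    show "?f \<one> x = x" if x: "x \<in> ?E" for x
    proof -
      obtain y where "y \<in> K" "x = ?c y" using x by blast
      then show ?thesis using fg[OF cP(2)] cK(1) by simp
    qed
    show "?f (g \<otimes> h) x = ?f g (?f h x)" if gx: "g \<in> P" "h \<in> P" "x \<in> ?E" for g h x
    proof -
      obtain y where y: "y \<in> K" "x = ?c y" using gx by blast
      then show ?thesis
        using fg[OF cP(3)[OF gx(1,2)] y(1)] fg[OF gx(2) y(1)] fg[OF gx(1) PK[OF gx(2) y(1)]]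
          gx cP(1) cK(1) by (simp add: conj_by_conj_by)
    qed
  qed
  have two: "?E - ?N \<noteq> {?c \<one>}"
  proof
    assume *: "?E - ?N = {?c \<one>}"
    have "finite ?E" using sub_finite[OF NK(1)] by simp
    then have "card ?E = card ?N + card (?E - ?N)"
      by (metis (no_types, lifting) add.commute card_Diff_subset card_mono finite_subset le_add_diff_inverse2
          mem_Collect_eq subsetI)
    then have "card ?E = card ?N + 1" using * by simp
    then have "p dvd card ?N + 1" using cE \<open>k \<noteq> 0\<close> by (metis dvd_power not_gr_zero)
    then have "p dvd 1" using N dvd_add_right_iff by blast
    then show False using p(1) not_prime_unit by blast
  qed
  have mem: "?c \<one> \<in> ?E - ?N"
  proof -
    have "?f g (?c \<one>) = ?c \<one>" if "g \<in> P" for g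
      using fg[OF that cK(2)] cP(1)[OF that] by simp
    then show ?thesis using cK(2) by blast
  qed
  have "\<exists>z\<in>A. z \<noteq> a" if "a \<in> A" "A \<noteq> {a}" for A and a :: "'a set"
    using that by blast
  from this[OF mem two] obtain z where z: "z \<in> ?E - ?N" "z \<noteq> ?c \<one>" by (elim bexE)
  from z(1) obtain y where y: "y \<in> K" "z = ?c y" by (elim DiffE imageE)
  have "y \<notin> L"
  proof
    assume "y \<in> L"
    then have "cong_mod L y \<one>" using cL by (simp add: cong_mod_def)
    then show False using eq[OF y(1) cK(2)] y z by simp
  qed
  moreover have "cong_mod L (conj_by g y) y" if g: "g \<in> P" for g
  proof -
    have "?c (conj_by g y) = ?c y" using z y g fg[OF g y(1)] by auto
    then show ?thesis using eq'[OF PK[OF g y(1)]] by blast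
  qed
  ultimately show thesis using that y by blast
qed

section \<open>Chief factors of solvable groups\<close>

lemma cong_mod_comm_iff:
  assumes "a \<in> carrier G" "b \<in> carrier G"
  shows "cong_mod L (a \<otimes> b) (b \<otimes> a) \<longleftrightarrow> a \<otimes> b \<otimes> inv a \<otimes> inv b \<in> L"
  using assms by (simp add: cong_mod_def inv_mult_group m_assoc)

text \<open>Otherwise \<open>K = L K'\<close>, and then \<open>K\<close> is contained in \<open>L D\<close> for each term \<open>D\<close> of the derived series
  of \<open>G\<close>.\<close>

lemma chief_solvable_abelian:
  assumes sol: "solvable G" and ch: "chief U L K" and ab: "a \<in> K" "b \<in> K"
  shows "cong_mod L (a \<otimes> b) (b \<otimes> a)"
proof -
  note chD = chiefD[OF ch]
  note NL = normal_subD[OF chD(1)] and NK = normal_subD[OF chD(2)]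
  note cU = sub_closed[OF NL(2)] and cK = sub_closed[OF NK(1)] and cL = sub_closed[OF NL(1)]
  have KG: "K \<subseteq> carrier G" using cK(1) by blast
  let ?D = "derived G K"
  have DsubG: "subgroup ?D G" using derived_is_subgroup[OF KG] .
  interpret U: group "G\<lparr>carrier := U\<rparr>" using NL(2) subgroup_imp_group by blast
  have "K \<lhd> G\<lparr>carrier := U\<rparr>" using normal_sub_iff[OF NL(2)] chD(2) by blast
  then have "derived (G\<lparr>carrier := U\<rparr>) K \<lhd> G\<lparr>carrier := U\<rparr>"
    by (rule U.derived_is_normal)
  then have DU: "normal_sub ?D U"
    using normal_sub_iff[OF NL(2)] derived_consistent[OF NK(3) NL(2)] by simp
  have DK: "?D \<subseteq> K" using derived_incl[OF order_refl NK(1)] .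
  let ?Y = "L <#> ?D"
  have Y: "normal_sub ?Y U" "L \<subseteq> ?Y" "?D \<subseteq> ?Y" "?Y \<subseteq> K"
    using normal_sub_mult[OF chD(1) DU] mult_sub_incl[OF NL(1) DsubG]
      mult_sub_least[OF NK(1) _ DK] chD(3) by blast+
  have "?Y \<noteq> K"
  proof
    assume YK: "?Y = K"
    have all: "K \<subseteq> L <#> ((derived G ^^ n) (carrier G) \<inter> K)" for n
    proof (induction n)
      case 0
      then show ?case using mult_sub_incl[OF NL(1) NK(1)] KG by (simp add: Int_absorb1)
    next
      case (Suc n)
      let ?A = "(derived G ^^ n) (carrier G)"
      have A: "subgroup ?A G" using exp_of_derived_is_subgroup[OF subgroup_self] .
      have A': "subgroup (derived G ?A) G"
        using derived_is_subgroup[OF subgroup.subset[OF A]] .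
      let ?B = "derived G ?A \<inter> K"
      have B: "subgroup ?B G" "?B \<subseteq> U" using sub_Int[OF A' NK(1)] NK(3) by auto
      note LB = normal_mult_subgroup[OF chD(1) B]
      have "a \<otimes> b \<otimes> inv a \<otimes> inv b \<in> L <#> ?B" if ab: "a \<in> K" "b \<in> K" for a b
      proof -
        obtain l x where x: "l \<in> L" "x \<in> ?A \<inter> K" "a = l \<otimes> x"
          using Suc ab(1) set_mult_iff[of a L "?A \<inter> K"] by blast
        obtain m y where y: "m \<in> L" "y \<in> ?A \<inter> K" "b = m \<otimes> y"
          using Suc ab(2) set_mult_iff[of b L "?A \<inter> K"] by blast
        have mem: "a \<in> U" "b \<in> U" "x \<in> U" "y \<in> U" "l \<in> carrier G" "m \<in> carrier G"
          using ab x y NK(3) cL(1) by auto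
        have ex: "cong_mod L a x" "cong_mod L b y"
          using x y mem cU(1) by (auto simp: cong_mod_def m_assoc)
        have inv: "cong_mod L (inv u) (inv v)" if uv: "u \<in> U" "v \<in> U" "cong_mod L u v" for u v
        proof -
          have "conj_by (inv v) (inv (u \<otimes> inv v)) \<in> L"
            using uv NL(4)[OF cU(4)[OF uv(2)] cL(4)] unfolding cong_mod_def by blast
          then show ?thesis
            using uv cU by (simp add: conj_by_def cong_mod_def inv_mult_group m_assoc)
        qed
        have "cong_mod L (a \<otimes> b \<otimes> inv a \<otimes> inv b) (x \<otimes> y \<otimes> inv x \<otimes> inv y)"
          using mem cU ex inv by (intro cong_mod_mult[OF chD(1)]) auto
        moreover have "x \<otimes> y \<otimes> inv x \<otimes> inv y \<in> ?B"
        proof -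
          have "x \<otimes> y \<otimes> inv x \<otimes> inv y \<in> derived_set G ?A"
            using x y by blast
          then show ?thesis
            unfolding derived_def using x y cK by (auto intro: generate.incl)
        qed
        ultimately show ?thesis
          using cong_mod_in[OF LB(1,2)] LB(3) mem cU by auto
      qed
      then have "derived_set G K \<subseteq> L <#> ?B" by (intro UN_least) simp
      then have "?D \<subseteq> L <#> ?B"
        unfolding derived_def[of G K] by (rule generate_subgroup_incl[OF _ LB(1)])
      then have "?Y \<subseteq> L <#> ?B"
        using mult_sub_least[OF LB(1,2)] by blast
      then show ?case using YK by simp
    qed
    obtain n where "(derived G ^^ n) (carrier G) = {\<one>}"
      using sol solvable_iff_trivial_derived_seq by blast
    then have "K \<subseteq> L <#> ({\<one>} \<inter> K)" using all[of n] by (simp only:)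
    also have "\<dots> \<subseteq> L"
      by (rule mult_sub_least[OF NL(1) order_refl]) (use cL(2) in auto)
    finally have "K \<subseteq> L" .
    then show False using chD(3) by blast
  qed
  then have "?Y = L" using chD(4)[OF Y(1,2,4)] by blast
  then have DL: "?D \<subseteq> L" using Y(3) by simp
  have "a \<otimes> b \<otimes> inv a \<otimes> inv b \<in> derived_set G K" using ab by blast
  then have "a \<otimes> b \<otimes> inv a \<otimes> inv b \<in> ?D" unfolding derived_def by (rule generate.incl)
  then show ?thesis using DL cong_mod_comm_iff ab cK(1) by blast
qed

lemma cong_mod_pow_mult:
  assumes L: "normal_sub L U" and K: "subgroup K G" "K \<subseteq> U"
    and ab: "\<And>a b. a \<in> K \<Longrightarrow> b \<in> K \<Longrightarrow> cong_mod L (a \<otimes> b) (b \<otimes> a)" and a: "a \<in> K" and b: "b \<in> K"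
  shows "cong_mod L ((a \<otimes> b) [^] (n::nat)) (a [^] n \<otimes> b [^] n)"
proof (induction n)
  case 0
  then show ?case using normal_subD[OF L] by (simp add: cong_mod_refl)
next
  case (Suc n)
  note NL = normal_subD[OF L]
  note c = sub_closed[OF K(1)]
  have KU: "x \<in> K \<Longrightarrow> x \<in> U" for x using K(2) by blast
  have mem: "a [^] n \<in> K" "b [^] n \<in> K" "(a \<otimes> b) [^] n \<in> K" "a \<otimes> b \<in> K" "b [^] n \<otimes> a \<in> K"
    "a \<otimes> b [^] n \<in> K" using a b c by auto
  have 1: "cong_mod L ((a \<otimes> b) [^] n \<otimes> (a \<otimes> b)) ((a [^] n \<otimes> b [^] n) \<otimes> (a \<otimes> b))"
    by (rule cong_mod_mult[OF L])
      (use cong_mod_refl[OF NL(1) c(1)[OF mem(4)]] Suc mem c(3) KU in auto)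
  have "cong_mod L ((b [^] n \<otimes> a) \<otimes> b) ((a \<otimes> b [^] n) \<otimes> b)"
    by (rule cong_mod_mult[OF L]) (use mem a b c ab KU cong_mod_refl[OF NL(1)] in auto)
  then have "cong_mod L (a [^] n \<otimes> ((b [^] n \<otimes> a) \<otimes> b)) (a [^] n \<otimes> ((a \<otimes> b [^] n) \<otimes> b))"
    by (rule cong_mod_mult[OF L, rotated -1]) (use mem a b c KU cong_mod_refl[OF NL(1)] in auto)
  then have 2: "cong_mod L ((a [^] n \<otimes> b [^] n) \<otimes> (a \<otimes> b)) ((a [^] n \<otimes> a) \<otimes> (b [^] n \<otimes> b))"
    using a b c(1) by (simp add: m_assoc)
  have "cong_mod L ((a \<otimes> b) [^] n \<otimes> (a \<otimes> b)) ((a [^] n \<otimes> a) \<otimes> (b [^] n \<otimes> b))"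
    by (rule cong_mod_trans[OF NL(1) _ _ _ 1 2]) (use a b mem c(1) in auto)
  then show ?case by simp
qed

lemma coprime_pow_mem:
  assumes L: "subgroup L G" and x: "x \<in> carrier G" "x [^] (m::nat) \<in> L" "x [^] (n::nat) \<in> L" "coprime m n"
  shows "x \<in> L"
proof -
  obtain d :: nat where d: "d > 0" "\<And>j::nat. x [^] j \<in> L \<longleftrightarrow> d dvd j"
    using order_mod[OF L x(1)] by metis
  then have "d = 1" using x by (metis coprime_common_divisor_nat)
  then show ?thesis using d(2)[of 1] x(1) by simp
qed

lemma index_pow_mem:
  assumes L: "normal_sub L U" and W: "subgroup W G" "L \<subseteq> W" "W \<subseteq> U" and x: "x \<in> W"
    and m: "card W = m * card L"
  shows "x [^] m \<in> L"
proof -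
  note NL = normal_subD[OF L]
  have xU: "x \<in> U" using x W by blast
  have xG: "x \<in> carrier G" using x sub_closed[OF W(1)] by blast
  obtain d :: nat where d: "d > 0" "\<And>j::nat. x [^] j \<in> L \<longleftrightarrow> d dvd j"
    using order_mod[OF NL(1) xG] by metis
  have "d * card L dvd m * card L"
    using sub_card_dvd[OF adjoin_subgroup(1)[OF L xU] W(1) adjoin_subgroup(5)[OF L xU W(1,2) x]]
    by (simp add: card_adjoin[OF NL(1) xG d] m)
  then show ?thesis using d sub_pos[OF NL(1)] by simp
qed

text \<open>The elements of \<open>K\<close> whose order modulo \<open>L\<close> is a power of a fixed prime form a normal
  subgroup, because \<open>K/L\<close> is abelian.\<close>

lemma chief_solvable_prime_power:
  assumes sol: "solvable G" and ch: "chief U L K"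
  obtains q k where "Factorial_Ring.prime (q::nat)" "k > 0" "card K = q ^ k * card L"
proof -
  note chD = chiefD[OF ch]
  note NL = normal_subD[OF chD(1)] and NK = normal_subD[OF chD(2)]
  note cU = sub_closed[OF NL(2)] and cK = sub_closed[OF NK(1)] and cL = sub_closed[OF NL(1)]
  have LK: "L \<subseteq> K" using chD(3) by blast
  obtain m where m: "card K = m * card L" "m > 0"
    using sub_index[OF NL(1) NK(1) LK] by blast
  have "m \<noteq> 1"
    using m psubset_card_mono[OF sub_finite[OF NK(1)] chD(3)] by auto
  then obtain q where q: "Factorial_Ring.prime q" "q dvd m"
    using prime_factor_nat by blast
  define e where "e = q ^ multiplicity q (card K)"
  let ?T = "{x \<in> K. x [^] e \<in> L}"
  note ab = chief_solvable_abelian[OF sol ch]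
  have "subgroup ?T G"
  proof (rule subgroup_if_closed)
    show "?T \<subseteq> carrier G" using cK(1) by blast
    show "\<one> \<in> ?T" using cK(2) cL(2) by simp
    fix x y assume xy: "x \<in> ?T" "y \<in> ?T"
    have "cong_mod L ((x \<otimes> y) [^] e) (x [^] e \<otimes> y [^] e)"
      using xy by (intro cong_mod_pow_mult[OF chD(1) NK(1,3) ab]) auto
    then have "(x \<otimes> y) [^] e \<in> L"
      by (rule cong_mod_in[OF NL(1) order_refl, rotated 2]) (use xy cL cK in auto)
    then show "x \<otimes> y \<in> ?T" using xy cK by simp
  qed
  then have "normal_sub ?T U"
    using NK NL(4) cU(1) cK(1) by (auto simp: normal_sub_def conj_by_pow[symmetric])
  moreover have "L \<subseteq> ?T" "?T \<subseteq> K" using cL(5) LK by auto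
  moreover have "?T \<noteq> L"
  proof
    assume T: "?T = L"
    obtain Q where Q: "is_sylow q Q K" using sylow_ex[OF NK(1) q(1)] by blast
    have "Q \<subseteq> ?T"
    proof
      fix x assume x: "x \<in> Q"
      then have "x [^] e = \<one>"
        using pow_card[of Q x] Q unfolding is_sylow_def e_def by auto
      then show "x \<in> ?T" using x Q cL(2) unfolding is_sylow_def by auto
    qed
    then have "\<not> q dvd m"
      using T by (intro sylow_index[OF Q NK(1) NL(1) _ m(1) q(1)]) simp
    then show False using q by simp
  qed
  ultimately have T: "?T = K" using chD(4) by blast
  have "s = q" if s: "Factorial_Ring.prime s" "s dvd m" for s
  proof (rule ccontr)
    assume "s \<noteq> q"
    obtain S where S: "is_sylow s S K" using sylow_ex[OF NK(1) s(1)] by blast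
    have SK: "subgroup S G" "S \<subseteq> K" "card S = s ^ multiplicity s (card K)"
      using S by (auto simp: is_sylow_def)
    have "x \<in> L" if x: "x \<in> S" for x
    proof (rule coprime_pow_mem[OF NL(1)])
      show "x \<in> carrier G" using x SK(2) cK(1) by blast
      show "x [^] e \<in> L" using x SK(2) T by blast
      show "x [^] card S \<in> L" using pow_card[OF SK(1) x] cL(2) by simp
      have "coprime q s" using q(1) s(1) \<open>s \<noteq> q\<close> primes_coprime by metis
      then show "coprime e (card S)"
        unfolding e_def SK(3) by simp
    qed
    then have "\<not> s dvd m"
      by (intro sylow_index[OF S NK(1) NL(1) _ m(1) s(1)]) blast
    then show False using s by simp
  qed
  then obtain k where k: "m = q ^ k"
    using prime_power_eq[OF q(1) m(2)] by blast
  moreover have "k \<noteq> 0" using k \<open>m \<noteq> 1\<close> by (cases k) auto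
  ultimately show thesis using that q(1) m(1) by blast
qed

text \<open>\<open>O\<^bsub>p\<^esub>(G/C) = 1\<close> for the centralizer \<open>C\<close> of a chief factor \<open>K/L\<close> of \<open>p\<close>-power order: the fixed
  points in \<open>K/L\<close> of a normal \<open>p\<close>-subgroup \<open>Y/C\<close> form a nontrivial normal subgroup.\<close>

lemma p_core_mod_centralizer:
  assumes ch: "chief (carrier G) L K" and p: "Factorial_Ring.prime p" "card K = p ^ k * card L"
    and Y: "normal_sub Y (carrier G)" "centralizer_mod K L \<subseteq> Y" "card Y = p ^ j * card (centralizer_mod K L)"
  shows "Y = centralizer_mod K L"
proof -
  note chD = chiefD[OF ch]
  note NL = normal_subD[OF chD(1)] and NK = normal_subD[OF chD(2)] and NY = normal_subD[OF Y(1)]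
  note cK = sub_closed[OF NK(1)]
  let ?C = "centralizer_mod K L"
  have C: "normal_sub ?C (carrier G)" by (rule normal_sub_centralizer[OF chD(1,2)])
  have CY: "normal_sub ?C Y" by (rule normal_sub_restrict[OF C NY(1,3) Y(2)])
  obtain P where P: "is_sylow p P Y" using sylow_ex[OF NY(1) p(1)] by blast
  have PG: "subgroup P G" "P \<subseteq> Y" "card P = p ^ multiplicity p (card Y)"
    using P by (auto simp: is_sylow_def)
  have CP: "?C <#> P = Y" by (rule sylow_mult[OF CY p(1) Y(3) P])
  let ?F = "{y \<in> K. \<forall>g\<in>Y. cong_mod L (conj_by g y) y}"
  have F: "normal_sub ?F (carrier G)"
  proof -
    have "subgroup ?F G"
    proof (rule subgroup_if_closed)
      show "?F \<subseteq> carrier G" using cK(1) by blast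
      show "\<one> \<in> ?F" using cK(2) NY(3) cong_mod_refl[OF NL(1)] by auto
      fix x y assume xy: "x \<in> ?F" "y \<in> ?F"
      have "cong_mod L (conj_by g (x \<otimes> y)) (x \<otimes> y)" if g: "g \<in> Y" for g
      proof -
        have gG: "g \<in> carrier G" using g NY(3) by blast
        then show ?thesis
          using xy g cK(1) by (subst conj_by_mult) (auto intro!: cong_mod_mult[OF chD(1)])
      qed
      then show "x \<otimes> y \<in> ?F" using xy cK(3) by blast
    qed
    moreover have "conj_by h y \<in> ?F" if h: "h \<in> carrier G" and y: "y \<in> ?F" for h y
    proof -
      have "cong_mod L (conj_by g (conj_by h y)) (conj_by h y)" if g: "g \<in> Y" for g
      proof -
        have gG: "g \<in> carrier G" using g NY(3) by blast
        let ?g = "conj_by (inv h) g"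
        have "?g \<in> Y" using NY(4) g h by blast
        then have "cong_mod L (conj_by ?g y) y" using y by blast
        then have "cong_mod L (conj_by h (conj_by ?g y)) (conj_by h y)"
          using cong_mod_conj_by[OF chD(1) h] y cK(1) gG h by auto
        moreover have "conj_by h (conj_by ?g y) = conj_by g (conj_by h y)"
          using y cK(1) gG h by (simp add: conj_by_conj_by conj_by_def[of "inv h" g])
        ultimately show ?thesis by simp
      qed
      then show ?thesis using NK(4)[OF h] y by blast
    qed
    ultimately show ?thesis using NK(3) subgroup_self unfolding normal_sub_def by blast
  qed
  have LF: "L \<subseteq> ?F"
  proof
    fix l assume l: "l \<in> L"
    have "cong_mod L (conj_by g l) l" if "g \<in> Y" for g
      using NL(4)[of g l] l that NY(3) sub_closed[OF NL(1)] unfolding cong_mod_def by blast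
    then show "l \<in> ?F" using l chD(3) by blast
  qed
  obtain y where y: "y \<in> K" "y \<notin> L" "\<And>g. g \<in> P \<Longrightarrow> cong_mod L (conj_by g y) y"
    using fixed_point_mod[OF chD(1,2,3) p PG(1) _ PG(3)] PG(2) NY(3) by (metis subset_trans)
  have "y \<in> ?F"
  proof -
    have "cong_mod L (conj_by g y) y" if g: "g \<in> Y" for g
    proof -
      obtain c x where cx: "c \<in> ?C" "x \<in> P" "g = c \<otimes> x"
        using g CP set_mult_iff[of g ?C P] by blast
      have mem: "c \<in> carrier G" "x \<in> carrier G" "conj_by x y \<in> K"
        using cx PG NY NK(4) y(1) by (auto simp: centralizer_mod_def)
      have 1: "cong_mod L (conj_by c (conj_by x y)) (conj_by x y)"
        using cx(1) mem(3) by (auto simp: centralizer_mod_def acts_trivially_def)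
      have "cong_mod L (conj_by c (conj_by x y)) y"
        by (rule cong_mod_trans[OF NL(1) _ _ _ 1 y(3)[OF cx(2)]]) (use mem y(1) cK(1) in auto)
      then show ?thesis using cx(3) mem y(1) cK(1) by (simp add: conj_by_conj_by)
    qed
    then show ?thesis using y(1) by blast
  qed
  then have "?F = K" using chD(4)[OF F LF] y(2) by blast
  then have "Y \<subseteq> ?C"
    unfolding centralizer_mod_def acts_trivially_def using NY(3) by blast
  then show ?thesis using Y(2) by blast
qed

section \<open>The action of a supersolvable subgroup on a chief factor\<close>

text \<open>If \<open>U\<close> covers \<open>K/L\<close>, that is \<open>K = L (K \<inter> U)\<close>, then \<open>K/L\<close> and \<open>(K \<inter> U)/(L \<inter> U)\<close> are isomorphic as
  groups with an action of \<open>U\<close>.\<close>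

lemma acts_trivially_cover:
  assumes L: "normal_sub L (carrier G)" and K: "normal_sub K (carrier G)" "L \<subseteq> K"
    and U: "subgroup U G" and cov: "K \<subseteq> L <#> (K \<inter> U)"
    and u: "u \<in> U" and tr: "acts_trivially u (K \<inter> U) (L \<inter> U)"
  shows "acts_trivially u K L"
  unfolding acts_trivially_def
proof
  fix x assume x: "x \<in> K"
  note NL = normal_subD[OF L] and NK = normal_subD[OF K(1)]
  obtain l y where ly: "l \<in> L" "y \<in> K \<inter> U" "x = l \<otimes> y"
    using x cov set_mult_iff[of x L "K \<inter> U"] by blast
  have mem: "l \<in> carrier G" "y \<in> carrier G" "u \<in> carrier G"
    using ly u sub_closed(1)[OF U] NL(3) by auto
  have "cong_mod (L \<inter> U) (conj_by u y) y" using tr ly unfolding acts_trivially_def by blast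
  then have 1: "cong_mod L (conj_by u y) y" by (simp add: cong_mod_def)
  have "cong_mod L (conj_by u l) l"
    using NL(4)[OF mem(3) ly(1)] ly(1) sub_closed[OF NL(1)] by (simp add: cong_mod_def)
  then have "cong_mod L (conj_by u l \<otimes> conj_by u y) (l \<otimes> y)"
    using mem by (intro cong_mod_mult[OF L _ _ _ _ _ 1]) auto
  then show "cong_mod L (conj_by u x) x" using ly(3) mem by (simp add: conj_by_mult)
qed

lemma card_cover:
  assumes L: "normal_sub L (carrier G)" and K: "normal_sub K (carrier G)" "L \<subseteq> K"
    and U: "subgroup U G" and cov: "K \<subseteq> L <#> (K \<inter> U)" and m: "card K = m * card L"
  shows "card (K \<inter> U) = m * card (L \<inter> U)"
proof -
  note NL = normal_subD[OF L] and NK = normal_subD[OF K(1)]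
  have KU: "subgroup (K \<inter> U) G" using sub_Int[OF NK(1) U] .
  have "L <#> (K \<inter> U) = K"
    using cov mult_sub_least[OF NK(1) K(2), of "K \<inter> U"] by blast
  moreover have "L \<inter> (K \<inter> U) = L \<inter> U" using K(2) by blast
  ultimately have "card K * card (L \<inter> U) = card L * card (K \<inter> U)"
    using card_mult[OF NL(1) KU] by simp
  then have "card L * (m * card (L \<inter> U)) = card L * card (K \<inter> U)"
    using m by (simp add: mult.commute mult.left_commute)
  then show ?thesis using sub_pos[OF NL(1)] by simp
qed

text \<open>\<open>|K : L (K \<inter> U)|\<close> is a power of \<open>p\<close> and divides \<open>|K U : U|\<close>, hence \<open>|G : U|\<close>.\<close>

lemma cover_of_index:
  assumes L: "normal_sub L (carrier G)" and K: "normal_sub K (carrier G)" "L \<subseteq> K"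
    and p: "Factorial_Ring.prime p" "card K = p ^ k * card L"
    and U: "subgroup U G" "order G = m * card U" "\<not> p dvd m"
  shows "K \<subseteq> L <#> (K \<inter> U)"
proof -
  note NL = normal_subD[OF L] and NK = normal_subD[OF K(1)]
  have UG: "U \<subseteq> carrier G" using subgroup.subset[OF U(1)] .
  have KU: "subgroup (K \<inter> U) G" using sub_Int[OF NK(1) U(1)] .
  let ?Y = "L <#> (K \<inter> U)"
  have Y: "subgroup ?Y G" "L \<subseteq> ?Y" "K \<inter> U \<subseteq> ?Y"
    using normal_mult_subgroup[OF L KU] UG by auto
  have YK: "?Y \<subseteq> K" using mult_sub_least[OF NK(1) K(2)] by blast
  obtain a where a: "card K = a * card ?Y" using sub_index[OF Y(1) NK(1) YK] by blast
  obtain b where b: "card ?Y = b * card L" using sub_index[OF NL(1) Y(1,2)] by blast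
  have "a * b = p ^ k" using a b p(2) sub_pos[OF NL(1)] by (simp add: mult.assoc[symmetric])
  then obtain i where i: "a = p ^ i" using divides_primepow_nat[OF p(1)] by (metis dvd_triv_left)
  have Z: "subgroup (K <#> U) G" "U \<subseteq> K <#> U"
    using normal_mult_subgroup[OF K(1) U(1) UG] by auto
  obtain c where c: "card (K <#> U) = c * card U" using sub_index[OF U(1) Z] by blast
  obtain d where d: "card ?Y = d * card (K \<inter> U)" using sub_index[OF KU Y(1,3)] by blast
  have "card (K <#> U) * card (K \<inter> U) = card K * card U" by (rule card_mult[OF NK(1) U(1)])
  then have "card U * (c * card (K \<inter> U)) = card U * (a * d * card (K \<inter> U))"
    unfolding c a d by (simp add: mult.commute mult.left_commute)
  then have "c = a * d" using sub_pos[OF KU] sub_pos[OF U(1)] by simp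
  moreover have "c dvd m"
  proof -
    have "c * card U dvd m * card U" using sub_card_order[OF Z(1)] U(2) c by simp
    then show ?thesis using sub_pos[OF U(1)] by simp
  qed
  ultimately have "\<not> p dvd a" using U(3) by (metis dvd_mult2 dvd_trans)
  then have "a = 1" using i by (cases i) auto
  then have "?Y = K" using card_subset_eq[OF sub_finite[OF NK(1)] YK] a by simp
  then show ?thesis by simp
qed

text \<open>In a section of \<open>p\<close>-power order that \<open>U\<close> covers these elements form, modulo the centralizer of the section, the
  normal Sylow \<open>p\<close>-subgroup of the group that \<open>U\<close> induces.\<close>

definition chain_stabilizer :: "'a set \<Rightarrow> 'a set \<Rightarrow> 'a set \<Rightarrow> 'a set" where
  "chain_stabilizer U K L = {u \<in> U. \<forall>B A. chief U B A \<and> L \<inter> U \<subseteq> B \<and> A \<subseteq> K \<inter> U \<longrightarrow> acts_trivially u A B}"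

lemma chain_stabilizer_normal:
  assumes U: "subgroup U G"
  shows "normal_sub (chain_stabilizer U K L) U"
proof -
  have "subgroup (chain_stabilizer U K L) G"
  proof (rule subgroup_if_closed)
    show "chain_stabilizer U K L \<subseteq> carrier G"
      using sub_closed(1)[OF U] by (auto simp: chain_stabilizer_def)
    have "acts_trivially \<one> A B" if "chief U B A" for A B
      using acts_trivially_one normal_subD(1) chiefD(1,2)[OF that] by simp
    then show "\<one> \<in> chain_stabilizer U K L"
      using sub_closed(2)[OF U] by (simp add: chain_stabilizer_def)
    fix x y assume xy: "x \<in> chain_stabilizer U K L" "y \<in> chain_stabilizer U K L"
    have "acts_trivially (x \<otimes> y) A B" if c: "chief U B A" "L \<inter> U \<subseteq> B" "A \<subseteq> K \<inter> U" for A B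
      using acts_trivially_mult[OF chiefD(1)[OF c(1)] normal_subD(3,1)[OF chiefD(2)[OF c(1)]]] xy c
      unfolding chain_stabilizer_def by blast
    then show "x \<otimes> y \<in> chain_stabilizer U K L"
      using xy sub_closed(3)[OF U] unfolding chain_stabilizer_def by blast
  qed
  moreover have "conj_by u x \<in> chain_stabilizer U K L" if ux: "u \<in> U" "x \<in> chain_stabilizer U K L" for u x
  proof -
    have "acts_trivially (conj_by u x) A B" if c: "chief U B A" "L \<inter> U \<subseteq> B" "A \<subseteq> K \<inter> U" for A B
      using acts_trivially_conj_by[OF chiefD(1)[OF c(1)] chiefD(2)[OF c(1)] _ ux(1)] ux c
      unfolding chain_stabilizer_def by blast
    then show ?thesis using ux sub_conj_by[OF U] unfolding chain_stabilizer_def by blast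
  qed
  ultimately show ?thesis
    using U unfolding normal_sub_def by (auto simp: chain_stabilizer_def)
qed

text \<open>This transfers \<open>stability\<close> from \<open>(K \<inter> U)/(L \<inter> U)\<close> to \<open>K/L\<close>.\<close>

lemma chain_stabilizer_coprime:
  assumes L: "normal_sub L (carrier G)" and K: "normal_sub K (carrier G)" "L \<subseteq> K"
    and U: "subgroup U G" and cov: "K \<subseteq> L <#> (K \<inter> U)" and m: "card K = m * card L"
    and u: "u \<in> chain_stabilizer U K L" "u [^] (n::nat) \<in> centralizer_mod K L" "coprime n m"
  shows "u \<in> centralizer_mod K L"
proof -
  have uU: "u \<in> U" using u by (simp add: chain_stabilizer_def)
  have UG: "U \<subseteq> carrier G" using subgroup.subset[OF U] .
  have LU: "normal_sub (L \<inter> U) U" and KU: "normal_sub (K \<inter> U) U"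
    using normal_sub_Int[OF L U UG] normal_sub_Int[OF K(1) U UG] .
  have LU': "subgroup (L \<inter> U) G" using normal_subD(1)[OF LU] .
  have "acts_trivially u (K \<inter> U) (L \<inter> U)"
  proof (rule stability[OF LU KU _ uU _ _ card_cover[OF L K U cov m] u(3)])
    show "L \<inter> U \<subseteq> K \<inter> U" using K(2) by blast
    show "acts_trivially u A B" if "chief U B A" "L \<inter> U \<subseteq> B" "A \<subseteq> K \<inter> U" for B A
      using u(1) that unfolding chain_stabilizer_def by blast
    have un: "u [^] n \<in> U" "u [^] n \<in> carrier G" using sub_closed(5)[OF U uU] UG by auto
    show "acts_trivially (u [^] n) (K \<inter> U) (L \<inter> U)"
      unfolding acts_trivially_def cong_mod_def
    proof
      fix a assume a: "a \<in> K \<inter> U"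
      have "conj_by (u [^] n) a \<otimes> inv a \<in> L"
        using u(2) a unfolding centralizer_mod_def acts_trivially_def cong_mod_def by blast
      moreover have "conj_by (u [^] n) a \<otimes> inv a \<in> U"
        using sub_conj_by[OF U un(1)] a sub_closed[OF U] by auto
      ultimately show "conj_by (u [^] n) a \<otimes> inv a \<in> L \<inter> U" by blast
    qed
  qed
  then show ?thesis
    using acts_trivially_cover[OF L K U cov uU] uU UG unfolding centralizer_mod_def by blast
qed

text \<open>The following lemmas share a setting: \<open>K/L\<close> is a normal section of \<open>p\<close>-power order, covered by the
  supersolvable subgroup \<open>U\<close>, so that the \<open>U\<close>-chief factors inside it have order \<open>p\<close>.\<close>

lemma chief_in_section:
  assumes L: "normal_sub L (carrier G)" and K: "normal_sub K (carrier G)" "L \<subseteq> K"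
    and p: "Factorial_Ring.prime p" "card K = p ^ k * card L"
    and U: "subgroup U G" "supersolvable (G\<lparr>carrier := U\<rparr>)" and cov: "K \<subseteq> L <#> (K \<inter> U)"
    and ch: "chief U B A" "L \<inter> U \<subseteq> B" "A \<subseteq> K \<inter> U"
  shows "card A = p * card B"
proof -
  note NB = normal_subD[OF chiefD(1)[OF ch(1)]] and NA = normal_subD[OF chiefD(2)[OF ch(1)]]
  have S: "subgroup (K \<inter> U) G" "subgroup (L \<inter> U) G"
    using sub_Int[OF normal_subD(1)[OF K(1)] U(1)] sub_Int[OF normal_subD(1)[OF L] U(1)] .
  obtain q where q: "Factorial_Ring.prime q" "card A = q * card B"
    using supersolvable_chief_prime[OF U U(1) order_refl ch(1)] by metis
  obtain a where a: "card (K \<inter> U) = a * card A" using sub_index[OF NA(1) S(1) ch(3)] by blast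
  obtain b where b: "card B = b * card (L \<inter> U)" using sub_index[OF S(2) NB(1) ch(2)] by blast
  have "p ^ k * card (L \<inter> U) = a * q * b * card (L \<inter> U)"
    using card_cover[OF L K U(1) cov p(2)] a b q(2) by (metis mult.assoc)
  then have "p ^ k = a * q * b" using sub_pos[OF S(2)] by (simp only: mult_cancel2) simp
  then have "q dvd p ^ k" by simp
  then have "q = p" using q(1) p(1) prime_dvd_power primes_dvd_imp_eq by metis
  then show ?thesis using q by simp
qed

lemma comm_in_stabilizer:
  assumes "subgroup U G" "supersolvable (G\<lparr>carrier := U\<rparr>)" "u \<in> U" "v \<in> U"
  shows "u \<otimes> v \<otimes> inv (v \<otimes> u) \<in> chain_stabilizer U K L"
proof -
  have "acts_trivially (u \<otimes> v \<otimes> inv (v \<otimes> u)) A B" if ch: "chief U B A" for A B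
    using supersolvable_chief_prime[OF assms(1,2,1) order_refl ch]
      prime_factor_comm[OF chiefD(1-3)[OF ch] _ _ assms(3,4)] by metis
  then show ?thesis using sub_closed[OF assms(1)] assms(3,4) by (simp add: chain_stabilizer_def)
qed

lemma exp_in_stabilizer:
  assumes "normal_sub L (carrier G)" "normal_sub K (carrier G)" "L \<subseteq> K"
    "Factorial_Ring.prime p" "card K = p ^ k * card L"
    "subgroup U G" "supersolvable (G\<lparr>carrier := U\<rparr>)" "K \<subseteq> L <#> (K \<inter> U)" "u \<in> U"
  shows "u [^] (p - 1) \<in> chain_stabilizer U K L"
proof -
  have "acts_trivially (u [^] (p - 1)) A B" if ch: "chief U B A" "L \<inter> U \<subseteq> B" "A \<subseteq> K \<inter> U" for A B
    using prime_factor_exp[OF chiefD(1-3)[OF ch(1)] assms(4) chief_in_section[OF assms(1-8) ch] assms(9)] .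
  then show ?thesis using sub_closed(5)[OF assms(6)] assms(9) by (auto simp: chain_stabilizer_def)
qed

text \<open>The \<open>(p - 1)\<close>-th powers stabilize the chain, and \<open>p - 1\<close> is prime to the order of a \<open>p\<close>-element.\<close>

lemma p_group_in_stabilizer:
  assumes "normal_sub L (carrier G)" "normal_sub K (carrier G)" "L \<subseteq> K"
    "Factorial_Ring.prime p" "card K = p ^ k * card L"
    "subgroup U G" "supersolvable (G\<lparr>carrier := U\<rparr>)" "K \<subseteq> L <#> (K \<inter> U)"
    and P: "subgroup P G" "P \<subseteq> U" "card P = p ^ i"
  shows "P \<subseteq> chain_stabilizer U K L"
proof
  fix x assume x: "x \<in> P"
  note R = normal_subD(1)[OF chain_stabilizer_normal[OF assms(6), of K L]]
  have "x [^] (p ^ i) \<in> chain_stabilizer U K L"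
    using pow_card[OF P(1) x] P(3) sub_closed(2)[OF R] by simp
  moreover have "x [^] (p - 1) \<in> chain_stabilizer U K L"
    using exp_in_stabilizer[OF assms(1-8)] x P(2) by blast
  moreover have "coprime (p ^ i) (p - 1)"
  proof -
    have "coprime p (p - 1)"
      using prime_gt_1_nat[OF assms(4)] by (intro coprime_diff_one_right_nat) auto
    then show ?thesis by simp
  qed
  ultimately show "x \<in> chain_stabilizer U K L"
    using coprime_pow_mem[OF R sub_closed(1)[OF P(1) x]] by blast
qed

text \<open>Let \<open>R\<close> be the chain stabilizer and \<open>C\<close> the centralizer of \<open>K/L\<close>. Elements of \<open>R\<close> of order prime
  to \<open>p\<close> lie in \<open>C\<close> by stability, so \<open>R = (C \<inter> R) P\<close> and \<open>C P = C R\<close>, where \<open>R\<close> is normal in \<open>U\<close>.\<close>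

lemma sylow_times_centralizer_normalised:
  assumes L: "normal_sub L (carrier G)" and K: "normal_sub K (carrier G)" "L \<subseteq> K"
    and p: "Factorial_Ring.prime p" "card K = p ^ k * card L"
    and U: "subgroup U G" "supersolvable (G\<lparr>carrier := U\<rparr>)" and cov: "K \<subseteq> L <#> (K \<inter> U)"
    and P: "is_sylow p P U"
  shows "\<And>u y. u \<in> U \<Longrightarrow> y \<in> centralizer_mod K L <#> P \<Longrightarrow> conj_by u y \<in> centralizer_mod K L <#> P"
proof -
  let ?C = "centralizer_mod K L" and ?R = "chain_stabilizer U K L"
  have C: "normal_sub ?C (carrier G)" by (rule normal_sub_centralizer[OF L K(1)])
  note NC = normal_subD[OF C]
  have R: "normal_sub ?R U" by (rule chain_stabilizer_normal[OF U(1)])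
  note NR = normal_subD[OF R]
  have RG: "?R \<subseteq> carrier G" using subgroup.subset[OF NR(1)] .
  have PG: "subgroup P G" "P \<subseteq> U" "card P = p ^ multiplicity p (card U)"
    using P by (auto simp: is_sylow_def)
  have PR: "P \<subseteq> ?R"
    by (rule p_group_in_stabilizer[OF L K p U cov PG])
  have sP: "is_sylow p P ?R"
    by (rule sylow_mono[OF P NR(1) PR NR(3) U(1) p(1)])
  have CR: "normal_sub (?C \<inter> ?R) ?R"
    by (rule normal_sub_Int[OF C NR(1) RG])
  have "\<exists>S. is_sylow s S ?R \<and> S \<subseteq> ?C \<inter> ?R" if s: "Factorial_Ring.prime s" "s \<noteq> p" for s
  proof -
    obtain S where S: "is_sylow s S ?R" using sylow_ex[OF NR(1) s(1)] by blast
    have SG: "subgroup S G" "S \<subseteq> ?R" "card S = s ^ multiplicity s (card ?R)"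
      using S by (auto simp: is_sylow_def)
    have "x \<in> ?C" if x: "x \<in> S" for x
    proof (rule chain_stabilizer_coprime[OF L K U(1) cov p(2)])
      show "x \<in> ?R" using x SG by blast
      show "x [^] card S \<in> ?C" using pow_card[OF SG(1) x] sub_closed(2)[OF NC(1)] by simp
      have "coprime s p" using s p(1) primes_coprime by metis
      then show "coprime (card S) (p ^ k)" unfolding SG(3) by simp
    qed
    then show ?thesis using S SG(2) by blast
  qed
  then obtain j where j: "card ?R = p ^ j * card (?C \<inter> ?R)"
    using index_prime_power[OF NR(1) normal_subD(1,3)[OF CR] p(1)] by metis
  have eq: "(?C \<inter> ?R) <#> P = ?R" by (rule sylow_mult[OF CR p(1) j sP])
  have CPs: "subgroup (?C <#> P) G" "?C \<subseteq> ?C <#> P" "P \<subseteq> ?C <#> P"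
    using normal_mult_subgroup[OF C PG(1)] subgroup.subset[OF PG(1)] by auto
  fix u y assume u: "u \<in> U" and y: "y \<in> ?C <#> P"
  have uG: "u \<in> carrier G" using sub_closed(1)[OF U(1) u] .
  obtain c x where cx: "c \<in> ?C" "x \<in> P" "y = c \<otimes> x"
    using y set_mult_iff[of y ?C P] by blast
  have mem: "c \<in> carrier G" "x \<in> carrier G" using cx NC(3) sub_closed(1)[OF PG(1)] by auto
  have "conj_by u x \<in> ?R" using NR(4)[OF u] cx(2) PR by blast
  then have "conj_by u x \<in> (?C \<inter> ?R) <#> P" using eq by simp
  also have "\<dots> \<subseteq> ?C <#> P"
    using mult_sub_least[OF CPs(1), of "?C \<inter> ?R" P] CPs by blast
  finally have "conj_by u x \<in> ?C <#> P" .
  moreover have "conj_by u c \<in> ?C <#> P" using NC(4)[OF uG cx(1)] CPs(2) by blast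
  ultimately show "conj_by u y \<in> ?C <#> P"
    using sub_closed(3)[OF CPs(1)] cx(3) mem uG by (simp add: conj_by_mult)
qed

text \<open>The index of \<open>Z\<close> divides the coprime indices of \<open>U\<close> and of a conjugate of \<open>V\<close>. The conjugation
  serves to compare Sylow subgroups of \<open>U\<close> and \<open>V\<close>.\<close>

lemma coprime_cover:
  assumes Z: "subgroup Z G" and U: "subgroup U G" "subgroup V G"
    and i: "order G = m * card U" "order G = n * card V" "coprime m n"
    and UZ: "U \<subseteq> Z" and h: "h \<in> carrier G" "\<And>v. v \<in> V \<Longrightarrow> conj_by h v \<in> Z"
  shows "Z = carrier G"
proof -
  have 1: "card U dvd card Z" using sub_card_dvd[OF U(1) Z UZ] .
  note c = conj_by_image_subgroup[OF U(2) h(1)]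
  have "card V dvd card Z" using sub_card_dvd[OF c(1) Z] c(2) h(2) by auto
  then obtain b where b: "card Z = b * card V" by (metis dvd_def mult.commute)
  obtain a where a: "card Z = a * card U" using 1 by (metis dvd_def mult.commute)
  obtain z where z: "order G = z * card Z"
    using sub_card_order[OF Z] by (metis dvd_def mult.commute)
  have "z dvd m"
  proof -
    have "m * card U = z * a * card U" using i(1) z a by (metis mult.assoc)
    then have "m = z * a" using sub_pos[OF U(1)] by (simp only: mult_cancel2) simp
    then show ?thesis by simp
  qed
  moreover have "z dvd n"
  proof -
    have "n * card V = z * b * card V" using i(2) z b by (metis mult.assoc)
    then have "n = z * b" using sub_pos[OF U(2)] by (simp only: mult_cancel2) simp
    then show ?thesis by simp
  qed
  ultimately have "z = 1" using i(3) by (metis coprime_common_divisor_nat)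
  then show ?thesis
    using card_subset_eq[OF fin subgroup.subset[OF Z]] z by (simp add: order_def)
qed

lemma sylow_of_index:
  assumes "subgroup U G" "order G = m * card U" "\<not> p dvd m" "Factorial_Ring.prime p" "is_sylow p P U"
  shows "is_sylow p P (carrier G)"
proof -
  have "m > 0" using assms(2) fin order_gt_0_iff_finite by (metis gr0I mult_0 less_irrefl)
  then have "multiplicity p (order G) = multiplicity p m + multiplicity p (card U)"
    using assms sub_pos[OF assms(1)] by (simp add: prime_elem_multiplicity_mult_distrib)
  then have "multiplicity p (order G) = multiplicity p (card U)"
    using assms(3) by (simp add: not_dvd_imp_multiplicity_0)
  then show ?thesis using assms(5) sub_closed(1)[OF assms(1)] by (auto simp: is_sylow_def order_def)
qed

text \<open>A normal subgroup \<open>C P\<close> gives a normal \<open>p\<close>-subgroup of \<open>G/C\<close>, but \<open>O\<^bsub>p\<^esub>(G/C) = 1\<close>.\<close>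

lemma sylow_in_centralizer:
  assumes ch: "chief (carrier G) L K" and p: "Factorial_Ring.prime p" "card K = p ^ k * card L"
    and PG: "subgroup P G" "card P = p ^ i" and nor: "normal_sub (centralizer_mod K L <#> P) (carrier G)"
  shows "P \<subseteq> centralizer_mod K L"
proof -
  note chD = chiefD[OF ch]
  let ?C = "centralizer_mod K L"
  have C: "normal_sub ?C (carrier G)" by (rule normal_sub_centralizer[OF chD(1,2)])
  note NC = normal_subD[OF C]
  have Y: "?C \<subseteq> ?C <#> P" "P \<subseteq> ?C <#> P" using mult_sub_incl[OF NC(1) PG(1)] .
  obtain m where m: "card (?C <#> P) = m * card ?C"
    using sub_index[OF NC(1) normal_subD(1)[OF nor] Y(1)] by blast
  have "m * card ?C * card (?C \<inter> P) = card ?C * card P"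
    using card_mult[OF NC(1) PG(1)] m by simp
  then have "card ?C * (m * card (?C \<inter> P)) = card ?C * card P"
    by (simp only: ac_simps)
  then have "m * card (?C \<inter> P) = card P" using sub_pos[OF NC(1)] by (simp only: mult_cancel1) simp
  then have "m dvd p ^ i" using PG(2) by (metis dvd_triv_left)
  then obtain j where "m = p ^ j" using divides_primepow_nat[OF p(1)] by blast
  then have "?C <#> P = ?C" using p_core_mod_centralizer[OF ch p nor Y(1)] m by blast
  then show ?thesis using Y(2) by simp
qed

lemma conj_by_mult_image:
  assumes C: "normal_sub C (carrier G)" and P: "subgroup P G" and h: "h \<in> carrier G"
  shows "conj_by h ` (C <#> P) = C <#> conj_by h ` P"
proof -
  note NC = normal_subD[OF C]
  have 1: "conj_by g ` (C <#> Q) \<subseteq> C <#> conj_by g ` Q" if g: "g \<in> carrier G" "subgroup Q G" for g Q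
  proof
    fix x assume "x \<in> conj_by g ` (C <#> Q)"
    then obtain y where y: "y \<in> C <#> Q" "x = conj_by g y" by blast
    then obtain c z where cz: "c \<in> C" "z \<in> Q" "y = c \<otimes> z"
      using set_mult_iff[of y C Q] by blast
    then have "x = conj_by g c \<otimes> conj_by g z"
      using y g NC(3) sub_closed(1)[OF g(2)] by (simp add: conj_by_mult subset_iff)
    then show "x \<in> C <#> conj_by g ` Q"
      using NC(4)[OF g(1) cz(1)] cz(2) set_mult_iff[of x C "conj_by g ` Q"] by blast
  qed
  have PG: "P \<subseteq> carrier G" using subgroup.subset[OF P] .
  have Q: "subgroup (conj_by h ` P) G" using conj_by_image_subgroup[OF P h] by blast
  have cancel: "conj_by (inv h) ` conj_by h ` P = P"
    using h PG by (force simp: image_image subset_iff)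
  have "C <#> conj_by h ` P \<subseteq> conj_by h ` (C <#> P)"
  proof
    fix x assume x: "x \<in> C <#> conj_by h ` P"
    then have xG: "x \<in> carrier G"
      using mult_sub_least[OF subgroup_self NC(3) subgroup.subset[OF Q]] by blast
    have "conj_by (inv h) x \<in> C <#> conj_by (inv h) ` conj_by h ` P"
      using 1[OF inv_closed[OF h] Q] x by blast
    then have "conj_by h (conj_by (inv h) x) \<in> conj_by h ` (C <#> P)" unfolding cancel by blast
    then show "x \<in> conj_by h ` (C <#> P)" using xG h by simp
  qed
  then show ?thesis using 1[OF h P] by blast
qed

text \<open>Let \<open>Q\<close> be a Sylow \<open>p\<close>-subgroup of \<open>V\<close>. The subgroups \<open>U\<close> and \<open>V\<close> normalise \<open>C P\<close> and \<open>C Q\<close>, which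
  are conjugate, so the index of the normalizer of \<open>C P\<close> divides two coprime numbers.\<close>

lemma coprime_ss_p'_action:
  assumes ch: "chief (carrier G) L K" and p: "Factorial_Ring.prime p" "card K = p ^ k * card L"
    and U: "subgroup U G" "supersolvable (G\<lparr>carrier := U\<rparr>)" "order G = m * card U" "\<not> p dvd m"
    and V: "subgroup V G" "supersolvable (G\<lparr>carrier := V\<rparr>)" "order G = n * card V" "\<not> p dvd n"
    and cop: "coprime m n" and P: "is_sylow p P (carrier G)" "P \<subseteq> U"
  shows "P \<subseteq> centralizer_mod K L"
proof -
  note chD = chiefD[OF ch]
  let ?C = "centralizer_mod K L"
  have LK: "L \<subseteq> K" using chD(3) by blast
  have C: "normal_sub ?C (carrier G)" by (rule normal_sub_centralizer[OF chD(1,2)])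
  note NC = normal_subD[OF C]
  have UG: "U \<subseteq> carrier G" "V \<subseteq> carrier G" using subgroup.subset U V by blast+
  have PG: "subgroup P G" "card P = p ^ multiplicity p (card (carrier G))"
    using P by (auto simp: is_sylow_def)
  have PU: "is_sylow p P U" by (rule sylow_mono[OF P(1) U(1) P(2) UG(1) subgroup_self p(1)])
  obtain Q where Q: "is_sylow p Q V" using sylow_ex[OF V(1) p(1)] by blast
  have QG: "subgroup Q G" using Q by (simp add: is_sylow_def)
  have Q': "is_sylow p Q (carrier G)" by (rule sylow_of_index[OF V(1,3,4) p(1) Q])
  obtain h where h: "h \<in> carrier G" "P = conj_by h ` Q"
    using sylow_conj_eq[OF subgroup_self Q' P(1) p(1)] by blast
  have CQ: "?C <#> P = conj_by h ` (?C <#> Q)" using conj_by_mult_image[OF C QG h(1)] h(2) by simp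
  have CPs: "subgroup (?C <#> P) G"
    using normal_mult_subgroup[OF C PG(1) subgroup.subset[OF PG(1)]] by blast
  have CQs: "subgroup (?C <#> Q) G"
    using normal_mult_subgroup[OF C QG subgroup.subset[OF QG]] by blast
  have sub: "?C <#> P \<subseteq> carrier G" "?C <#> Q \<subseteq> carrier G"
    using subgroup.subset CPs CQs by blast+
  have "set_normalizer (?C <#> P) = carrier G"
  proof (rule coprime_cover[OF set_normalizer_subgroup[OF sub(1)] U(1) V(1) U(3) V(3) cop _ h(1)])
    show "U \<subseteq> set_normalizer (?C <#> P)"
      using sylow_times_centralizer_normalised[OF chD(1,2) LK p U(1,2)
          cover_of_index[OF chD(1,2) LK p U(1,3,4)] PU] UG(1)
      unfolding set_normalizer_iff[OF sub(1)] subset_iff by blast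
    show "conj_by h v \<in> set_normalizer (?C <#> P)" if v: "v \<in> V" for v
    proof -
      have vG: "v \<in> carrier G" using v UG by blast
      have "conj_by (conj_by h v) y \<in> ?C <#> P" if y: "y \<in> ?C <#> P" for y
      proof -
        obtain z where z: "z \<in> ?C <#> Q" "y = conj_by h z" using y CQ by blast
        have "conj_by v z \<in> ?C <#> Q"
          using sylow_times_centralizer_normalised[OF chD(1,2) LK p V(1,2)
              cover_of_index[OF chD(1,2) LK p V(1,3,4)] Q v z(1)] .
        moreover have "conj_by (conj_by h v) y = conj_by h (conj_by v z)"
          using z sub(2) vG h(1) by (simp add: conj_by_conj_by conj_by_def[of h v] subset_iff)
        ultimately show ?thesis using CQ by blast
      qed
      then show ?thesis using vG h(1) by (simp add: set_normalizer_iff[OF sub(1)])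
    qed
  qed
  then have "normal_sub (?C <#> P) (carrier G)"
    using CPs subgroup_self set_normalizer_iff[OF sub(1)] sub(1) by (auto simp: normal_sub_def)
  then show ?thesis by (rule sylow_in_centralizer[OF ch p PG])
qed

text \<open>When \<open>W/C\<close> is a \<open>p'\<close>-group, every element of the chain stabilizer inside \<open>W\<close> lies in \<open>C\<close> by
  stability. So \<open>U\<close> induces an abelian group of exponent dividing \<open>p - 1\<close> on \<open>K/L\<close>.\<close>

lemma comm_in_centralizer:
  assumes L: "normal_sub L (carrier G)" and K: "normal_sub K (carrier G)" "L \<subseteq> K"
    and p: "Factorial_Ring.prime p" "card K = p ^ k * card L"
    and U: "subgroup U G" "supersolvable (G\<lparr>carrier := U\<rparr>)" and cov: "K \<subseteq> L <#> (K \<inter> U)"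
    and W: "subgroup W G" "centralizer_mod K L \<subseteq> W" "U \<subseteq> W" "card W = n * card (centralizer_mod K L)" "\<not> p dvd n"
    and u: "u \<in> U" "v \<in> U"
  shows "cong_mod (centralizer_mod K L) (u \<otimes> v) (v \<otimes> u)" "u [^] (p - 1) \<in> centralizer_mod K L"
proof -
  have C: "normal_sub (centralizer_mod K L) (carrier G)" by (rule normal_sub_centralizer[OF L K(1)])
  have "x \<in> centralizer_mod K L" if x: "x \<in> chain_stabilizer U K L" for x
  proof (rule chain_stabilizer_coprime[OF L K U(1) cov p(2) x])
    show "x [^] n \<in> centralizer_mod K L"
      using index_pow_mem[OF C W(1,2) subgroup.subset[OF W(1)] _ W(4)] x W(3)
      by (auto simp: chain_stabilizer_def)
    have "coprime p n" using p(1) W(5) prime_imp_coprime by blast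
    then show "coprime n (p ^ k)" by (simp add: coprime_commute)
  qed
  then show "cong_mod (centralizer_mod K L) (u \<otimes> v) (v \<otimes> u)" "u [^] (p - 1) \<in> centralizer_mod K L"
    using comm_in_stabilizer[OF U u] exp_in_stabilizer[OF L K p U cov u(1)] unfolding cong_mod_def
    by blast+
qed

text \<open>The preimage of the centralizer of the image of \<open>S\<close> in \<open>G/C\<close>.\<close>

definition central_mod :: "'a set \<Rightarrow> 'a set \<Rightarrow> 'a set" where
  "central_mod C S = {g \<in> carrier G. \<forall>x\<in>S. cong_mod C (g \<otimes> x) (x \<otimes> g)}"

lemma central_mod_iff:
  assumes "normal_sub C (carrier G)" "g \<in> carrier G" "x \<in> carrier G"
  shows "cong_mod C (g \<otimes> x) (x \<otimes> g) \<longleftrightarrow> cong_mod C (conj_by g x) x"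
  using assms by (simp add: cong_mod_def conj_by_def m_assoc inv_mult_group)

lemma central_mod_subgroup:
  assumes C: "normal_sub C (carrier G)" and S: "S \<subseteq> carrier G"
  shows "subgroup (central_mod C S) G"
proof (rule subgroup_if_closed)
  note NC = normal_subD[OF C]
  show "central_mod C S \<subseteq> carrier G" by (auto simp: central_mod_def)
  show "\<one> \<in> central_mod C S"
    using S cong_mod_refl[OF NC(1)] by (auto simp: central_mod_def subset_iff)
  fix g h assume gh: "g \<in> central_mod C S" "h \<in> central_mod C S"
  have G: "g \<in> carrier G" "h \<in> carrier G" using gh by (auto simp: central_mod_def)
  have "cong_mod C (conj_by (g \<otimes> h) x) x" if x: "x \<in> S" for x
  proof -
    have xG: "x \<in> carrier G" using x S by blast
    have 1: "cong_mod C (conj_by g x) x" "cong_mod C (conj_by h x) x"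
      using gh x G xG central_mod_iff[OF C] by (auto simp: central_mod_def)
    have 2: "cong_mod C (conj_by g (conj_by h x)) (conj_by g x)"
      by (rule cong_mod_conj_by[OF C G(1) _ xG 1(2)]) (use G xG in auto)
    show ?thesis
      using cong_mod_trans[OF NC(1) _ _ xG 2 1(1)] G xG by (simp add: conj_by_conj_by)
  qed
  then show "g \<otimes> h \<in> central_mod C S"
    using G S central_mod_iff[OF C] by (auto simp: central_mod_def subset_iff)
qed

text \<open>Both subgroups contain Sylow \<open>s\<close>-subgroups of \<open>G\<close>, which are conjugate and, modulo \<open>C\<close>,
  centralised by these subgroups. So the index of the centralizer of \<open>S\<close> divides two coprime numbers.\<close>

lemma sylow_central:
  assumes C: "normal_sub C (carrier G)"
    and U: "subgroup U G" "order G = m * card U" "\<And>u v. u \<in> U \<Longrightarrow> v \<in> U \<Longrightarrow> cong_mod C (u \<otimes> v) (v \<otimes> u)"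
    and V: "subgroup V G" "order G = n * card V" "\<And>u v. u \<in> V \<Longrightarrow> v \<in> V \<Longrightarrow> cong_mod C (u \<otimes> v) (v \<otimes> u)"
    and cop: "coprime m n" and s: "Factorial_Ring.prime s" "\<not> s dvd m" "\<not> s dvd n"
  shows "\<exists>S. is_sylow s S (carrier G) \<and> S \<subseteq> central_mod C (carrier G)"
proof -
  have UG: "U \<subseteq> carrier G" "V \<subseteq> carrier G" using subgroup.subset U V by blast+
  obtain S where S: "is_sylow s S U" using sylow_ex[OF U(1) s(1)] by blast
  obtain T where T: "is_sylow s T V" using sylow_ex[OF V(1) s(1)] by blast
  have S': "is_sylow s S (carrier G)" by (rule sylow_of_index[OF U(1,2) s(2,1) S])
  have T': "is_sylow s T (carrier G)" by (rule sylow_of_index[OF V(1,2) s(3,1) T])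
  obtain h where h: "h \<in> carrier G" "S = conj_by h ` T"
    using sylow_conj_eq[OF subgroup_self T' S' s(1)] by blast
  have SU: "S \<subseteq> U" "T \<subseteq> V" using S T by (auto simp: is_sylow_def)
  then have SG: "S \<subseteq> carrier G" "T \<subseteq> carrier G" using UG by auto
  have "central_mod C S = carrier G"
  proof (rule coprime_cover[OF central_mod_subgroup[OF C SG(1)] U(1) V(1) U(2) V(2) cop _ h(1)])
    show "U \<subseteq> central_mod C S" using U(3) SU UG by (auto simp: central_mod_def subset_iff)
    show "conj_by h v \<in> central_mod C S" if v: "v \<in> V" for v
    proof -
      have vG: "v \<in> carrier G" using v UG by blast
      have "cong_mod C (conj_by h v \<otimes> x) (x \<otimes> conj_by h v)" if x: "x \<in> S" for x
      proof -
        obtain t where t: "t \<in> T" "x = conj_by h t" using x h by blast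
        have tG: "t \<in> carrier G" using t SG by blast
        have "cong_mod C (conj_by h (v \<otimes> t)) (conj_by h (t \<otimes> v))"
          by (rule cong_mod_conj_by[OF C h(1)]) (use V(3) v t SU vG tG in auto)
        then show ?thesis using t tG vG h(1) by (simp add: conj_by_mult)
      qed
      then show ?thesis using vG h(1) by (simp add: central_mod_def)
    qed
  qed
  then have *: "\<And>g x. g \<in> carrier G \<Longrightarrow> x \<in> S \<Longrightarrow> cong_mod C (g \<otimes> x) (x \<otimes> g)"
    unfolding central_mod_def by blast
  have "cong_mod C (x \<otimes> g) (g \<otimes> x)" if "g \<in> carrier G" "x \<in> S" for g x
    by (rule cong_mod_sym[OF normal_subD(1)[OF C] _ _ *[OF that]]) (use that SG in auto)
  then have "S \<subseteq> central_mod C (carrier G)"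
    using SG by (auto simp: central_mod_def)
  then show ?thesis using S' by blast
qed

text \<open>Each prime is prime to two of the three indices, so \<open>sylow_central\<close> puts a Sylow subgroup for it
  into the centre modulo \<open>C\<close>.\<close>

lemma three_abelian:
  assumes C: "normal_sub C (carrier G)"
    and U: "\<And>i. i < 3 \<Longrightarrow> subgroup (U i) G" "\<And>i. i < (3::nat) \<Longrightarrow> order G = m i * card (U i)"
      "\<And>i u v. i < 3 \<Longrightarrow> u \<in> U i \<Longrightarrow> v \<in> U i \<Longrightarrow> cong_mod C (u \<otimes> v) (v \<otimes> u)"
    and cop: "\<And>i j. i < 3 \<Longrightarrow> j < 3 \<Longrightarrow> i \<noteq> j \<Longrightarrow> coprime (m i) (m j)"
    and g: "g \<in> carrier G" "h \<in> carrier G"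
  shows "cong_mod C (g \<otimes> h) (h \<otimes> g)"
proof -
  have "central_mod C (carrier G) = carrier G"
  proof (rule sub_eq_if_sylow[OF subgroup_self central_mod_subgroup[OF C order_refl]])
    show "central_mod C (carrier G) \<subseteq> carrier G" by (auto simp: central_mod_def)
    fix s :: nat assume s: "Factorial_Ring.prime s"
    have c: "\<not> s dvd m i \<or> \<not> s dvd m j" if "i < 3" "j < 3" "i \<noteq> j" for i j
      using cop[OF that] s by (meson coprime_common_divisor not_prime_unit)
    have "\<exists>i j. i < 3 \<and> j < 3 \<and> i \<noteq> j \<and> \<not> s dvd m i \<and> \<not> s dvd m j"
    proof -
      have w: ?thesis if "i < 3" "j < 3" "i \<noteq> j" "\<not> s dvd m i" "\<not> s dvd m j" for i j
        using that by blast
      show ?thesis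
        using w[of 0 1] w[of 0 2] w[of 1 2] c[of 0 1] c[of 0 2] c[of 1 2] by force
    qed
    then obtain i j where ij: "i < 3" "j < 3" "i \<noteq> j" "\<not> s dvd m i" "\<not> s dvd m j" by blast
    show "\<exists>S. is_sylow s S (carrier G) \<and> S \<subseteq> central_mod C (carrier G)"
      by (rule sylow_central[OF C U(1)[OF ij(1)] U(2)[OF ij(1)] U(3)[OF ij(1)]
          U(1)[OF ij(2)] U(2)[OF ij(2)] U(3)[OF ij(2)] cop[OF ij(1-3)] s ij(4,5)])
  qed
  then show ?thesis using g unfolding central_mod_def by blast
qed

section \<open>Four supersolvable subgroups of coprime indices\<close>

text \<open>\<open>G/C\<close> is an abelian \<open>p'\<close>-group for the centralizer \<open>C\<close> of \<open>K/L\<close>: the first two subgroups exclude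
  elements of order \<open>p\<close>, then all three are abelian modulo \<open>C\<close>. It remains to see that an irreducible
  action of this abelian group has degree one, for which the eigenvectors come from the subgroups.\<close>

lemma three_ss_chief_prime:
  assumes sol: "solvable G" and ch: "chief (carrier G) L K"
    and p: "Factorial_Ring.prime p" "card K = p ^ k * card L"
    and U: "\<And>i. i < 3 \<Longrightarrow> subgroup (U i) G" "\<And>i. i < 3 \<Longrightarrow> supersolvable (G\<lparr>carrier := U i\<rparr>)"
      "\<And>i. i < (3::nat) \<Longrightarrow> order G = m i * card (U i)" "\<And>i. i < 3 \<Longrightarrow> \<not> p dvd m i"
    and cop: "\<And>i j. i < 3 \<Longrightarrow> j < 3 \<Longrightarrow> i \<noteq> j \<Longrightarrow> coprime (m i) (m j)"
  shows "\<exists>q::nat. Factorial_Ring.prime q \<and> card K = q * card L"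
proof -
  note chD = chiefD[OF ch]
  note NL = normal_subD[OF chD(1)] and NK = normal_subD[OF chD(2)]
  note cK = sub_closed[OF NK(1)] and cL = sub_closed[OF NL(1)]
  have LK: "L \<subseteq> K" using chD(3) by blast
  let ?C = "centralizer_mod K L"
  have C: "normal_sub ?C (carrier G)" by (rule normal_sub_centralizer[OF chD(1,2)])
  note NC = normal_subD[OF C]
  have cov: "K \<subseteq> L <#> (K \<inter> U i)" if "i < 3" for i
    by (rule cover_of_index[OF chD(1,2) LK p U(1)[OF that] U(3)[OF that] U(4)[OF that]])
  obtain P where P: "is_sylow p P (U 0)" using sylow_ex[OF U(1) p(1), of 0] by auto
  have PG: "is_sylow p P (carrier G)" by (rule sylow_of_index[OF U(1) U(3) U(4) p(1) P]) auto
  have "P \<subseteq> ?C"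
    by (rule coprime_ss_p'_action[OF ch p U(1) U(2) U(3) U(4) U(1) U(2) U(3) U(4) cop PG, of 0 1])
      (use P in \<open>auto simp: is_sylow_def\<close>)
  moreover obtain n where n: "card (carrier G) = n * card ?C"
    using sub_index[OF NC(1) subgroup_self NC(3)] by blast
  ultimately have pn: "\<not> p dvd n"
    using sylow_index[OF PG subgroup_self NC(1) _ n p(1)] by blast
  have ab: "cong_mod ?C (g \<otimes> h) (h \<otimes> g)" if "g \<in> carrier G" "h \<in> carrier G" for g h
  proof (rule three_abelian[OF C U(1) U(3) _ cop that])
    show "cong_mod ?C (u \<otimes> v) (v \<otimes> u)" if i: "i < 3" "u \<in> U i" "v \<in> U i" for i u v
      using comm_in_centralizer(1)[OF chD(1,2) LK p U(1,2)[OF i(1)] cov[OF i(1)] subgroup_self NC(3)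
          subgroup.subset[OF U(1)[OF i(1)]] n pn i(2,3)] .
  qed auto
  \<comment> \<open>The group acts on \<open>K/L\<close> by power maps: each \<open>u \<in> U i\<close> has an eigenvector, in the bottom
    \<open>U i\<close>-chief factor, and its eigenspace is normal because \<open>G/C\<close> is abelian.\<close>
  let ?E = "\<lambda>u j. {x \<in> K. cong_mod L (conj_by u x) (x [^] (j::nat))}"
  let ?P = "{g \<in> carrier G. \<exists>j::nat. K \<subseteq> ?E g j}"
  have Ei: "normal_sub (?E u j) (carrier G)" if u: "u \<in> carrier G" for u and j :: nat
  proof -
    have "subgroup (?E u j) G"
    proof (rule subgroup_if_closed)
      show "?E u j \<subseteq> carrier G" using cK(1) by blast
      show "\<one> \<in> ?E u j" using u cK(2) cong_mod_refl[OF NL(1)] by simp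
      fix x y assume xy: "x \<in> ?E u j" "y \<in> ?E u j"
      then have mem: "x \<in> K" "y \<in> K" "conj_by u x \<in> K" "conj_by u y \<in> K" using NK(4)[OF u] by auto
      have 1: "cong_mod L (conj_by u x \<otimes> conj_by u y) (x [^] j \<otimes> y [^] j)"
        by (rule cong_mod_mult[OF chD(1)]) (use xy mem cK in auto)
      have "cong_mod L ((x \<otimes> y) [^] j) (x [^] j \<otimes> y [^] j)"
        by (rule cong_mod_pow_mult[OF chD(1) NK(1,3) chief_solvable_abelian[OF sol ch]])
          (use mem in auto)
      then have 2: "cong_mod L (x [^] j \<otimes> y [^] j) ((x \<otimes> y) [^] j)"
        by (rule cong_mod_sym[OF NL(1), rotated 2]) (use mem cK in auto)
      have "cong_mod L (conj_by u x \<otimes> conj_by u y) ((x \<otimes> y) [^] j)"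
        by (rule cong_mod_trans[OF NL(1) _ _ _ 1 2]) (use mem cK in auto)
      then show "x \<otimes> y \<in> ?E u j" using mem u cK by (simp add: conj_by_mult)
    qed
    moreover have "conj_by g x \<in> ?E u j" if g: "g \<in> carrier G" and x: "x \<in> ?E u j" for g x
    proof -
      have mem: "x \<in> K" "x \<in> carrier G" "conj_by g x \<in> K" "conj_by u x \<in> K" "conj_by g x \<in> carrier G"
        using x NK(4)[OF g] NK(4)[OF u] cK(1) g by auto
      have "u \<otimes> g \<otimes> inv (g \<otimes> u) \<in> ?C" using ab[OF u g] by (simp add: cong_mod_def)
      moreover have "conj_by (g \<otimes> u) x \<in> K" using NK(4) mem(1) g u by simp
      ultimately have "cong_mod L (conj_by (u \<otimes> g \<otimes> inv (g \<otimes> u)) (conj_by (g \<otimes> u) x)) (conj_by (g \<otimes> u) x)"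
        unfolding centralizer_mod_def acts_trivially_def by blast
      moreover have "conj_by (u \<otimes> g \<otimes> inv (g \<otimes> u)) (conj_by (g \<otimes> u) x) = conj_by (u \<otimes> g) x"
        using u g mem by (simp add: conj_by_conj_by[symmetric] m_assoc inv_mult_group)
      ultimately have 1: "cong_mod L (conj_by u (conj_by g x)) (conj_by g (conj_by u x))"
        using u g mem by (simp add: conj_by_conj_by)
      have "cong_mod L (conj_by g (conj_by u x)) (conj_by g (x [^] j))"
        by (rule cong_mod_conj_by[OF chD(1) g]) (use x mem u in auto)
      then have "cong_mod L (conj_by g (conj_by u x)) (conj_by g x [^] j)"
        using g mem by (simp add: conj_by_pow)
      then have "cong_mod L (conj_by u (conj_by g x)) (conj_by g x [^] j)"
        by (rule cong_mod_trans[OF NL(1) _ _ _ 1, rotated -1]) (use mem g u in auto)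
      then show ?thesis using mem by simp
    qed
    ultimately show ?thesis using NK(3) subgroup_self unfolding normal_sub_def by blast
  qed
  have UP: "U i \<subseteq> ?P" if i: "i < 3" for i
  proof
    fix u assume u: "u \<in> U i"
    have UG: "U i \<subseteq> carrier G" using subgroup.subset[OF U(1)[OF i]] .
    have uG: "u \<in> carrier G" using u UG by blast
    let ?L = "L \<inter> U i" and ?K = "K \<inter> U i"
    have nor: "normal_sub ?L (U i)" "normal_sub ?K (U i)"
      using normal_sub_Int[OF chD(1) U(1)[OF i] UG] normal_sub_Int[OF chD(2) U(1)[OF i] UG] .
    have "?L \<noteq> ?K"
    proof
      assume "?L = ?K"
      then have "?K \<subseteq> L" by blast
      then have "K \<subseteq> L" using cov[OF i] mult_sub_least[OF NL(1) order_refl, of ?K] by blast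
      then show False using chD(3) by blast
    qed
    then obtain A where A: "chief (U i) ?L A" "A \<subseteq> ?K"
      using chief_above[OF nor] LK by blast
    note chA = chiefD[OF A(1)]
    obtain q where q: "Factorial_Ring.prime q" "card A = q * card ?L"
      using supersolvable_chief_prime[OF U(1,2)[OF i] U(1)[OF i] order_refl A(1)] by metis
    obtain j :: nat where j: "\<And>a. a \<in> A \<Longrightarrow> cong_mod ?L (conj_by u a) (a [^] j)"
      using prime_factor_power[OF chA(1-3) q u] by metis
    have AE: "A \<subseteq> ?E u j" using j A(2) by (auto simp: cong_mod_def)
    have LE: "L \<subseteq> ?E u j"
    proof
      fix l assume l: "l \<in> L"
      then have "conj_by u l \<otimes> inv (l [^] j) \<in> L" using NL(4)[OF uG l] cL by simp
      then show "l \<in> ?E u j" using l LK by (auto simp: cong_mod_def)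
    qed
    have "?E u j = K"
    proof (rule chD(4)[OF Ei[OF uG] LE])
      show "?E u j \<noteq> L" using AE chA(3) A(2) by blast
    qed blast
    then show "u \<in> ?P" using uG by blast
  qed
  have Ps: "subgroup ?P G"
  proof (rule subgroup_if_closed)
    have "K \<subseteq> ?E \<one> 1" using cK(1) cong_mod_refl[OF NL(1)] by auto
    then show "\<one> \<in> ?P" by blast
    fix g h assume gh: "g \<in> ?P" "h \<in> ?P"
    then obtain i j :: nat where ij: "K \<subseteq> ?E g i" "K \<subseteq> ?E h j" by blast
    have G: "g \<in> carrier G" "h \<in> carrier G" using gh by auto
    have "K \<subseteq> ?E (g \<otimes> h) (i * j)"
    proof
      fix x assume x: "x \<in> K"
      have mem: "conj_by h x \<in> K" "x [^] i \<in> K" "conj_by g (conj_by h x) \<in> K"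
        using x NK(4) G cK by auto
      have 1: "cong_mod L (conj_by g (conj_by h x)) (conj_by h x [^] i)" using ij(1) mem(1) by blast
      have 2: "cong_mod L (conj_by h x [^] i) ((x [^] j) [^] i)"
        by (rule cong_mod_pow[OF chD(1)]) (use ij(2) x mem cK in auto)
      have "cong_mod L (conj_by g (conj_by h x)) ((x [^] j) [^] i)"
        by (rule cong_mod_trans[OF NL(1) _ _ _ 1 2]) (use mem x cK in auto)
      then show "x \<in> ?E (g \<otimes> h) (i * j)"
        using x G cK by (simp add: conj_by_conj_by nat_pow_pow mult.commute)
    qed
    then show "g \<otimes> h \<in> ?P" using G by blast
  qed blast
  have "?P = carrier G"
    by (rule coprime_cover[OF Ps U(1) U(1) U(3) U(3) cop UP one_closed, of 0 1])
      (use UP[of 1] subgroup.subset[OF U(1), of 1] in \<open>auto simp: subset_iff\<close>)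
  then have pow: "\<exists>j::nat. K \<subseteq> ?E g j" if "g \<in> carrier G" for g using that by blast
  obtain y where y: "y \<in> K" "y \<notin> L" using chD(3) by blast
  have yG: "y \<in> carrier G" using y cK by blast
  note Y = adjoin_subgroup[OF chD(1) yG]
  have "normal_sub (adjoin L y) (carrier G)"
  proof (rule adjoin_normal[OF chD(1) yG])
    fix u assume u: "u \<in> carrier G"
    obtain j :: nat where "K \<subseteq> ?E u j" using pow[OF u] by blast
    then have "cong_mod L (conj_by u y) (y [^] j)" using y(1) by blast
    then show "conj_by u y \<in> adjoin L y" unfolding adjoin_def using conj_by_closed[OF u yG] by blast
  qed
  then have "adjoin L y = K" using chD(4)[of "adjoin L y"] Y(2,3) Y(5)[OF NK(1) LK y(1)] y(2)
    by blast
  then have "K \<subseteq> adjoin L y" by simp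
  then show ?thesis using chief_cyclic_prime[OF ch y(1)] by metis
qed

text \<open>Doerk: at most one of four pairwise coprime indices is divisible by a given prime, so three of
  the subgroups serve for each chief factor.\<close>

theorem four_ss_supersolvable:
  assumes sol: "solvable G"
    and U: "\<And>i. i < 4 \<Longrightarrow> subgroup (U i) G" "\<And>i. i < 4 \<Longrightarrow> supersolvable (G\<lparr>carrier := U i\<rparr>)"
      "\<And>i. i < (4::nat) \<Longrightarrow> order G = m i * card (U i)"
    and cop: "\<And>i j. i < 4 \<Longrightarrow> j < 4 \<Longrightarrow> i \<noteq> j \<Longrightarrow> coprime (m i) (m j)"
  shows "supersolvable G"
proof -
  have "\<exists>q::nat. Factorial_Ring.prime q \<and> card K = q * card L" if ch: "chief (carrier G) L K" for K L
  proof -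
    obtain p k where p: "Factorial_Ring.prime p" "card K = p ^ k * card L"
      using chief_solvable_prime_power[OF sol ch] by metis
    obtain b where b: "b < 4" "\<And>i. i < 4 \<Longrightarrow> i \<noteq> b \<Longrightarrow> \<not> p dvd m i"
    proof (cases "\<exists>b<4. p dvd m b")
      case True
      then obtain b where b: "b < 4" "p dvd m b" by blast
      have "\<not> p dvd m i" if "i < 4" "i \<noteq> b" for i
        using cop[OF that(1) b(1) that(2)] b(2) p(1)
        by (meson coprime_common_divisor not_prime_unit)
      then show thesis using that b(1) by blast
    next
      case False
      then show thesis using that[of 3] by simp
    qed
    define f where "f i = (if i < b then i else Suc i)" for i
    have f: "f i < 4" "f i \<noteq> b" if "i < 3" for i using that by (auto simp: f_def)
    have inj: "f i \<noteq> f j" if "i \<noteq> j" for i j using that by (auto simp: f_def)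
    show ?thesis
      by (rule three_ss_chief_prime[OF sol ch p, where U = "\<lambda>i. U (f i)" and m = "\<lambda>i. m (f i)"])
        (use U f b(2) cop inj in auto)
  qed
  then show ?thesis using supersolvableI[OF subgroup_self] by simp
qed

section \<open>Subgroups of prime power index\<close>

text \<open>\<open>|G : D| = |K : K \<inter> D|\<close> divides \<open>|K : L|\<close>.\<close>

lemma supplement_index:
  assumes L: "subgroup L G" and K: "subgroup K G" and q: "Factorial_Ring.prime q" "card K = q ^ k * card L"
    and D: "subgroup D G" "L \<subseteq> D" "L \<subseteq> K" "K <#> D = carrier G"
  obtains i where "order G = q ^ i * card D"
proof -
  have KD: "subgroup (K \<inter> D) G" using sub_Int[OF K D(1)] .
  obtain a where a: "card K = a * card (K \<inter> D)" using sub_index[OF KD K] by blast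
  obtain b where b: "card (K \<inter> D) = b * card L" using sub_index[OF L KD] D(2,3) by blast
  have "a * b * card L = q ^ k * card L" using a b q(2) by (metis mult.assoc)
  then have "a * b = q ^ k" using sub_pos[OF L] by (simp only: mult_cancel2) simp
  then obtain i where i: "a = q ^ i" using divides_primepow_nat[OF q(1)] by (metis dvd_triv_left)
  have "order G * card (K \<inter> D) = a * card D * card (K \<inter> D)"
    using card_mult[OF K D(1)] D(4) a by (simp add: order_def mult.commute mult.left_commute)
  then have "order G = a * card D" using sub_pos[OF KD] by (simp only: mult_cancel2) simp
  then show thesis using that i by blast
qed

lemma finite_subsets: "(\<And>L. L \<in> S \<Longrightarrow> L \<subseteq> carrier G) \<Longrightarrow> finite S"
  by (rule finite_subset[of _ "Pow (carrier G)"]) (use fin in auto)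

lemma maximal_normal_with:
  assumes "normal_sub L0 (carrier G)" "Q L0"
  obtains L where "normal_sub L (carrier G)" "Q L" "L0 \<subseteq> L"
    "\<And>K. normal_sub K (carrier G) \<Longrightarrow> L \<subset> K \<Longrightarrow> \<not> Q K"
proof -
  let ?S = "{L. normal_sub L (carrier G) \<and> Q L \<and> L0 \<subseteq> L}"
  have "finite ?S" by (rule finite_subsets) (auto dest: normal_subD(3))
  then have "\<exists>L\<in>?S. \<forall>K\<in>?S. L \<le> K \<longrightarrow> L = K"
    using assms by (intro finite_has_maximal) auto
  then obtain L where L: "L \<in> ?S" "\<And>K. K \<in> ?S \<Longrightarrow> L \<subseteq> K \<Longrightarrow> L = K" by auto
  show thesis by (rule that[of L]) (use L in auto)
qed

text \<open>If \<open>L\<close> is the largest normal subgroup of \<open>G\<close> inside \<open>M\<close>, then \<open>M\<close> supplements each chief factor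
  \<open>K/L\<close>.\<close>

lemma maximal_subgroup_index:
  assumes sol: "solvable G" and M: "maximal_subgroup M G"
  obtains q k where "Factorial_Ring.prime q" "order G = q ^ k * card M"
proof -
  have MG: "subgroup M G" "M \<noteq> carrier G"
    and mx: "\<And>K. subgroup K G \<Longrightarrow> M \<subseteq> K \<Longrightarrow> K \<noteq> M \<Longrightarrow> K = carrier G"
    using M unfolding maximal_subgroup_def by blast+
  have Mc: "M \<subseteq> carrier G" using subgroup.subset[OF MG(1)] .
  have one: "{\<one>} \<subseteq> M" using sub_closed(2)[OF MG(1)] by simp
  obtain L where L: "normal_sub L (carrier G)" "L \<subseteq> M"
    "\<And>K. normal_sub K (carrier G) \<Longrightarrow> L \<subset> K \<Longrightarrow> \<not> K \<subseteq> M"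
    using maximal_normal_with[OF normal_sub_one[OF subgroup_self], of "\<lambda>L. L \<subseteq> M", OF one]
    by metis
  have "L \<subset> carrier G" using L(2) MG(2) Mc by blast
  then obtain K where ch: "chief (carrier G) L K"
    using chief_above[OF L(1) normal_sub_self[OF subgroup_self]] by blast
  note chD = chiefD[OF ch]
  obtain q k where q: "Factorial_Ring.prime q" "card K = q ^ k * card L"
    using chief_solvable_prime_power[OF sol ch] by metis
  note KM = normal_mult_subgroup[OF chD(2) MG(1) Mc]
  have "K <#> M = carrier G"
    using mx[OF KM(1,3)] KM(2) L(3)[OF chD(2,3)] by blast
  then show thesis
    using supplement_index[OF normal_subD(1)[OF L(1)] normal_subD(1)[OF chD(2)] q MG(1) L(2)] chD(3) that[OF q(1)]
    by blast
qed

text \<open>Choose a normal subgroup \<open>L\<close> that is maximal subject to \<open>q\<close> dividing its index. A chief factor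
  \<open>K/L\<close> is a Sylow \<open>q\<close>-subgroup of \<open>G/L\<close>. If \<open>K \<noteq> G\<close>, take a chief factor \<open>T/K\<close> and a Sylow subgroup
  \<open>S\<close> of \<open>T\<close> for its prime. By the Frattini argument \<open>K\<close> is supplemented by the normalizer of \<open>L S\<close>,
  and this normalizer is proper by the choice of \<open>L\<close>. This avoids the complements of the
  Schur-Zassenhaus theorem.\<close>

lemma prime_power_index:
  assumes sol: "solvable G" and q: "Factorial_Ring.prime q" "q dvd order G"
  obtains U k where "subgroup U G" "U \<noteq> carrier G" "order G = q ^ k * card U"
proof -
  have one: "q * card {\<one>} dvd order G" using q by simp
  obtain L where L: "normal_sub L (carrier G)" "q * card L dvd order G"
    "\<And>K. normal_sub K (carrier G) \<Longrightarrow> L \<subset> K \<Longrightarrow> \<not> q * card K dvd order G"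
    using maximal_normal_with[OF normal_sub_one[OF subgroup_self], of "\<lambda>L. q * card L dvd order G", OF one]
    by metis
  note NL = normal_subD[OF L(1)]
  obtain c where c: "order G = q * card L * c" using L(2) by blast
  have opos: "order G > 0" using fin order_gt_0_iff_finite by blast
  have Lne: "L \<noteq> carrier G"
  proof
    assume "L = carrier G"
    then have "card L = q * c * card L" using c by (simp add: order_def ac_simps)
    then have "q * c = 1" using sub_pos[OF NL(1)] by simp
    then show False using q(1) by simp
  qed
  then obtain K where ch: "chief (carrier G) L K"
    using chief_above[OF L(1) normal_sub_self[OF subgroup_self]] NL(3) by blast
  note chD = chiefD[OF ch]
  note NK = normal_subD[OF chD(2)]
  have LK: "L \<subseteq> K" using chD(3) by blast
  obtain r k where r: "Factorial_Ring.prime r" "card K = r ^ k * card L"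
    using chief_solvable_prime_power[OF sol ch] by metis
  obtain a where a: "order G = a * card K"
    using sub_card_order[OF NK(1)] by (metis dvd_def mult.commute)
  have qa: "\<not> q dvd a"
    using L(3)[OF chD(2,3)] a by (metis mult_dvd_mono dvd_refl)
  have "a * r ^ k * card L = q * c * card L" using a c r(2) by (metis mult.assoc mult.commute)
  then have "a * r ^ k = q * c" using sub_pos[OF NL(1)] by (simp only: mult_cancel2) simp
  then have "q dvd r ^ k" using qa q(1) by (metis dvd_triv_left prime_dvd_mult_iff)
  then have rq: "r = q" using q(1) r(1) prime_dvd_power primes_dvd_imp_eq by metis
  show thesis
  proof (cases "K = carrier G")
    case True
    then show thesis using that[OF NL(1) Lne, of k] r(2) rq by (simp add: order_def)
  next
    case False
    then obtain T where chT: "chief (carrier G) K T"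
      using chief_above[OF chD(2) normal_sub_self[OF subgroup_self]] NK(3) by blast
    note chTD = chiefD[OF chT]
    note NT = normal_subD[OF chTD(2)]
    obtain s j where s: "Factorial_Ring.prime s" "j > 0" "card T = s ^ j * card K"
      using chief_solvable_prime_power[OF sol chT] by metis
    obtain t where t: "order G = t * card T"
      using sub_card_order[OF NT(1)] by (metis dvd_def mult.commute)
    have "a * card K = t * s ^ j * card K" using a t s(3) by (metis mult.assoc)
    then have "a = t * s ^ j" using sub_pos[OF NK(1)] by (simp only: mult_cancel2) simp
    then have sq: "s \<noteq> q" using qa s(2) by auto
    obtain S where S: "is_sylow s S T" using sylow_ex[OF NT(1) s(1)] by blast
    have SG: "subgroup S G" "S \<subseteq> T" "card S = s ^ multiplicity s (card T)"
      using S by (auto simp: is_sylow_def)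
    have KT: "normal_sub K T" using normal_sub_restrict[OF chD(2) NT(1,3)] chTD(3) by blast
    have KS: "K <#> S = T" by (rule sylow_mult[OF KT s(1,3) S])
    let ?Y = "L <#> S"
    note Y = normal_mult_subgroup[OF L(1) SG(1) subgroup.subset[OF SG(1)]]
    let ?D = "set_normalizer ?Y"
    have D: "subgroup ?D G" by (rule set_normalizer_subgroup[OF Y(4)])
    have YD: "?Y \<subseteq> ?D"
      using sub_conj_by[OF Y(1)] Y(4) unfolding set_normalizer_iff[OF Y(4)] subset_iff by blast
    have "carrier G \<subseteq> K <#> ?D"
    proof
      fix g assume g: "g \<in> carrier G"
      obtain u where u: "u \<in> T" "conj_by g ` S = conj_by u ` S"
        using frattini[OF chTD(2) S s(1) g] by blast
      obtain x y where xy: "x \<in> K" "y \<in> S" "u = x \<otimes> y"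
        using u(1) KS set_mult_iff[of u K S] by blast
      have mem: "x \<in> carrier G" "y \<in> carrier G" "u \<in> carrier G"
        using xy u NK(3) NT(3) sub_closed(1)[OF SG(1)] by auto
      have "y \<in> ?D" using YD Y(3) xy(2) by blast
      then have yY: "conj_by y ` ?Y = ?Y" by (simp add: set_normalizer_def)
      have "conj_by g ` ?Y = conj_by u ` ?Y"
        using conj_by_mult_image[OF L(1) SG(1)] g mem(3) u(2) by simp
      also have "\<dots> = conj_by x ` conj_by y ` ?Y"
        unfolding image_image xy(3)
        using mem Y(4) by (intro image_cong) (auto simp: conj_by_conj_by)
      finally have gx: "conj_by g ` ?Y = conj_by x ` ?Y" using yY by simp
      have "conj_by (inv x \<otimes> g) ` ?Y = conj_by (inv x) ` conj_by g ` ?Y"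
        unfolding image_image using mem g Y(4) by (intro image_cong) (auto simp: conj_by_conj_by)
      also have "\<dots> = (\<lambda>z. z) ` ?Y"
        unfolding gx image_image using mem Y(4) by (intro image_cong) auto
      finally have "inv x \<otimes> g \<in> ?D" using mem g by (simp add: set_normalizer_def)
      moreover have "g = x \<otimes> (inv x \<otimes> g)" using mem g by simp
      ultimately show "g \<in> K <#> ?D" using xy(1) set_mult_iff by blast
    qed
    then have KD: "K <#> ?D = carrier G"
      using mult_sub_least[OF subgroup_self NK(3) subgroup.subset[OF D]] by blast
    have Dne: "?D \<noteq> carrier G"
    proof
      assume DG: "?D = carrier G"
      then have nY: "normal_sub ?Y (carrier G)"
        using Y(1,4) subgroup_self set_normalizer_iff[OF Y(4)] by (auto simp: normal_sub_def)
      have "?Y \<noteq> L"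
      proof
        assume "?Y = L"
        then have "S \<subseteq> K" using Y(3) LK by blast
        then show False
          using sylow_index[OF S NT(1) NK(1) _ s(3,1)] s(2) by simp
      qed
      then have "\<not> q * card ?Y dvd order G" using L(3)[OF nY] Y(2) by blast
      moreover have "q * card ?Y dvd order G"
      proof -
        obtain z where z: "order G = z * card ?Y"
          using sub_card_order[OF Y(1)] by (metis dvd_def mult.commute)
        obtain x where x: "card ?Y = x * card L" using sub_index[OF NL(1) Y(1,2)] by blast
        have "x * card (L \<inter> S) * card L = card S * card L"
          using card_mult[OF NL(1) SG(1)] x by (simp add: ac_simps)
        then have "x * card (L \<inter> S) = card S" using sub_pos[OF NL(1)] by simp
        then obtain i where i: "x = s ^ i"
          using SG(3) divides_primepow_nat[OF s(1)] by (metis dvd_triv_left)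
        have "z * x * card L = q * c * card L" using z x c by (metis mult.assoc mult.commute)
        then have "z * x = q * c" using sub_pos[OF NL(1)] by (simp only: mult_cancel2) simp
        then have "q dvd z * x" by simp
        moreover have "\<not> q dvd x"
          using i sq q(1) s(1) prime_dvd_power primes_dvd_imp_eq by metis
        ultimately have "q dvd z" using q(1) prime_dvd_mult_iff by blast
        then show ?thesis using z by simp
      qed
      ultimately show False by blast
    qed
    obtain i where "order G = q ^ i * card ?D"
      using supplement_index[OF NL(1) NK(1) r(1,2) D _ LK KD] YD Y(2) rq by blast
    then show thesis using that D Dne by blast
  qed
qed

section \<open>The upper series and the p-length\<close>

lemma coset_hom:
  assumes "normal_sub N (carrier G)"
  shows "group_hom G (G Mod N) (\<lambda>x. N #> x)"
proof -
  interpret N: normal N G using assms normal_sub_carrier by blast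
  show ?thesis
    using N.factorgroup_is_group N.r_coset_hom_Mod is_group
    by (simp add: group_hom_def group_hom_axioms_def)
qed

lemma carrier_Mod: "carrier (G Mod N) = (\<lambda>x. N #> x) ` carrier G"
  by (auto simp: FactGroup_def RCOSETS_def)

lemma card_saturated:
  assumes N: "subgroup N G" and T: "subgroup T G" "N \<subseteq> T"
  shows "card T = card ((\<lambda>x. N #> x) ` T) * card N"
proof (rule card_fibres[OF sub_finite[OF T(1)]])
  fix z assume "z \<in> (\<lambda>x. N #> x) ` T"
  then obtain t where t: "t \<in> T" "z = N #> t" by blast
  note cT = sub_closed[OF T(1)]
  have "{x \<in> T. N #> x = z} = z"
  proof
    show "{x \<in> T. N #> x = z} \<subseteq> z" using rcos_self[OF cT(1) N] by blast
    show "z \<subseteq> {x \<in> T. N #> x = z}"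
    proof
      fix x assume x: "x \<in> z"
      then obtain n where n: "n \<in> N" "x = n \<otimes> t" using t by (auto simp: r_coset_def)
      have "x \<in> T" using n t T(2) cT(3) by blast
      moreover have "N #> x = z"
        using repr_independence[of x N t] x t cT(1) N by simp
      ultimately show "x \<in> {x \<in> T. N #> x = z}" by blast
    qed
  qed
  moreover have "card z = card N"
  proof -
    have "z \<in> rcosets N" using t cT(1) by (auto simp: RCOSETS_def)
    then show ?thesis
      using card_rcosets_equal[of z N] subgroup.subset[OF N] by simp
  qed
  ultimately show "card {x \<in> T. N #> x = z} = card N" by simp
qed

lemma preimage_normal:
  assumes N: "normal_sub N (carrier G)" and Q: "Q \<lhd> G Mod N"
  defines "H \<equiv> {x \<in> carrier G. N #> x \<in> Q}"
  shows "normal_sub H (carrier G)" "N \<subseteq> H" "card H = card Q * card N"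
proof -
  note NN = normal_subD[OF N]
  interpret h: group_hom G "G Mod N" "\<lambda>x. N #> x" by (rule coset_hom[OF N])
  interpret Q: normal Q "G Mod N" by (rule Q)
  have sub: "subgroup H G"
  proof (rule subgroup_if_closed)
    show "\<one> \<in> H" unfolding H_def using h.hom_one Q.one_closed by simp
    fix x y assume "x \<in> H" "y \<in> H"
    then show "x \<otimes> y \<in> H" unfolding H_def using Q.m_closed by simp
  qed (auto simp: H_def)
  moreover have "conj_by u x \<in> H" if "u \<in> carrier G" "x \<in> H" for u x
    using that Q.inv_op_closed2[of "N #> u" "N #> x"] unfolding H_def conj_by_def by simp
  ultimately show "normal_sub H (carrier G)"
    unfolding normal_sub_def using subgroup_self by (auto simp: H_def)
  show NH: "N \<subseteq> H"
  proof
    fix n assume n: "n \<in> N"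
    then have "N #> n = N" using NN by (simp add: coset_join2 sub_closed)
    then have "N #> n = \<one>\<^bsub>G Mod N\<^esub>" by simp
    then show "n \<in> H" unfolding H_def using n NN(3) Q.one_closed by auto
  qed
  have "(\<lambda>x. N #> x) ` H = Q"
    unfolding H_def using Q.subset carrier_Mod[of N] by auto
  then show "card H = card Q * card N" using card_saturated[OF NN(1) sub NH] by simp
qed

lemma image_normal:
  assumes N: "normal_sub N (carrier G)" and T: "normal_sub T (carrier G)"
  shows "(\<lambda>x. N #> x) ` T \<lhd> G Mod N"
proof -
  note NT = normal_subD[OF T]
  interpret h: group_hom G "G Mod N" "\<lambda>x. N #> x" by (rule coset_hom[OF N])
  have "z \<otimes>\<^bsub>G Mod N\<^esub> w \<otimes>\<^bsub>G Mod N\<^esub> inv\<^bsub>G Mod N\<^esub> z \<in> (\<lambda>x. N #> x) ` T"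
    if zw: "z \<in> carrier (G Mod N)" "w \<in> (\<lambda>x. N #> x) ` T" for z w
  proof -
    obtain g t where gt: "g \<in> carrier G" "z = N #> g" "t \<in> T" "w = N #> t"
      using zw by (auto simp: carrier_Mod)
    have "N #> conj_by g t = z \<otimes>\<^bsub>G Mod N\<^esub> w \<otimes>\<^bsub>G Mod N\<^esub> inv\<^bsub>G Mod N\<^esub> z"
      unfolding conj_by_def gt(2,4) using gt(1,3) NT(3) by (simp add: subset_iff)
    then show ?thesis using NT(4)[OF gt(1,3)] by (metis imageI)
  qed
  then show ?thesis
    by (simp add: h.H.normal_inv_iff h.subgroup_img_is_subgroup[OF NT(1)])
qed

lemma finite_Mod: "finite (carrier (G Mod N))"
  unfolding carrier_Mod using fin by simp

lemma p'_core_preimage: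
  assumes N: "normal_sub N (carrier G)" and p: "Factorial_Ring.prime p"
  defines "H \<equiv> {x \<in> carrier G. N #> x \<in> p'_core p (G Mod N)}"
  shows "normal_sub H (carrier G)" "N \<subseteq> H" "\<exists>m. card H = m * card N \<and> \<not> p dvd m"
    "\<And>T m. normal_sub T (carrier G) \<Longrightarrow> N \<subseteq> T \<Longrightarrow> card T = m * card N \<Longrightarrow> \<not> p dvd m \<Longrightarrow> T \<subseteq> H"
proof -
  note NN = normal_subD[OF N]
  interpret h: group_hom G "G Mod N" "\<lambda>x. N #> x" by (rule coset_hom[OF N])
  note core = h.H.p'_core[OF finite_Mod p]
  show "normal_sub H (carrier G)" "N \<subseteq> H" "\<exists>m. card H = m * card N \<and> \<not> p dvd m"
    using preimage_normal[OF N core(1)] core(2) unfolding H_def by blast+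
  fix T m assume T: "normal_sub T (carrier G)" "N \<subseteq> T" "card T = m * card N" "\<not> p dvd m"
  have "card ((\<lambda>x. N #> x) ` T) = m"
    using card_saturated[OF NN(1) normal_subD(1)[OF T(1)] T(2)] T(3) sub_pos[OF NN(1)] by simp
  then have "(\<lambda>x. N #> x) ` T \<subseteq> p'_core p (G Mod N)"
    using core(3)[OF image_normal[OF N T(1)]] T(4) by simp
  then show "T \<subseteq> H" unfolding H_def using normal_subD(3)[OF T(1)] by blast
qed

lemma p_core_preimage:
  assumes N: "normal_sub N (carrier G)" and p: "Factorial_Ring.prime p"
  defines "H \<equiv> {x \<in> carrier G. N #> x \<in> p_core p (G Mod N)}"
  shows "normal_sub H (carrier G)" "N \<subseteq> H" "\<exists>k. card H = p ^ k * card N"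
    "\<And>T k. normal_sub T (carrier G) \<Longrightarrow> N \<subseteq> T \<Longrightarrow> card T = p ^ k * card N \<Longrightarrow> T \<subseteq> H"
proof -
  note NN = normal_subD[OF N]
  interpret h: group_hom G "G Mod N" "\<lambda>x. N #> x" by (rule coset_hom[OF N])
  note core = h.H.p_core[OF finite_Mod p]
  obtain k where k: "card (p_core p (G Mod N)) = p ^ k" using core(2) by blast
  show "normal_sub H (carrier G)" "N \<subseteq> H"
    using preimage_normal[OF N core(1)] unfolding H_def by blast+
  show "\<exists>k. card H = p ^ k * card N"
    using preimage_normal(3)[OF N core(1)] k unfolding H_def by auto
  fix T k assume T: "normal_sub T (carrier G)" "N \<subseteq> T" "card T = p ^ k * card N"
  have "card ((\<lambda>x. N #> x) ` T) = p ^ k"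
    using card_saturated[OF NN(1) normal_subD(1)[OF T(1)] T(2)] T(3) sub_pos[OF NN(1)] by simp
  then have "(\<lambda>x. N #> x) ` T \<subseteq> p_core p (G Mod N)"
    using core(3)[OF image_normal[OF N T(1)]] by simp
  then show "T \<subseteq> H" unfolding H_def using normal_subD(3)[OF T(1)] by blast
qed

lemma card_mult_sylow:
  assumes N: "normal_sub N (carrier G)" and p: "Factorial_Ring.prime p" and P: "subgroup P G" "card P = p ^ i"
  obtains k where "card (N <#> P) = p ^ k * card N"
proof -
  note NN = normal_subD[OF N]
  note Y = normal_mult_subgroup[OF N P(1) subgroup.subset[OF P(1)]]
  obtain x where x: "card (N <#> P) = x * card N" using sub_index[OF NN(1) Y(1,2)] by blast
  have "x * card (N \<inter> P) * card N = card P * card N"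
    using card_mult[OF NN(1) P(1)] x by (simp add: ac_simps)
  then have "x * card (N \<inter> P) = p ^ i" using sub_pos[OF NN(1)] P(2) by simp
  then obtain k where "x = p ^ k" using divides_primepow_nat[OF p] by (metis dvd_triv_left)
  then show thesis using that x by blast
qed

lemma upper_series_normal:
  assumes p: "Factorial_Ring.prime p"
  shows "normal_sub (upper_series p G i) (carrier G)"
proof (induction i)
  case 0
  then show ?case using normal_sub_one[OF subgroup_self] by simp
next
  case (Suc i)
  then show ?case
    using p'_core_preimage(1)[OF Suc p] p_core_preimage(1)[OF Suc p] by simp
qed

lemma upper_series_mono:
  assumes p: "Factorial_Ring.prime p"
  shows "i \<le> j \<Longrightarrow> upper_series p G i \<subseteq> upper_series p G j"
proof (rule lift_Suc_mono_le[of "upper_series p G"])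
  show "upper_series p G i \<subseteq> upper_series p G (Suc i)" for i
    using p'_core_preimage(2)[OF upper_series_normal[OF p] p, of i]
      p_core_preimage(2)[OF upper_series_normal[OF p] p, of i] by simp
qed

text \<open>Once a Sylow \<open>p\<close>-subgroup is contained in a term of the upper series, no \<open>p\<close>-factor follows.\<close>

lemma p_length_one:
  assumes p: "Factorial_Ring.prime p" "p dvd order G" and P: "is_sylow p P (carrier G)"
    and T: "normal_sub T (carrier G)" "\<not> p dvd card T" "normal_sub (T <#> P) (carrier G)"
  shows "p_length p G = 1"
proof -
  let ?U = "upper_series p G"
  have PG: "subgroup P G" "card P = p ^ multiplicity p (card (carrier G))"
    using P by (auto simp: is_sylow_def)
  have mult: "multiplicity p (card (carrier G)) > 0"
    using p fin order_gt_0_iff_finite by (auto simp: order_def prime_multiplicity_gt_zero_iff)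
  have n0: "normal_sub {\<one>} (carrier G)" by (rule normal_sub_one[OF subgroup_self])
  have U1: "?U 1 = {x \<in> carrier G. {\<one>} #> x \<in> p'_core p (G Mod {\<one>})}" by simp
  note step1 = p'_core_preimage[OF n0 p(1), folded U1]
  have N: "normal_sub (?U 1) (carrier G)" "\<not> p dvd card (?U 1)"
    using step1(1,3) by auto
  note NN = normal_subD[OF N(1)] and NT = normal_subD[OF T(1)]
  have TN: "T \<subseteq> ?U 1"
    by (rule step1(4)[OF T(1)]) (use sub_closed(2)[OF NT(1)] T(2) in auto)
  have U2: "?U 2 = {x \<in> carrier G. ?U 1 #> x \<in> p_core p (G Mod ?U 1)}"
    by (simp add: numeral_2_eq_2)
  note step2 = p_core_preimage[OF N(1) p(1), folded U2]
  have NTP: "?U 1 <#> (T <#> P) = ?U 1 <#> P"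
  proof
    note Y = normal_mult_subgroup[OF N(1) PG(1) subgroup.subset[OF PG(1)]]
    note Z = normal_mult_subgroup[OF T(1) PG(1) subgroup.subset[OF PG(1)]]
    note W = normal_mult_subgroup[OF N(1) Z(1) Z(4)]
    have "T <#> P \<subseteq> ?U 1 <#> P" using mult_sub_least[OF Y(1)] TN Y(2,3) by blast
    then show "?U 1 <#> (T <#> P) \<subseteq> ?U 1 <#> P" using mult_sub_least[OF Y(1,2)] by blast
    show "?U 1 <#> P \<subseteq> ?U 1 <#> (T <#> P)" using mult_sub_least[OF W(1,2)] W(3) Z(3) by blast
  qed
  have nNP: "normal_sub (?U 1 <#> P) (carrier G)"
    using normal_sub_mult[OF N(1) T(3)] NTP by simp
  note NP = normal_mult_subgroup[OF N(1) PG(1) subgroup.subset[OF PG(1)]]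
  obtain k where "card (?U 1 <#> P) = p ^ k * card (?U 1)"
    using card_mult_sylow[OF N(1) p(1) PG] by blast
  then have "?U 1 <#> P \<subseteq> ?U 2" using step2(4)[OF nNP NP(2)] by blast
  then have P2: "P \<subseteq> ?U 2" using NP(3) by blast
  have ne: "?U 2 \<noteq> ?U 1"
  proof
    assume "?U 2 = ?U 1"
    then have "card P dvd card (?U 1)" using sub_card_dvd[OF PG(1) NN(1)] P2 by simp
    then show False using N(2) PG(2) mult dvd_power[of "multiplicity p (card (carrier G))" p] dvd_trans
      by metis
  qed
  have later: "?U (Suc i) = ?U i" if i: "odd i" "i \<ge> 2" for i
  proof -
    have Pi: "P \<subseteq> ?U i" using P2 upper_series_mono[OF p(1) i(2)] by blast
    have nor: "normal_sub (?U i) (carrier G)" "normal_sub (?U (Suc i)) (carrier G)"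
      by (rule upper_series_normal[OF p(1)])+
    note Ni = normal_subD[OF nor(1)] and Ni' = normal_subD[OF nor(2)]
    obtain k where k: "card (?U (Suc i)) = p ^ k * card (?U i)"
      using p_core_preimage(3)[OF nor(1) p(1)] i(1) by auto
    have sub: "?U i \<subseteq> ?U (Suc i)" using upper_series_mono[OF p(1), of i "Suc i"] by simp
    have "is_sylow p P (?U (Suc i))"
      by (rule sylow_mono[OF P Ni'(1) _ Ni'(3) subgroup_self p(1)]) (use Pi sub in blast)
    then have "\<not> p dvd p ^ k" using sylow_index[OF _ Ni'(1) Ni(1) Pi k p(1)] by blast
    then have "k = 0" by (cases k) auto
    then show ?thesis using card_subset_eq[OF sub_finite[OF Ni'(1)] sub] k by simp
  qed
  have "{i. odd i \<and> ?U (Suc i) \<noteq> ?U i} = {1}"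
  proof (intro equalityI subsetI)
    fix i assume i: "i \<in> {i. odd i \<and> ?U (Suc i) \<noteq> ?U i}"
    then have "\<not> i \<ge> 2" using later by blast
    moreover have "odd i" using i by blast
    ultimately show "i \<in> {1}" by (cases i) auto
  qed (use ne in \<open>simp add: numeral_2_eq_2\<close>)
  then show ?thesis unfolding p_length_def by simp
qed

section \<open>Sylow subgroups that centralise the chief factors\<close>

lemma sub_mult_swap:
  assumes "c \<in> carrier G" "x \<in> carrier G" "conj_by x c \<otimes> inv c \<in> B" "subgroup B G"
  shows "conj_by c x \<otimes> inv x \<in> B"
proof -
  have "inv (conj_by x c \<otimes> inv c) \<in> B" using assms sub_closed(4) by blast
  then show ?thesis using assms(1,2) by (simp add: conj_by_def m_assoc inv_mult_group)
qed

text \<open>If a Sylow subgroup \<open>P\<close> centralises all \<open>p\<close>-chief factors, let \<open>D\<close> be the intersection of their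
  centralizers and \<open>T\<close> a minimal normal subgroup of \<open>G\<close> among those inside \<open>D\<close> with \<open>D/T\<close> a
  \<open>p\<close>-group. If \<open>p\<close> divided \<open>|T|\<close>, there would be a \<open>p\<close>-chief factor \<open>A/B\<close> inside \<open>T\<close> with \<open>T/A\<close> a
  \<open>p'\<close>-group. It is central in \<open>T/B\<close>, hence a direct factor \<open>A/B \<times> E/B\<close> of it, and \<open>E\<close> contradicts the
  minimality of \<open>T\<close>. So \<open>T\<close> is a \<open>p'\<close>-group, and \<open>D = T P\<close>.\<close>

lemma p'_kernel:
  assumes sol: "solvable G" and p: "Factorial_Ring.prime p" and P: "is_sylow p P (carrier G)"
    and cen: "\<And>B A k. chief (carrier G) B A \<Longrightarrow> card A = p ^ k * card B \<Longrightarrow> P \<subseteq> centralizer_mod A B"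
  obtains T where "normal_sub T (carrier G)" "\<not> p dvd card T" "normal_sub (T <#> P) (carrier G)"
proof -
  let ?Q = "\<lambda>B A. chief (carrier G) B A \<and> (\<exists>k. card A = p ^ k * card B)"
  define D where "D = {g \<in> carrier G. \<forall>B A. ?Q B A \<longrightarrow> acts_trivially g A B}"
  have PG: "subgroup P G" using P by (simp add: is_sylow_def)
  have D: "normal_sub D (carrier G)"
  proof -
    have "subgroup D G"
    proof (rule subgroup_if_closed)
      show "D \<subseteq> carrier G" by (auto simp: D_def)
      have "acts_trivially \<one> A B" if "?Q B A" for A B
        using acts_trivially_one normal_subD(1) chiefD(1,2) that by metis
      then show "\<one> \<in> D" by (simp add: D_def)
      fix x y assume xy: "x \<in> D" "y \<in> D"
      have "acts_trivially (x \<otimes> y) A B" if q: "?Q B A" for A B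
      proof -
        have ch: "chief (carrier G) B A" using q by blast
        show ?thesis
          using acts_trivially_mult[OF chiefD(1)[OF ch] normal_subD(3,1)[OF chiefD(2)[OF ch]]] xy q
          unfolding D_def by blast
      qed
      then show "x \<otimes> y \<in> D" using xy by (simp add: D_def)
    qed
    moreover have "conj_by u x \<in> D" if ux: "u \<in> carrier G" "x \<in> D" for u x
    proof -
      have "acts_trivially (conj_by u x) A B" if q: "?Q B A" for A B
      proof -
        have ch: "chief (carrier G) B A" using q by blast
        show ?thesis
          using acts_trivially_conj_by[OF chiefD(1)[OF ch] chiefD(2)[OF ch] _ ux(1)] ux(2) q
          unfolding D_def by blast
      qed
      then show ?thesis using ux by (simp add: D_def)
    qed
    ultimately show ?thesis unfolding normal_sub_def using subgroup_self by (auto simp: D_def)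
  qed
  note ND = normal_subD[OF D]
  have PD: "P \<subseteq> D"
    using cen sub_closed(1)[OF PG] unfolding D_def centralizer_mod_def by blast
  let ?S = "{T. normal_sub T (carrier G) \<and> T \<subseteq> D \<and> (\<exists>k. card D = p ^ k * card T)}"
  have fS: "finite ?S" by (rule finite_subsets) (auto dest: normal_subD(3))
  have "card D = p ^ 0 * card D" by simp
  then have "D \<in> ?S" using D by blast
  then have "?S \<noteq> {}" by blast
  from finite_has_minimal[OF fS this]
  have "\<exists>T\<in>?S. \<forall>E\<in>?S. E \<le> T \<longrightarrow> T = E" .
  then obtain T where T: "T \<in> ?S" "\<And>E. E \<in> ?S \<Longrightarrow> E \<subseteq> T \<Longrightarrow> T = E" by auto
  then obtain l where l: "card D = p ^ l * card T" by blast
  have T': "normal_sub T (carrier G)" "T \<subseteq> D" using T(1) by auto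
  note NT = normal_subD[OF T'(1)]
  have "\<not> p dvd card T"
  proof
    assume pT: "p dvd card T"
    have n1: "normal_sub {\<one>} (carrier G)" by (rule normal_sub_one[OF subgroup_self])
    have one: "{\<one>} \<subseteq> T \<and> p * card {\<one>} dvd card T" using pT sub_closed(2)[OF NT(1)] by simp
    obtain B where B: "normal_sub B (carrier G)" "B \<subseteq> T \<and> p * card B dvd card T"
      "\<And>K. normal_sub K (carrier G) \<Longrightarrow> B \<subset> K \<Longrightarrow> \<not> (K \<subseteq> T \<and> p * card K dvd card T)"
      using maximal_normal_with[OF n1, of "\<lambda>B. B \<subseteq> T \<and> p * card B dvd card T", OF one] by metis
    note NB = normal_subD[OF B(1)]
    obtain c where c: "card T = p * card B * c" using B(2) by blast
    have "B \<noteq> T"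
    proof
      assume "B = T"
      then have "card T = p * c * card T" using c by (simp add: ac_simps)
      then have "p * c = 1" using sub_pos[OF NT(1)] by simp
      then show False using p by simp
    qed
    then obtain A where A: "chief (carrier G) B A" "A \<subseteq> T"
      using chief_above[OF B(1) T'(1)] B(2) by blast
    note chA = chiefD[OF A(1)]
    note NA = normal_subD[OF chA(2)]
    obtain r k where r: "Factorial_Ring.prime r" "k > 0" "card A = r ^ k * card B"
      using chief_solvable_prime_power[OF sol A(1)] by metis
    obtain a where a: "card T = a * card A" using sub_index[OF NA(1) NT(1) A(2)] by blast
    have pa: "\<not> p dvd a"
      using B(3)[OF chA(2,3)] A(2) a by (metis mult_dvd_mono dvd_refl)
    have "a * r ^ k * card B = p * c * card B" using a c r(3) by (metis mult.assoc mult.commute)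
    then have "a * r ^ k = p * c" using sub_pos[OF NB(1)] by (simp only: mult_cancel2) simp
    then have "p dvd r ^ k" using pa p by (metis dvd_triv_left prime_dvd_mult_iff)
    then have rp: "r = p" using p r(1) prime_dvd_power primes_dvd_imp_eq by metis
    have TA: "conj_by t x \<otimes> inv x \<in> B" if "t \<in> T" "x \<in> A" for t x
    proof -
      have "?Q B A" using A(1) r(3) rp by blast
      then have "acts_trivially t A B" using that(1) T'(2) unfolding D_def by blast
      then show ?thesis using that(2) unfolding acts_trivially_def cong_mod_def by blast
    qed
    have e1: "B \<subseteq> T \<and> (\<exists>e. card B = e * card B \<and> \<not> p dvd e)"
      using B(2) p not_prime_unit by (intro conjI exI[of _ 1]) auto
    \<comment> \<open>The largest normal \<open>p'\<close>-subgroup \<open>E/B\<close> of \<open>G/B\<close> inside \<open>T/B\<close>. If \<open>A E\<close> were smaller than \<open>T\<close>,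
      a Sylow subgroup \<open>S\<close> of the next chief factor would enlarge it to \<open>E S\<close>, since \<open>A\<close> and \<open>S\<close>
      commute modulo \<open>B\<close>.\<close>
    obtain E where E: "normal_sub E (carrier G)" "E \<subseteq> T \<and> (\<exists>e. card E = e * card B \<and> \<not> p dvd e)" "B \<subseteq> E"
      "\<And>K. normal_sub K (carrier G) \<Longrightarrow> E \<subset> K \<Longrightarrow> \<not> (K \<subseteq> T \<and> (\<exists>e. card K = e * card B \<and> \<not> p dvd e))"
      using maximal_normal_with[OF B(1), of "\<lambda>E. E \<subseteq> T \<and> (\<exists>e. card E = e * card B \<and> \<not> p dvd e)", OF e1]
      by metis
    note NE = normal_subD[OF E(1)]
    obtain e where e: "card E = e * card B" "\<not> p dvd e" using E(2) by blast
    let ?AE = "A <#> E"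
    have AE: "normal_sub ?AE (carrier G)" by (rule normal_sub_mult[OF chA(2) E(1)])
    note NAE = normal_subD[OF AE]
    have AEi: "A \<subseteq> ?AE" "E \<subseteq> ?AE" using mult_sub_incl[OF NA(1) NE(1)] .
    have AET: "?AE \<subseteq> T" using mult_sub_least[OF NT(1) A(2)] E(2) by blast
    have cAE: "card ?AE = p ^ k * card E"
    proof -
      have I: "subgroup (A \<inter> E) G" by (rule sub_Int[OF NA(1) NE(1)])
      obtain x where x: "card (A \<inter> E) = x * card B"
        using sub_index[OF NB(1) I] chA(3) E(3) by blast
      obtain y where y: "card A = y * card (A \<inter> E)" using sub_index[OF I NA(1)] by blast
      obtain z where z: "card E = z * card (A \<inter> E)" using sub_index[OF I NE(1)] by blast
      have "y * x * card B = p ^ k * card B" using x y r(3) rp by (metis mult.assoc)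
      then have "y * x = p ^ k" using sub_pos[OF NB(1)] by (simp only: mult_cancel2) simp
      moreover have "z * x * card B = e * card B" using x z e(1) by (metis mult.assoc)
      then have "z * x = e" using sub_pos[OF NB(1)] by (simp only: mult_cancel2) simp
      ultimately have "x dvd p ^ k" "x dvd e" by (metis dvd_triv_right)+
      moreover have "coprime (p ^ k) e" using p e(2) by (simp add: prime_imp_coprime)
      ultimately have "x = 1" by (metis coprime_common_divisor_nat)
      then have "card ?AE * card B = p ^ k * card E * card B"
        using card_mult[OF NA(1) NE(1)] x r(3) rp by (simp add: ac_simps)
      then show ?thesis using sub_pos[OF NB(1)] by simp
    qed
    show False
    proof (cases "?AE = T")
      case True
      have "E \<in> ?S"
        using E(1,2) T'(2) l cAE True by (auto intro!: exI[of _ "l + k"] simp: power_add)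
      then have "E = T" using T(2) E(2) by blast
      then have "p ^ k * card E = 1 * card E" using cAE True by (metis mult_1)
      then have "p ^ k = 1" using sub_pos[OF NE(1)] by (simp only: mult_cancel2) simp
      then show False using r(2) p by (simp add: prime_gt_1_nat)
    next
      case False
      then obtain F where F: "chief (carrier G) ?AE F" "F \<subseteq> T"
        using chief_above[OF AE T'(1)] AET by blast
      note chF = chiefD[OF F(1)]
      note NF = normal_subD[OF chF(2)]
      obtain s j where s: "Factorial_Ring.prime s" "j > 0" "card F = s ^ j * card ?AE"
        using chief_solvable_prime_power[OF sol F(1)] by metis
      have sp: "s \<noteq> p"
      proof
        assume sp: "s = p"
        obtain f where f: "card T = f * card F" using sub_index[OF NF(1) NT(1) F(2)] by blast
        obtain y where y: "card ?AE = y * card A" using sub_index[OF NA(1) NAE(1) AEi(1)] by blast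
        have "f * s ^ j * y * card A = a * card A" using f y a s(3) by (metis mult.assoc)
        then have "f * s ^ j * y = a" using sub_pos[OF NA(1)] by (simp only: mult_cancel2) simp
        then show False using pa s(2) sp by auto
      qed
      obtain S where S: "is_sylow s S F" using sylow_ex[OF NF(1) s(1)] by blast
      have SG: "subgroup S G" "S \<subseteq> F" "card S = s ^ multiplicity s (card F)"
        using S by (auto simp: is_sylow_def)
      have AEF: "normal_sub ?AE F" using normal_sub_restrict[OF AE NF(1,3)] chF(3) by blast
      have FS: "?AE <#> S = F" by (rule sylow_mult[OF AEF s(1,3) S])
      let ?Y = "E <#> S"
      note Y = normal_mult_subgroup[OF E(1) SG(1) subgroup.subset[OF SG(1)]]
      have N: "subgroup (set_normalizer ?Y) G" by (rule set_normalizer_subgroup[OF Y(4)])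
      have YN: "?Y \<subseteq> set_normalizer ?Y"
        using sub_conj_by[OF Y(1)] Y(4) unfolding set_normalizer_iff[OF Y(4)] subset_iff by blast
      have AN: "A \<subseteq> set_normalizer ?Y"
      proof
        fix x assume x: "x \<in> A"
        have xG: "x \<in> carrier G" using x NA(3) by blast
        have "conj_by x y \<in> ?Y" if y: "y \<in> ?Y" for y
        proof -
          obtain u z where uz: "u \<in> E" "z \<in> S" "y = u \<otimes> z" using y set_mult_iff[of y E S] by blast
          have mem: "u \<in> carrier G" "z \<in> carrier G" using uz NE(3) sub_closed(1)[OF SG(1)] by auto
          have "conj_by z x \<otimes> inv x \<in> B" using TA uz(2) SG(2) F(2) x by blast
          then have "conj_by x z \<otimes> inv z \<in> ?Y"
            using sub_mult_swap[OF xG mem(2) _ NB(1)] E(3) Y(2) by blast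
          moreover have "z \<in> ?Y" using uz(2) Y(3) by blast
          ultimately have "conj_by x z \<otimes> inv z \<otimes> z \<in> ?Y" using sub_closed(3)[OF Y(1)] by blast
          then have "conj_by x z \<in> ?Y" using xG mem by (simp add: m_assoc)
          moreover have "conj_by x u \<in> ?Y" using NE(4)[OF xG uz(1)] Y(2) by blast
          ultimately have "conj_by x u \<otimes> conj_by x z \<in> ?Y" using sub_closed(3)[OF Y(1)] by blast
          then show ?thesis using uz(3) xG mem by (simp add: conj_by_mult)
        qed
        then show "x \<in> set_normalizer ?Y" using xG by (simp add: set_normalizer_iff[OF Y(4)])
      qed
      have "E \<subseteq> set_normalizer ?Y" using YN Y(2) by blast
      then have "?AE \<subseteq> set_normalizer ?Y" by (rule mult_sub_least[OF N AN])
      moreover have "S \<subseteq> set_normalizer ?Y" using YN Y(3) by blast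
      ultimately have FN: "F \<subseteq> set_normalizer ?Y" using mult_sub_least[OF N] FS by blast
      have nY: "normal_sub ?Y (carrier G)"
      proof -
        have "conj_by g ` ?Y = ?Y" if g: "g \<in> carrier G" for g
        proof -
          obtain f where f: "f \<in> F" "conj_by g ` S = conj_by f ` S"
            using frattini[OF chF(2) S s(1) g] by blast
          have "conj_by g ` ?Y = conj_by f ` ?Y"
            using conj_by_mult_image[OF E(1) SG(1)] g f NF(3) by (simp add: subset_iff)
          then show ?thesis using f(1) FN by (auto simp: set_normalizer_def)
        qed
        then show ?thesis unfolding normal_sub_def using Y(1,4) subgroup_self by blast
      qed
      have YT: "?Y \<subseteq> T" using mult_sub_least[OF NT(1)] E(2) SG(2) F(2) by (meson subset_trans)
      have "?Y \<noteq> E"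
      proof
        assume "?Y = E"
        then have "S \<subseteq> ?AE" using Y(3) AEi(2) by blast
        then show False using sylow_index[OF S NF(1) NAE(1) _ s(3,1)] s(2) by simp
      qed
      then have "\<not> (\<exists>e. card ?Y = e * card B \<and> \<not> p dvd e)" using E(4)[OF nY] YT Y(2) by blast
      moreover obtain i where "card ?Y = s ^ i * card E"
        using card_mult_sylow[OF E(1) s(1) SG(1,3)] by blast
      then have "card ?Y = s ^ i * e * card B" using e(1) by simp
      moreover have "\<not> p dvd s ^ i * e"
        using e(2) sp p s(1) prime_dvd_mult_iff prime_dvd_power primes_dvd_imp_eq by metis
      ultimately show False by blast
    qed
  qed
  moreover have "T <#> P = D"
  proof (rule sylow_mult[OF _ p l])
    show "normal_sub T D" by (rule normal_sub_restrict[OF T'(1) ND(1,3) T'(2)])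
    show "is_sylow p P D" by (rule sylow_mono[OF P ND(1) PD ND(3) subgroup_self p])
  qed
  ultimately show thesis using that[OF T'(1)] D by simp
qed

text \<open>The \<open>G\<close>-conjugates of a Sylow subgroup of \<open>V\<close> are its \<open>V\<close>-conjugates.\<close>

lemma normal_of_frattini:
  assumes C: "normal_sub C (carrier G)" and V: "normal_sub V (carrier G)" and S: "is_sylow s S V" "Factorial_Ring.prime s"
    and n: "\<And>v y. v \<in> V \<Longrightarrow> y \<in> C <#> S \<Longrightarrow> conj_by v y \<in> C <#> S"
  shows "normal_sub (C <#> S) (carrier G)"
proof -
  have SG: "subgroup S G" using S by (simp add: is_sylow_def)
  note Y = normal_mult_subgroup[OF C SG subgroup.subset[OF SG]]
  have "conj_by g y \<in> C <#> S" if g: "g \<in> carrier G" "y \<in> C <#> S" for g y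
  proof -
    obtain v where v: "v \<in> V" "conj_by g ` S = conj_by v ` S"
      using frattini[OF V S g(1)] by blast
    have "conj_by g ` (C <#> S) = conj_by v ` (C <#> S)"
      using conj_by_mult_image[OF C SG] g(1) v normal_subD(3)[OF V] by (simp add: subset_iff)
    then have "conj_by g y \<in> conj_by v ` (C <#> S)" using g(2) by (metis imageI)
    then show ?thesis using n[OF v(1)] by (auto elim!: imageE)
  qed
  then show ?thesis unfolding normal_sub_def using Y(1,4) subgroup_self by simp
qed

text \<open>The Frattini argument for \<open>N' = N S\<close>; the factor \<open>S\<close> is absorbed by the normalizer.\<close>

lemma frattini_supplement:
  assumes "normal_sub N (carrier G)" "is_sylow s S N'" "normal_sub N' (carrier G)" "N' = N <#> S" "Factorial_Ring.prime s"
  shows "N <#> set_normalizer S = carrier G"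
proof -
  note NN = normal_subD[OF assms(1)]
  have SG: "subgroup S G" using assms(2) by (simp add: is_sylow_def)
  have Sc: "S \<subseteq> carrier G" using subgroup.subset[OF SG] .
  have nS: "subgroup (set_normalizer S) G" by (rule set_normalizer_subgroup[OF Sc])
  have "carrier G \<subseteq> N <#> set_normalizer S"
  proof
    fix g assume g: "g \<in> carrier G"
    obtain u where u: "u \<in> N'" "conj_by g ` S = conj_by u ` S"
      using frattini[OF assms(3,2,5) g] by blast
    obtain x y where xy: "x \<in> N" "y \<in> S" "u = x \<otimes> y"
      using u(1) assms(4) set_mult_iff[of u N S] by blast
    have mem: "x \<in> carrier G" "y \<in> carrier G" using xy NN(3) Sc by auto
    have "y \<in> set_normalizer S"
      using xy(2) mem sub_conj_by[OF SG] set_normalizer_iff[OF Sc] by blast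
    then have yS: "conj_by y ` S = S" by (simp add: set_normalizer_def)
    have "conj_by u ` S = conj_by x ` conj_by y ` S"
      unfolding image_image xy(3) using mem Sc by (intro image_cong) (auto simp: conj_by_conj_by)
    then have gx: "conj_by g ` S = conj_by x ` S" using yS u(2) by simp
    have "conj_by (inv x \<otimes> g) ` S = conj_by (inv x) ` conj_by g ` S"
      unfolding image_image using mem g Sc by (intro image_cong) (auto simp: conj_by_conj_by)
    also have "\<dots> = (\<lambda>z. z) ` S"
      unfolding gx image_image using mem Sc by (intro image_cong) auto
    finally have "inv x \<otimes> g \<in> set_normalizer S" using mem g by (simp add: set_normalizer_def)
    moreover have "g = x \<otimes> (inv x \<otimes> g)" using mem g by simp
    ultimately show "g \<in> N <#> set_normalizer S" using xy(1) set_mult_iff by blast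
  qed
  then show ?thesis
    using mult_sub_least[OF subgroup_self NN(3) subgroup.subset[OF nS]] by blast
qed

section \<open>Critical groups\<close>

text \<open>Let \<open>C\<close> be the centralizer of the chief factor and \<open>V/C\<close> a maximal normal subgroup of \<open>G/C\<close>.
  The proper subgroup \<open>V\<close> is supersolvable, so \<open>V/C\<close> is a \<open>p'\<close>-group of exponent dividing \<open>p - 1\<close>.
  If \<open>G/V\<close> is a \<open>p\<close>-group and \<open>C\<close> has a proper supplement \<open>Y\<close>, then \<open>Y\<close> is supersolvable as well and
  its \<open>p\<close>-elements centralise \<open>V/C\<close>, because they act trivially on sections of prime order \<open>r < p\<close>. So
  \<open>C S\<close> is normal in \<open>G\<close> for a Sylow \<open>p\<close>-subgroup \<open>S\<close> of \<open>Y\<close>, and \<open>O\<^bsub>p\<^esub>(G/C) = 1\<close> gives \<open>S \<le> C\<close> and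
  \<open>G = V S = V\<close>, a contradiction. If \<open>C\<close> has no proper supplement, the Sylow subgroups of \<open>V\<close> for
  primes other than \<open>p\<close> are normal in \<open>G\<close> by the Frattini argument and hence centralise \<open>K/L\<close>. Then
  \<open>V = C\<close> and \<open>G/C\<close> is a \<open>p\<close>-group, which is again impossible.\<close>

lemma critical_p_centralises:
  assumes sol: "solvable G" and crit: "critical supersolvable G" and p: "Factorial_Ring.prime p"
    and P: "is_sylow p P (carrier G)" and ch: "chief (carrier G) L K" and k: "card K = p ^ k * card L"
  shows "P \<subseteq> centralizer_mod K L"
proof (cases "centralizer_mod K L = carrier G")
  case True
  then show ?thesis using P by (simp add: is_sylow_def)
next
  case False
  have ss: "supersolvable (G\<lparr>carrier := H\<rparr>)" if "subgroup H G" "H \<noteq> carrier G" for H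
    using crit that unfolding critical_def by blast
  let ?C = "centralizer_mod K L"
  note chD = chiefD[OF ch]
  have LK: "L \<subseteq> K" using chD(3) by blast
  note NL = normal_subD[OF chD(1)] and NK = normal_subD[OF chD(2)]
  have C: "normal_sub ?C (carrier G)" by (rule normal_sub_centralizer[OF chD(1,2)])
  note NC = normal_subD[OF C]
  obtain V where V: "normal_sub V (carrier G)" "V \<noteq> carrier G" "?C \<subseteq> V"
    "\<And>Y. normal_sub Y (carrier G) \<Longrightarrow> V \<subset> Y \<Longrightarrow> \<not> Y \<noteq> carrier G"
    using maximal_normal_with[OF C, of "\<lambda>V. V \<noteq> carrier G", OF False] by metis
  note NV = normal_subD[OF V(1)]
  have "chief (carrier G) V (carrier G)"
    unfolding chief_def using V normal_sub_self[OF subgroup_self] NV(3) by blast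
  then obtain t l where t: "Factorial_Ring.prime t" "card (carrier G) = t ^ l * card V"
    using chief_solvable_prime_power[OF sol] by metis
  have ssV: "supersolvable (G\<lparr>carrier := V\<rparr>)" using ss[OF NV(1) V(2)] .
  have KC: "K \<subseteq> ?C"
  proof
    fix x assume x: "x \<in> K"
    have xG: "x \<in> carrier G" using x NK(3) by blast
    have "cong_mod L (conj_by x a) a" if "a \<in> K" for a
      using chief_solvable_abelian[OF sol ch x that] central_mod_iff[OF chD(1) xG] that NK(3)
      by blast
    then show "x \<in> ?C" using xG by (simp add: centralizer_mod_def acts_trivially_def)
  qed
  have cov: "K \<subseteq> L <#> (K \<inter> V)"
    using mult_sub_incl[OF NL(1) NK(1)] KC V(3) by (metis Int_absorb2 subset_trans)
  have CV: "normal_sub ?C V" by (rule normal_sub_restrict[OF C NV(1,3) V(3)])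
  obtain Q where Q: "is_sylow p Q V" using sylow_ex[OF NV(1) p] by blast
  have QG: "subgroup Q G" "Q \<subseteq> V" "card Q = p ^ multiplicity p (card V)"
    using Q by (auto simp: is_sylow_def)
  have "normal_sub (?C <#> Q) (carrier G)"
    by (rule normal_of_frattini[OF C V(1) Q p sylow_times_centralizer_normalised[OF chD(1,2) LK p k NV(1) ssV cov Q]])
  then have QC: "Q \<subseteq> ?C" by (rule sylow_in_centralizer[OF ch p k QG(1,3)])
  obtain n where n: "card V = n * card ?C" using sub_index[OF NC(1) NV(1) V(3)] by blast
  have pn: "\<not> p dvd n" by (rule sylow_index[OF Q NV(1) NC(1) QC n p])
  note act = comm_in_centralizer[OF chD(1,2) LK p k NV(1) ssV cov NV(1) V(3) order_refl n pn]
  show ?thesis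
  proof (cases "t = p")
    case False
    have "\<not> p dvd t ^ l"
      using False p t(1) prime_dvd_power primes_dvd_imp_eq by metis
    then have Q': "is_sylow p Q (carrier G)"
      using sylow_of_index[OF NV(1) _ _ p Q, of "t ^ l"] t(2) by (simp add: order_def)
    obtain g where g: "g \<in> carrier G" "P = conj_by g ` Q"
      using sylow_conj_eq[OF subgroup_self Q' P p] by blast
    show ?thesis using NC(4)[OF g(1)] QC g(2) by blast
  next
    case tp: True
    show ?thesis
    proof (cases "\<exists>Y. subgroup Y G \<and> Y \<noteq> carrier G \<and> ?C <#> Y = carrier G")
      case True
      then obtain Y where Y: "subgroup Y G" "Y \<noteq> carrier G" "?C <#> Y = carrier G" by blast
      have Yc: "Y \<subseteq> carrier G" using subgroup.subset[OF Y(1)] .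
      have ssY: "supersolvable (G\<lparr>carrier := Y\<rparr>)" using ss[OF Y(1,2)] .
      have VY: "normal_sub (V \<inter> Y) Y" "normal_sub (?C \<inter> Y) Y"
        using normal_sub_Int[OF V(1) Y(1) Yc] normal_sub_Int[OF C Y(1) Yc] .
      obtain S where S: "is_sylow p S Y" using sylow_ex[OF Y(1) p] by blast
      have SG: "subgroup S G" "S \<subseteq> Y" "card S = p ^ multiplicity p (card Y)"
        using S by (auto simp: is_sylow_def)
      note cS = sub_closed[OF SG(1)]
      have covV: "V \<subseteq> ?C <#> (V \<inter> Y)"
      proof
        fix v assume v: "v \<in> V"
        obtain c x where cx: "c \<in> ?C" "x \<in> Y" "v = c \<otimes> x"
          using v NV(3) Y(3) set_mult_iff[of v ?C Y] by blast
        have mem: "c \<in> carrier G" "x \<in> carrier G" "inv c \<in> V"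
          using cx NC(3) Yc V(3) sub_closed(4)[OF NV(1)] by auto
        have "x = inv c \<otimes> v" using cx mem by simp
        then have "x \<in> V" using sub_closed(3)[OF NV(1) mem(3) v] by simp
        then show "v \<in> ?C <#> (V \<inter> Y)" using cx set_mult_iff[of v ?C "V \<inter> Y"] by blast
      qed
      have Sc: "x \<in> centralizer_mod V ?C" if x: "x \<in> S" for x
      proof (rule chain_stabilizer_coprime[OF C V(1) V(3) Y(1) covV n])
        have xY: "x \<in> Y" using x SG(2) by blast
        have xS: "x [^] card S = \<one>" by (rule pow_card[OF SG(1) x])
        show "x [^] card S \<in> centralizer_mod V ?C"
          using xS sub_closed(2)[OF normal_subD(1)[OF normal_sub_centralizer[OF C V(1)]]] by simp
        show "coprime (card S) n" unfolding SG(3) using p pn by (simp add: prime_imp_coprime)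
        have "acts_trivially x A B" if q: "chief Y B A" "?C \<inter> Y \<subseteq> B" "A \<subseteq> V \<inter> Y" for A B
        proof -
          note q' = chiefD[OF q(1)]
          note NA = normal_subD[OF q'(2)] and NB = normal_subD[OF q'(1)]
          obtain r where r: "Factorial_Ring.prime r" "card A = r * card B"
            using supersolvable_chief_prime[OF Y(1) ssY Y(1) order_refl q(1)] by metis
          obtain y where y: "y \<in> A" "y \<notin> B" using q'(3) by blast
          have "y [^] (p - 1) \<in> ?C" using act(2) y(1) q(3) by blast
          moreover have "y [^] (p - 1) \<in> Y" using y(1) q(3) sub_closed(5)[OF Y(1)] by blast
          ultimately have "y [^] (p - 1) \<in> B" using q(2) by blast
          then have "r dvd p - 1"
            using prime_factor_adjoin(3)[OF q'(1) NA(1) _ NA(3) r y] q'(3) by blast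
          \<comment> \<open>Thus \<open>r < p\<close>, so \<open>p\<close> does not divide the exponent \<open>r - 1\<close>.\<close>
          then have "r \<le> p - 1" using p prime_gt_1_nat by (intro dvd_imp_le) auto
          then have "\<not> p dvd r - 1"
            using prime_gt_1_nat[OF r(1)] prime_gt_1_nat[OF p] by (auto dest!: dvd_imp_le)
          then have cop: "coprime (card S) (r - 1)"
            unfolding SG(3) using p by (simp add: prime_imp_coprime)
          let ?Z = "{u \<in> Y. acts_trivially u A B}"
          have "subgroup ?Z G"
          proof (rule subgroup_if_closed)
            show "?Z \<subseteq> carrier G" using Yc by blast
            show "\<one> \<in> ?Z" using sub_closed(2)[OF Y(1)] acts_trivially_one[OF NB(1) NA(1)] by simp
            show "u \<otimes> v \<in> ?Z" if "u \<in> ?Z" "v \<in> ?Z" for u v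
              using that acts_trivially_mult[OF q'(1) NA(3,1)] sub_closed(3)[OF Y(1)] by simp
          qed
          moreover have "x [^] (r - 1) \<in> ?Z"
            using prime_factor_exp[OF q'(1,2,3) r xY] sub_closed(5)[OF Y(1) xY] by simp
          moreover have "x [^] card S \<in> ?Z"
            using xS sub_closed(2)[OF Y(1)] acts_trivially_one[OF NB(1) NA(1)] by simp
          ultimately show ?thesis
            using coprime_pow_mem[OF _ _ _ _ cop, of ?Z x] cS(1)[OF x] by simp
        qed
        then show "x \<in> chain_stabilizer Y V ?C" using xY by (simp add: chain_stabilizer_def)
      qed
      have swap: "conj_by v x \<otimes> inv x \<in> ?C" if v: "v \<in> V" and x: "x \<in> S" for v x
      proof -
        have "conj_by x v \<otimes> inv v \<in> ?C"
          using Sc[OF x] v unfolding centralizer_mod_def[of V] acts_trivially_def cong_mod_def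
          by blast
        then show ?thesis
          using sub_mult_swap[OF _ cS(1)[OF x] _ NC(1)] v NV(3) by blast
      qed
      \<comment> \<open>The Sylow subgroup \<open>S\<close> supplements \<open>V\<close> in \<open>G\<close>, so \<open>C S\<close> is normal.\<close>
      have VYG: "V <#> Y = carrier G"
        using Y(3) V(3) normal_mult_subgroup[OF V(1) Y(1) Yc]
          mult_sub_least[OF normal_mult_subgroup(1)[OF V(1) Y(1) Yc], of ?C Y] by blast
      have VYs: "subgroup (V \<inter> Y) G" using normal_subD(1)[OF VY(1)] .
      have "card (carrier G) * card (V \<inter> Y) = card V * card Y"
        using card_mult[OF NV(1) Y(1)] VYG by simp
      then have "card V * (p ^ l * card (V \<inter> Y)) = card V * card Y"
        using t(2) tp by (simp add: ac_simps)
      then have "card Y = p ^ l * card (V \<inter> Y)"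
        using sub_pos[OF NV(1)] by (simp only: mult_cancel1) simp
      then have VS: "(V \<inter> Y) <#> S = Y" by (rule sylow_mult[OF VY(1) p _ S])
      have gen: "\<exists>v\<in>V. \<exists>x\<in>S. g = v \<otimes> x" if g: "g \<in> carrier G" for g
      proof -
        obtain c y where cy: "c \<in> ?C" "y \<in> Y" "g = c \<otimes> y"
          using g Y(3) set_mult_iff[of g ?C Y] by blast
        obtain v x where vx: "v \<in> V \<inter> Y" "x \<in> S" "y = v \<otimes> x"
          using cy(2) VS set_mult_iff[of y "V \<inter> Y" S] by blast
        have "g = (c \<otimes> v) \<otimes> x"
          using cy vx NC(3) NV(3) cS(1) by (simp add: m_assoc subset_iff)
        moreover have "c \<otimes> v \<in> V" using cy(1) vx(1) V(3) sub_closed(3)[OF NV(1)] by blast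
        ultimately show ?thesis using vx(2) by blast
      qed
      note CS = normal_mult_subgroup[OF C SG(1) subgroup.subset[OF SG(1)]]
      have "conj_by g y \<in> ?C <#> S" if g: "g \<in> carrier G" and y: "y \<in> ?C <#> S" for g y
      proof -
        obtain v x where vx: "v \<in> V" "x \<in> S" "g = v \<otimes> x" using gen[OF g] by blast
        obtain c z where cz: "c \<in> ?C" "z \<in> S" "y = c \<otimes> z" using y set_mult_iff[of y ?C S] by blast
        have mem: "v \<in> carrier G" "x \<in> carrier G" "c \<in> carrier G" "z \<in> carrier G"
          using vx cz NV(3) NC(3) cS(1) by auto
        have xz: "conj_by x z \<in> S" by (rule sub_conj_by[OF SG(1) vx(2) cz(2)])
        have "conj_by v (conj_by x z) \<otimes> inv (conj_by x z) \<in> ?C <#> S"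
          using swap[OF vx(1) xz] CS(2) by blast
        then have "conj_by v (conj_by x z) \<otimes> inv (conj_by x z) \<otimes> conj_by x z \<in> ?C <#> S"
          using sub_closed(3)[OF CS(1)] CS(3) xz by blast
        then have "conj_by v (conj_by x z) \<in> ?C <#> S" using mem by (simp add: m_assoc)
        moreover have "conj_by g c \<in> ?C <#> S" using NC(4)[OF g cz(1)] CS(2) by blast
        ultimately have "conj_by g c \<otimes> conj_by v (conj_by x z) \<in> ?C <#> S"
          using sub_closed(3)[OF CS(1)] by blast
        then show ?thesis using cz(3) vx(3) mem g by (simp add: conj_by_mult conj_by_conj_by)
      qed
      then have "normal_sub (?C <#> S) (carrier G)"
        unfolding normal_sub_def using CS(1,4) subgroup_self by simp
      then have "S \<subseteq> ?C" by (rule sylow_in_centralizer[OF ch p k SG(1,3)])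
      then have "carrier G \<subseteq> V" using gen V(3) sub_closed(3)[OF NV(1)] by blast
      then show ?thesis using V(2) NV(3) by blast
    next
      case no_suppl: False
      have "?C = V"
      proof (rule sub_eq_if_sylow[OF NV(1) NC(1) V(3)])
        fix s :: nat assume s: "Factorial_Ring.prime s"
        show "\<exists>S. is_sylow s S V \<and> S \<subseteq> ?C"
        proof (cases "s = p")
          case True
          then show ?thesis using Q QC by blast
        next
          case sp: False
          obtain S where S: "is_sylow s S V" using sylow_ex[OF NV(1) s] by blast
          have SG: "subgroup S G" "S \<subseteq> V" "card S = s ^ multiplicity s (card V)"
            using S by (auto simp: is_sylow_def)
          note cS = sub_closed[OF SG(1)]
          have Sc: "S \<subseteq> carrier G" using cS(1) by blast
          note CS = normal_mult_subgroup[OF C SG(1) Sc]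
          have nCS: "normal_sub (?C <#> S) (carrier G)"
          proof (rule normal_of_frattini[OF C V(1) S s])
            fix v y assume v: "v \<in> V" and y: "y \<in> ?C <#> S"
            obtain c z where cz: "c \<in> ?C" "z \<in> S" "y = c \<otimes> z"
              using y set_mult_iff[of y ?C S] by blast
            have mem: "v \<in> carrier G" "c \<in> carrier G" "z \<in> carrier G"
              using v cz NV(3) NC(3) cS(1) by auto
            have "cong_mod ?C (v \<otimes> z) (z \<otimes> v)" using act(1)[OF v] cz(2) SG(2) by blast
            then have "conj_by v z \<otimes> inv z \<in> ?C"
              using central_mod_iff[OF C mem(1,3)] by (simp add: cong_mod_def)
            then have "conj_by v z \<otimes> inv z \<otimes> z \<in> ?C <#> S"
              using sub_closed(3)[OF CS(1)] CS(2,3) cz(2) by blast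
            then have "conj_by v z \<in> ?C <#> S" using mem by (simp add: m_assoc)
            moreover have "conj_by v c \<in> ?C <#> S" using NC(4)[OF mem(1) cz(1)] CS(2) by blast
            ultimately have "conj_by v c \<otimes> conj_by v z \<in> ?C <#> S"
              using sub_closed(3)[OF CS(1)] by blast
            then show "conj_by v y \<in> ?C <#> S" using cz(3) mem by (simp add: conj_by_mult)
          qed
          have CSV: "?C <#> S \<subseteq> V" by (rule mult_sub_least[OF NV(1) V(3) SG(2)])
          have S': "is_sylow s S (?C <#> S)" by (rule sylow_mono[OF S CS(1,3) CSV NV(1) s])
          have "?C <#> set_normalizer S = carrier G"
            by (rule frattini_supplement[OF C S' nCS refl s])
          then have "set_normalizer S = carrier G"
            using no_suppl set_normalizer_subgroup[OF Sc] by blast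
          then have nS: "conj_by g x \<in> S" if "g \<in> carrier G" "x \<in> S" for g x
            using that set_normalizer_iff[OF Sc, of g] by blast
          have "x \<in> ?C" if x: "x \<in> S" for x
          proof -
            have xG: "x \<in> carrier G" using cS(1)[OF x] .
            have "conj_by x a \<otimes> inv a \<in> L" if a: "a \<in> K" for a
            proof (rule coprime_pow_mem[OF NL(1)])
              have aG: "a \<in> carrier G" using a NK(3) by blast
              let ?y = "conj_by x a \<otimes> inv a"
              show "?y \<in> carrier G" using xG aG by simp
              have "conj_by a x \<otimes> inv x \<in> S" using nS[OF aG x] cS(3,4) x by blast
              then have yS: "?y \<in> S" using sub_mult_swap[OF xG aG _ SG(1)] by blast
              then show "?y [^] card S \<in> L" using pow_card[OF SG(1)] sub_closed(2)[OF NL(1)] by simp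
              have "?y \<in> K" using NK(4)[OF xG a] a sub_closed(3,4)[OF NK(1)] by blast
              then show "?y [^] (p ^ k) \<in> L"
                by (rule index_pow_mem[OF chD(1) NK(1) LK NK(3) _ k])
              show "coprime (card S) (p ^ k)"
                unfolding SG(3) using primes_coprime[OF s p sp] by simp
            qed
            then show ?thesis
              using xG by (simp add: centralizer_mod_def acts_trivially_def cong_mod_def)
          qed
          then show ?thesis using S by blast
        qed
      qed
      then have "carrier G = ?C"
        using p_core_mod_centralizer[OF ch p k normal_sub_self[OF subgroup_self] NC(3), of l] t(2) tp
        by simp
      then show ?thesis using False by simp
    qed
  qed
qed

section \<open>Prime divisors of the order\<close>

lemma prime_index_family:
  assumes sol: "solvable G" and f: "\<And>i. i < (n::nat) \<Longrightarrow> Factorial_Ring.prime (f i)" "\<And>i. i < n \<Longrightarrow> f i dvd order G"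
      "inj_on f {..<n}"
  obtains U m k where "\<And>i. i < n \<Longrightarrow> subgroup (U i) G" "\<And>i. i < n \<Longrightarrow> U i \<noteq> carrier G"
    "\<And>i. i < n \<Longrightarrow> order G = m i * card (U i)" "\<And>i. i < n \<Longrightarrow> m i = f i ^ k i"
    "\<And>i j. i < n \<Longrightarrow> j < n \<Longrightarrow> i \<noteq> j \<Longrightarrow> coprime (m i) (m j)"
proof -
  have "\<exists>U k. subgroup U G \<and> U \<noteq> carrier G \<and> order G = f i ^ k * card U" if i: "i < n" for i
    using prime_power_index[OF sol f(1,2)[OF i]] by metis
  then obtain U k where U: "\<And>i. i < n \<Longrightarrow> subgroup (U i) G \<and> U i \<noteq> carrier G \<and> order G = f i ^ k i * card (U i)"
    by metis
  have cop: "coprime (f i ^ k i) (f j ^ k j)" if ij: "i < n" "j < n" "i \<noteq> j" for i j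
  proof -
    have "f i \<noteq> f j" using ij f(3) by (auto dest: inj_onD)
    then have "coprime (f i) (f j)" using f(1) ij primes_coprime by blast
    then show ?thesis by simp
  qed
  show thesis
    by (rule that[of U "\<lambda>i. f i ^ k i" k]) (use U cop in auto)
qed

lemma enum_subset:
  assumes "n \<le> card A"
  obtains f :: "nat \<Rightarrow> nat" where "\<And>i. i < n \<Longrightarrow> f i \<in> A" "inj_on f {..<n}"
proof -
  obtain B where B: "B \<subseteq> A" "card B = n" "finite B"
    using obtain_subset_with_card_n[OF assms] by metis
  obtain f where "bij_betw f {0..<n} B"
    using ex_bij_betw_nat_finite[OF B(3)] B(2) by blast
  then show thesis
    using that[of f] B(1) by (auto simp: bij_betw_def lessThan_atLeast0 image_subset_iff)
qed

text \<open>The bound on the number of primes: four subgroups of index powers of primes other than \<open>p\<close>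
  would be supersolvable.\<close>

lemma semicritical_primes:
  assumes sol: "solvable G" and p: "Factorial_Ring.prime p" and semi: "U_semicritical p G"
  shows "card (primes_of G) \<le> 4"
proof (rule ccontr)
  assume "\<not> card (primes_of G) \<le> 4"
  then have "4 \<le> card (primes_of G - {p})"
    using card_Diff_singleton_if[of "primes_of G" p] by (simp split: if_splits)
  then obtain f :: "nat \<Rightarrow> nat" where f: "\<And>i. i < 4 \<Longrightarrow> f i \<in> primes_of G - {p}" "inj_on f {..<4}"
    using enum_subset by metis
  have f': "Factorial_Ring.prime (f i)" "f i dvd order G" "f i \<noteq> p" if "i < 4" for i
    using f(1)[OF that] by (auto simp: primes_of_def)
  obtain U m k where U: "\<And>i. i < (4::nat) \<Longrightarrow> subgroup (U i) G" "\<And>i. i < 4 \<Longrightarrow> U i \<noteq> carrier G"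
    "\<And>i. i < (4::nat) \<Longrightarrow> order G = m i * card (U i)" "\<And>i. i < 4 \<Longrightarrow> m i = f i ^ k i"
    "\<And>i j. i < 4 \<Longrightarrow> j < 4 \<Longrightarrow> i \<noteq> j \<Longrightarrow> coprime (m i) (m j)"
    by (rule prime_index_family[OF sol f'(1,2) f(2)]) auto
  have ssU: "supersolvable (G\<lparr>carrier := U i\<rparr>)" if i: "i < 4" for i
  proof -
    have "\<not> p dvd f i ^ k i"
      using f'(1,3)[OF i] p prime_dvd_power primes_dvd_imp_eq by metis
    moreover have "p dvd f i ^ k i * card (U i)"
      using semi U(3,4)[OF i] by (simp add: U_semicritical_def)
    ultimately have "p dvd card (U i)" using p prime_dvd_mult_iff by blast
    then show ?thesis using semi U(1,2)[OF i] by (simp add: U_semicritical_def)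
  qed
  have "supersolvable G" by (rule four_ss_supersolvable[OF sol U(1) ssU U(3,5)])
  then show False using semi by (simp add: U_semicritical_def)
qed

text \<open>So a minimal nonabelian solvable group has at most two prime divisors.\<close>

lemma three_primes_abelian:
  assumes sol: "solvable G" and c: "3 \<le> card (primes_of G)"
    and ab: "\<And>H u v. subgroup H G \<Longrightarrow> H \<noteq> carrier G \<Longrightarrow> u \<in> H \<Longrightarrow> v \<in> H \<Longrightarrow> u \<otimes> v = v \<otimes> u"
    and g: "g \<in> carrier G" "h \<in> carrier G"
  shows "g \<otimes> h = h \<otimes> g"
proof -
  obtain f :: "nat \<Rightarrow> nat" where f: "\<And>i. i < 3 \<Longrightarrow> f i \<in> primes_of G" "inj_on f {..<3}"
    using enum_subset[OF c] by metis
  have f': "Factorial_Ring.prime (f i)" "f i dvd order G" if "i < 3" for i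
    using f(1)[OF that] by (auto simp: primes_of_def)
  obtain U m k where U: "\<And>i. i < 3 \<Longrightarrow> subgroup (U i) G" "\<And>i. i < 3 \<Longrightarrow> U i \<noteq> carrier G"
    "\<And>i. i < (3::nat) \<Longrightarrow> order G = m i * card (U i)" "\<And>i. i < 3 \<Longrightarrow> m i = f i ^ k i"
    "\<And>i j. i < 3 \<Longrightarrow> j < 3 \<Longrightarrow> i \<noteq> j \<Longrightarrow> coprime (m i) (m j)"
    by (rule prime_index_family[OF sol f'(1,2) f(2)]) auto
  have one: "cong_mod {\<one>} x y \<longleftrightarrow> x = y" if "x \<in> carrier G" "y \<in> carrier G" for x y
    using that by (auto simp: cong_mod_def) (metis inv_equality inv_closed inv_inv)
  have "cong_mod {\<one>} (g \<otimes> h) (h \<otimes> g)"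
  proof (rule three_abelian[OF normal_sub_one[OF subgroup_self] U(1,3) _ U(5) g])
    fix i u v assume i: "i < (3::nat)" and uv: "u \<in> U i" "v \<in> U i"
    have "u \<otimes> v = v \<otimes> u" by (rule ab[OF U(1,2)[OF i] uv])
    then show "cong_mod {\<one>} (u \<otimes> v) (v \<otimes> u)"
      using sub_closed(1)[OF U(1)[OF i]] uv by (simp add: one)
  qed
  then show ?thesis using g one by simp
qed

text \<open>A vector that is fixed by the action generates a chief factor.\<close>

lemma chief_invariant_prime:
  assumes ch: "chief U B A" and y: "y \<in> A" "y \<notin> B" and inv: "\<And>u. u \<in> U \<Longrightarrow> cong_mod B (conj_by u y) y"
  shows "\<exists>q::nat. Factorial_Ring.prime q \<and> card A = q * card B"
proof -
  note chD = chiefD[OF ch]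
  note NA = normal_subD[OF chD(2)]
  have yU: "y \<in> U" "y \<in> carrier G" using y NA(3) sub_closed(1)[OF NA(2)] by auto
  note Y = adjoin_subgroup[OF chD(1) yU(1)]
  have "normal_sub (adjoin B y) U"
  proof (rule adjoin_normal[OF chD(1) yU(1)])
    fix u assume u: "u \<in> U"
    have "cong_mod B (conj_by u y) (y [^] (1::nat))" using inv[OF u] yU by simp
    then show "conj_by u y \<in> adjoin B y"
      unfolding adjoin_def using sub_closed(1)[OF NA(2) u] yU(2) by blast
  qed
  then have "adjoin B y = A" using chD(3) chD(4)[of "adjoin B y"] Y(2,3) Y(5)[OF NA(1) _ y(1)] y(2)
    by blast
  then have "A \<subseteq> adjoin B y" by simp
  then show ?thesis using chief_cyclic_prime[OF ch y(1)] by metis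
qed

lemma abelian_supersolvable:
  assumes U: "subgroup U G" and ab: "\<And>u v. u \<in> U \<Longrightarrow> v \<in> U \<Longrightarrow> u \<otimes> v = v \<otimes> u"
  shows "supersolvable (G\<lparr>carrier := U\<rparr>)"
proof (rule supersolvableI[OF U])
  fix A B assume ch: "chief U B A"
  note chD = chiefD[OF ch]
  obtain y where y: "y \<in> A" "y \<notin> B" using chD(3) by blast
  have yU: "y \<in> U" using y normal_subD(3)[OF chD(2)] by blast
  have "cong_mod B (conj_by u y) y" if u: "u \<in> U" for u
  proof -
    have "conj_by u y = y"
      using ab[OF u yU] sub_closed(1)[OF U] u yU by (simp add: conj_by_def m_assoc)
    then show ?thesis
      using cong_mod_refl[OF normal_subD(1)[OF chD(1)]] sub_closed(1)[OF U yU] by simp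
  qed
  then show "\<exists>q::nat. Factorial_Ring.prime q \<and> card A = q * card B"
    by (rule chief_invariant_prime[OF ch y])
qed

text \<open>A \<open>p\<close>-group has a fixed point in each of its chief factors.\<close>

lemma prime_power_supersolvable:
  assumes U: "subgroup U G" and r: "Factorial_Ring.prime r" "card U = r ^ j"
  shows "supersolvable (G\<lparr>carrier := U\<rparr>)"
proof (rule supersolvableI[OF U])
  fix A B assume ch: "chief U B A"
  note chD = chiefD[OF ch]
  note NA = normal_subD[OF chD(2)] and NB = normal_subD[OF chD(1)]
  obtain x where x: "card A = x * card B" using sub_index[OF NB(1) NA(1)] chD(3) by blast
  have "card A dvd r ^ j" using sub_card_dvd[OF NA(1) U NA(3)] r(2) by simp
  then have "x dvd r ^ j" using x by (metis dvd_mult_left)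
  then obtain k where "x = r ^ k" using divides_primepow_nat[OF r(1)] by blast
  then obtain y where "y \<in> A" "y \<notin> B" "\<And>g. g \<in> U \<Longrightarrow> cong_mod B (conj_by g y) y"
    using fixed_point_mod[OF chD(1-3) r(1) _ U order_refl r(2)] x by metis
  then show "\<exists>q::nat. Factorial_Ring.prime q \<and> card A = q * card B"
    using chief_invariant_prime[OF ch] by blast
qed

section \<open>Semicritical groups\<close>

lemma maximal_above:
  assumes "subgroup H G" "H \<noteq> carrier G"
  obtains M where "maximal_subgroup M G" "H \<subseteq> M"
proof -
  let ?S = "{M. subgroup M G \<and> M \<noteq> carrier G \<and> H \<subseteq> M}"
  have fS: "finite ?S" by (rule finite_subsets) (auto dest: subgroup.subset)
  have "?S \<noteq> {}" using assms by blast
  from finite_has_maximal[OF fS this]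
  obtain M where M: "M \<in> ?S" "\<And>K. K \<in> ?S \<Longrightarrow> M \<subseteq> K \<Longrightarrow> M = K" by auto
  have "maximal_subgroup M G"
    unfolding maximal_subgroup_def using M by auto
  then show thesis using that M(1) by blast
qed

lemma subgroup_of_sub:
  assumes "subgroup U G"
  shows "subgroup K (G\<lparr>carrier := U\<rparr>) \<longleftrightarrow> subgroup K G \<and> K \<subseteq> U"
  using incl_subgroup[OF assms, of K] subgroup_incl[OF _ assms, of K]
    subgroup.subset[of K "G\<lparr>carrier := U\<rparr>"] by auto

lemma comm_group_sub_iff:
  assumes "subgroup U G"
  shows "comm_group (G\<lparr>carrier := U\<rparr>) \<longleftrightarrow> (\<forall>u\<in>U. \<forall>v\<in>U. u \<otimes> v = v \<otimes> u)"
proof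
  assume "comm_group (G\<lparr>carrier := U\<rparr>)"
  then interpret U: comm_group "G\<lparr>carrier := U\<rparr>" .
  show "\<forall>u\<in>U. \<forall>v\<in>U. u \<otimes> v = v \<otimes> u" using U.m_comm by simp
next
  assume *: "\<forall>u\<in>U. \<forall>v\<in>U. u \<otimes> v = v \<otimes> u"
  interpret U: group "G\<lparr>carrier := U\<rparr>" by (rule subgroup_imp_group[OF assms])
  show "comm_group (G\<lparr>carrier := U\<rparr>)"
    by (rule U.group_comm_groupI) (use * in simp)
qed

lemma solvable_sub:
  assumes "solvable G" "subgroup U G"
  shows "solvable (G\<lparr>carrier := U\<rparr>)"
proof -
  interpret h: group_hom "G\<lparr>carrier := U\<rparr>" G "\<lambda>x. x"
    using subgroup_imp_group[OF assms(2)] sub_closed(1)[OF assms(2)] is_group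
    by (simp add: group_hom_def group_hom_axioms_def hom_def)
  show ?thesis by (rule h.inj_hom_imp_solvable[OF _ assms(1)]) simp
qed

lemma coprime_Int:
  assumes "subgroup A G" "subgroup B G" "coprime (card A) (card B)"
  shows "A \<inter> B = {\<one>}"
proof -
  have I: "subgroup (A \<inter> B) G" by (rule sub_Int[OF assms(1,2)])
  have "card (A \<inter> B) = 1"
    using sub_card_dvd[OF I assms(1)] sub_card_dvd[OF I assms(2)] assms(3)
    by (metis Int_lower1 Int_lower2 coprime_common_divisor_nat)
  then obtain z where "A \<inter> B = {z}" using card_1_singletonE by blast
  then show ?thesis using sub_closed(2)[OF I] by auto
qed

text \<open>Commutators of \<open>K\<close> stabilize a chief series of \<open>Q K\<close> below \<open>Q\<close>, and their orders are prime to \<open>p\<close>.\<close>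

lemma comm_centralises:
  assumes Q: "normal_sub Q (carrier G)" "card Q = p ^ k" and p: "Factorial_Ring.prime p"
    and K: "subgroup K G" "\<not> p dvd card K" and ss: "supersolvable (G\<lparr>carrier := Q <#> K\<rparr>)"
    and u: "u \<in> K" "v \<in> K"
  shows "u \<otimes> v \<otimes> inv (v \<otimes> u) \<in> centralizer_mod Q {\<one>}"
proof -
  let ?Y = "Q <#> K"
  note NQ = normal_subD[OF Q(1)]
  note Y = normal_mult_subgroup[OF Q(1) K(1) subgroup.subset[OF K(1)]]
  have one: "normal_sub {\<one>} (carrier G)" by (rule normal_sub_one[OF subgroup_self])
  let ?x = "u \<otimes> v \<otimes> inv (v \<otimes> u)"
  have xK: "?x \<in> K" using u sub_closed[OF K(1)] by simp
  show ?thesis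
  proof (rule chain_stabilizer_coprime[OF one Q(1) _ Y(1)])
    show "{\<one>} \<subseteq> Q" using sub_closed(2)[OF NQ(1)] by simp
    show "Q \<subseteq> {\<one>} <#> (Q \<inter> ?Y)"
      using mult_sub_incl(2)[OF triv_subgroup NQ(1)] Y(2) by (simp add: Int_absorb2)
    show "card Q = p ^ k * card {\<one>}" using Q(2) by simp
    show "?x \<in> chain_stabilizer ?Y Q {\<one>}"
      by (rule comm_in_stabilizer[OF Y(1) ss]) (use u Y(3) in auto)
    show "?x [^] card K \<in> centralizer_mod Q {\<one>}"
      using pow_card[OF K(1) xK] sub_closed(2)[OF normal_subD(1)[OF normal_sub_centralizer[OF one Q(1)]]]
      by simp
    have "coprime p (card K)" using p K(2) prime_imp_coprime by blast
    then show "coprime (card K) (p ^ k)" by (simp add: coprime_commute)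
  qed
qed

lemma p_part_eq:
  assumes p: "Factorial_Ring.prime p" and m: "order G = p ^ k * m" "\<not> p dvd m"
  shows "multiplicity p (order G) = k"
proof -
  have "m \<noteq> 0" using m(2) by (metis dvd_0_right)
  then show ?thesis
    using m p by (simp add: prime_elem_multiplicity_mult_distrib not_dvd_imp_multiplicity_0)
qed

text \<open>In the last two cases \<open>M\<close> is a \<open>p\<close>-complement above a proper subgroup that is not supersolvable,
  and the case distinction is by \<open>O\<^bsub>p\<^esub>(G)\<close>. Orders of supplements of \<open>M\<close> give all the statements
  about Sylow subgroups.\<close>

theorem semicritical_cases:
  assumes sol: "solvable G" and p: "Factorial_Ring.prime p" and semi: "U_semicritical p G"
  shows "p_length p G = 1 \<and>
    ( critical supersolvable G
    \<or> (p_core p G \<noteq> {\<one>} \<and> minimal_normal (p_core p G) G \<and>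
       (\<exists>M. maximal_p'_subgroup p M G \<and>
            critical supersolvable (G\<lparr>carrier := M\<rparr>) \<and>
            carrier G = p_core p G <#> M \<and>
            (p'_core p G = {\<one>} \<longrightarrow>
               critical comm_group (G\<lparr>carrier := M\<rparr>) \<and>
               p_part p G \<ge> p\<^sup>2 \<and>
               card (primes_of G) = 3)))
    \<or> (p_core p G = {\<one>} \<and> p_part p G = p \<and>
       (\<exists>P M. sylow_subgroup p P G \<and>
              maximal_p'_subgroup p M G \<and>
              \<not> supersolvable (G\<lparr>carrier := M\<rparr>) \<and>
              carrier G = P <#> M)))"
proof -
  have pG: "p dvd order G" and nss: "\<not> supersolvable G"
    and ss: "\<And>H. subgroup H G \<Longrightarrow> H \<noteq> carrier G \<Longrightarrow> p dvd card H \<Longrightarrow> supersolvable (G\<lparr>carrier := H\<rparr>)"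
    using semi unfolding U_semicritical_def by blast+
  have one: "normal_sub {\<one>} (carrier G)" by (rule normal_sub_one[OF subgroup_self])
  show ?thesis
  proof (cases "critical supersolvable G")
    case True
    obtain P where P: "is_sylow p P (carrier G)" using sylow_ex[OF subgroup_self p] by blast
    obtain T where T: "normal_sub T (carrier G)" "\<not> p dvd card T" "normal_sub (T <#> P) (carrier G)"
      by (rule p'_kernel[OF sol p P critical_p_centralises[OF sol True p P]])
    show ?thesis using p_length_one[OF p pG P T] True by blast
  next
    case False
    then obtain H where H: "subgroup H G" "H \<noteq> carrier G" "\<not> supersolvable (G\<lparr>carrier := H\<rparr>)"
      using nss is_group unfolding critical_def by blast
    obtain M where M: "maximal_subgroup M G" "H \<subseteq> M" using maximal_above[OF H(1,2)] by blast
    have MG: "subgroup M G" "M \<noteq> carrier G"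
      and mx: "\<And>K. subgroup K G \<Longrightarrow> M \<subseteq> K \<Longrightarrow> K \<noteq> M \<Longrightarrow> K = carrier G"
      using M(1) unfolding maximal_subgroup_def by blast+
    have Mc: "M \<subseteq> carrier G" using subgroup.subset[OF MG(1)] .
    have nssM: "\<not> supersolvable (G\<lparr>carrier := M\<rparr>)"
      using supersolvable_subgroup[OF MG(1) _ H(1) M(2)] H(3) by blast
    have pM: "\<not> p dvd card M" using ss[OF MG] nssM by blast
    have max': "maximal_p'_subgroup p M G" unfolding maximal_p'_subgroup_def using M(1) pM by blast
    obtain q k where qk: "Factorial_Ring.prime q" "order G = q ^ k * card M"
      using maximal_subgroup_index[OF sol M(1)] by metis
    have "p dvd q ^ k" using pG pM qk(2) p prime_dvd_mult_iff by metis
    then have qp: "q = p" using qk(1) p prime_dvd_power primes_dvd_imp_eq by metis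
    have oG: "order G = p ^ k * card M" using qk(2) qp by simp
    have mult: "multiplicity p (order G) = k" by (rule p_part_eq[OF p oG pM])
    have k0: "k \<noteq> 0" using pG pM oG by (cases k) auto
    \<comment> \<open>Every normal subgroup of order divisible by \<open>p\<close> supplements \<open>M\<close>.\<close>
    have supp: "K <#> M = carrier G" if K: "normal_sub K (carrier G)" "p dvd card K" for K
    proof -
      note Y = normal_mult_subgroup[OF K(1) MG(1) Mc]
      have "\<not> K \<subseteq> M"
        using sub_card_dvd[OF normal_subD(1)[OF K(1)] MG(1)] K(2) pM dvd_trans by blast
      then show ?thesis using mx[OF Y(1,3)] Y(2) by blast
    qed
    have card_supp: "card K * card M = p ^ k * card M * card (K \<inter> M)"
      if K: "subgroup K G" "K <#> M = carrier G" for K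
      by (rule card_mult[OF K(1) MG(1), unfolded K(2) oG[unfolded order_def], symmetric])
    let ?O = "p_core p G" and ?N = "p'_core p G"
    have core: "normal_sub ?O (carrier G)" "\<exists>j. card ?O = p ^ j"
      "\<And>N j. normal_sub N (carrier G) \<Longrightarrow> card N = p ^ j \<Longrightarrow> N \<subseteq> ?O"
      using p_core[OF fin p] normal_sub_carrier by auto
    have core': "normal_sub ?N (carrier G)" "\<not> p dvd card ?N"
      "\<And>N. normal_sub N (carrier G) \<Longrightarrow> \<not> p dvd card N \<Longrightarrow> N \<subseteq> ?N"
      using p'_core[OF fin p] normal_sub_carrier by auto
    note NO = normal_subD[OF core(1)] and NN = normal_subD[OF core'(1)]
    have p_card: "card K = p ^ k" if K: "normal_sub K (carrier G)" "card K = p ^ j" "K \<noteq> {\<one>}" for K j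
    proof -
      have K': "subgroup K G" using normal_subD(1)[OF K(1)] .
      have "j \<noteq> 0"
      proof
        assume "j = 0"
        then obtain z where "K = {z}" using K(2) card_1_singletonE by (metis power_0)
        then show False using K(3) sub_closed(2)[OF K'] by auto
      qed
      then have "K <#> M = carrier G" using supp[OF K(1)] K(2) by simp
      moreover have "coprime (card K) (card M)"
        unfolding K(2) using p pM by (simp add: prime_imp_coprime)
      then have "K \<inter> M = {\<one>}" by (rule coprime_Int[OF K' MG(1)])
      ultimately have "card K * card M = p ^ k * card M" using card_supp[OF K'] by simp
      then show ?thesis using sub_pos[OF MG(1)] by (simp only: mult_cancel2) simp
    qed
    show ?thesis
    proof (cases "?O = {\<one>}")
      case O1: False
      obtain j where "card ?O = p ^ j" using core(2) by blast
      then have cO: "card ?O = p ^ k" using p_card[OF core(1) _ O1] by blast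
      then have OM: "?O <#> M = carrier G" using supp[OF core(1)] k0 by simp
      have sylO: "is_sylow p ?O (carrier G)"
        unfolding is_sylow_def using NO cO mult by (simp add: order_def)
      have plen: "p_length p G = 1"
      proof (rule p_length_one[OF p pG sylO one])
        show "\<not> p dvd card {\<one>}" using prime_gt_1_nat[OF p] by simp
        have "{\<one>} <#> ?O = ?O"
          using mult_sub_incl[OF triv_subgroup NO(1)] mult_sub_least[OF NO(1), of "{\<one>}" ?O]
            sub_closed(2)[OF NO(1)] by blast
        then show "normal_sub ({\<one>} <#> ?O) (carrier G)" using core(1) by simp
      qed
      have minn: "minimal_normal ?O G"
        unfolding minimal_normal_def
      proof (intro conjI allI impI)
        show "?O \<lhd> G" using core(1) normal_sub_carrier by blast
        show "?O \<noteq> {\<one>}" by (rule O1)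
        fix K assume K: "K \<lhd> G \<and> K \<subseteq> ?O"
        then have K': "normal_sub K (carrier G)" using normal_sub_carrier by blast
        have "card K dvd p ^ k"
          using sub_card_dvd[OF normal_subD(1)[OF K'] NO(1)] K cO by simp
        then obtain i where "card K = p ^ i" using divides_primepow_nat[OF p] by blast
        then show "K = {\<one>} \<or> K = ?O"
          using p_card[OF K'] cO K card_subset_eq[OF sub_finite[OF NO(1)]] by metis
      qed
      have ssK: "subgroup K G" "\<not> p dvd card K" "supersolvable (G\<lparr>carrier := ?O <#> K\<rparr>)"
        "supersolvable (G\<lparr>carrier := K\<rparr>)"
        if K: "subgroup K (G\<lparr>carrier := M\<rparr>)" "K \<noteq> M" for K
      proof -
        have K': "subgroup K G" "K \<subseteq> M" using K(1) subgroup_of_sub[OF MG(1)] by auto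
        show "subgroup K G" by (rule K')
        show pK: "\<not> p dvd card K" using sub_card_dvd[OF K'(1) MG(1) K'(2)] pM dvd_trans by blast
        note Y = normal_mult_subgroup[OF core(1) K'(1) subgroup.subset[OF K'(1)]]
        have "card K < card M" using psubset_card_mono[OF sub_finite[OF MG(1)]] K'(2) K(2) by blast
        moreover have "card (?O <#> K) \<le> card ?O * card K"
          using card_mult[OF NO(1) K'(1)] sub_pos[OF sub_Int[OF NO(1) K'(1)]]
          by (metis Suc_leI mult_le_mono2 nat_mult_1_right One_nat_def)
        ultimately have "card (?O <#> K) < card (carrier G)"
          using cO oG p prime_gt_0_nat
          by (metis le_less_trans mult_less_cancel1 order_def zero_less_power)
        then have "?O <#> K \<noteq> carrier G" by auto
        moreover have "p dvd card (?O <#> K)"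
          using sub_card_dvd[OF NO(1) Y(1,2)] cO k0 by (metis dvd_power dvd_trans gr0I)
        ultimately show *: "supersolvable (G\<lparr>carrier := ?O <#> K\<rparr>)" using ss[OF Y(1)] by blast
        show "supersolvable (G\<lparr>carrier := K\<rparr>)"
          by (rule supersolvable_subgroup[OF Y(1) * K'(1) Y(3)])
      qed
      have crit: "critical supersolvable (G\<lparr>carrier := M\<rparr>)"
        unfolding critical_def using subgroup_imp_group[OF MG(1)] nssM ssK(4) by simp
      have "critical comm_group (G\<lparr>carrier := M\<rparr>) \<and> p_part p G \<ge> p\<^sup>2 \<and> card (primes_of G) = 3"
        if N1: "?N = {\<one>}"
      proof -
        let ?C = "centralizer_mod ?O {\<one>}"
        have C: "normal_sub ?C (carrier G)" by (rule normal_sub_centralizer[OF one core(1)])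
        note NC = normal_subD[OF C]
        have Cc: "x \<otimes> a = a \<otimes> x" if "x \<in> ?C" "a \<in> ?O" for x a
        proof -
          have mem: "x \<in> carrier G" "a \<in> carrier G" using that NC(3) NO(3) by auto
          have "conj_by x a \<otimes> inv a \<in> {\<one>}"
            using that unfolding centralizer_mod_def acts_trivially_def cong_mod_def by blast
          then have "conj_by x a = a"
            using mem by (metis conj_by_closed inv_closed inv_equality inv_inv singletonD)
          then have "x \<otimes> a \<otimes> inv x \<otimes> x = a \<otimes> x" by (simp add: conj_by_def)
          then show ?thesis using mem by (simp add: m_assoc)
        qed
        \<comment> \<open>\<open>C\<^bsub>M\<^esub>(O\<^bsub>p\<^esub>(G))\<close> is a normal \<open>p'\<close>-subgroup, so \<open>M\<close> acts faithfully on \<open>O\<^bsub>p\<^esub>(G)\<close>.\<close>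
        have CM: "normal_sub (?C \<inter> M) (carrier G)"
        proof -
          have "conj_by g x \<in> ?C \<inter> M" if g: "g \<in> carrier G" and x: "x \<in> ?C \<inter> M" for g x
          proof -
            obtain a m where am: "a \<in> ?O" "m \<in> M" "g = a \<otimes> m"
              using g OM set_mult_iff[of g ?O M] by blast
            have mem: "a \<in> carrier G" "m \<in> carrier G" "x \<in> carrier G" using am x NO(3) Mc by auto
            have mx': "conj_by m x \<in> ?C \<inter> M"
              using x am(2) NC(4)[OF mem(2)] sub_conj_by[OF MG(1)] by blast
            then have "conj_by m x \<otimes> a = a \<otimes> conj_by m x" using Cc am(1) by blast
            then have "conj_by a (conj_by m x) = conj_by m x"
              using mem
              by (simp add: conj_by_def[of a]) (metis conj_by_closed inv_solve_right' m_closed)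
            then show ?thesis using mx' am(3) mem by (simp add: conj_by_conj_by)
          qed
          then show ?thesis
            unfolding normal_sub_def using sub_Int[OF NC(1) MG(1)] subgroup_self Mc by blast
        qed
        have "card (?C \<inter> M) dvd card M"
          using sub_card_dvd[OF sub_Int[OF NC(1) MG(1)] MG(1)] by blast
        then have "?C \<inter> M \<subseteq> {\<one>}" using core'(3)[OF CM] pM N1 dvd_trans by blast
        then have CM1: "x = \<one>" if "x \<in> ?C" "x \<in> M" for x using that by blast
        have comm: "u \<otimes> v = v \<otimes> u"
          if "u \<in> M" "v \<in> M" "u \<otimes> v \<otimes> inv (v \<otimes> u) \<in> ?C" for u v
        proof -
          have "u \<otimes> v \<otimes> inv (v \<otimes> u) \<in> M" using that(1,2) sub_closed[OF MG(1)] by simp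
          then have "u \<otimes> v \<otimes> inv (v \<otimes> u) = \<one>" using CM1 that(3) by blast
          then have "u \<otimes> v = inv (inv (v \<otimes> u))"
            using that(1,2) Mc by (intro inv_equality[symmetric]) (auto simp: subset_iff)
          then show ?thesis using that(1,2) Mc by (simp add: subset_iff)
        qed
        have nab: "\<not> (\<forall>u\<in>M. \<forall>v\<in>M. u \<otimes> v = v \<otimes> u)"
          using abelian_supersolvable[OF MG(1)] nssM by blast
        have abK: "u \<otimes> v = v \<otimes> u"
          if K: "subgroup K (G\<lparr>carrier := M\<rparr>)" "K \<noteq> M" and uv: "u \<in> K" "v \<in> K" for K u v
        proof (rule comm)
          show "u \<in> M" "v \<in> M" using uv K(1) subgroup_of_sub[OF MG(1)] by auto
          show "u \<otimes> v \<otimes> inv (v \<otimes> u) \<in> ?C"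
            by (rule comm_centralises[OF core(1) cO p ssK(1-3)[OF K] uv])
        qed
        have "critical comm_group (G\<lparr>carrier := M\<rparr>)"
          unfolding critical_def
          using subgroup_imp_group[OF MG(1)] comm_group_sub_iff[OF MG(1)] nab abK
            comm_group_sub_iff[OF ssK(1)] by simp
        moreover have "p_part p G \<ge> p\<^sup>2"
        proof -
          \<comment> \<open>On a group of order \<open>p\<close> the action would be abelian.\<close>
          have "k \<noteq> 1"
          proof
            assume "k = 1"
            then have c1: "card ?O = p * card {\<one>}" using cO by simp
            have "{\<one>} \<subset> ?O" using O1 sub_closed(2)[OF NO(1)] by blast
            then have "u \<otimes> v \<otimes> inv (v \<otimes> u) \<in> ?C" if "u \<in> carrier G" "v \<in> carrier G" for u v
              using prime_factor_comm[OF one core(1) _ p c1 that] that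
              by (simp add: centralizer_mod_def)
            then show False using nab comm Mc by blast
          qed
          then have "2 \<le> k" using k0 by simp
          then show ?thesis
            unfolding p_part_def mult using prime_gt_0_nat[OF p] by (intro power_increasing) auto
        qed
        moreover have "card (primes_of G) = 3"
        proof -
          let ?H = "G\<lparr>carrier := M\<rparr>"
          interpret M: fin_group ?H
            using subgroup_imp_group[OF MG(1)] sub_finite[OF MG(1)]
            by (simp add: fin_group_def fin_group_axioms_def)
          have fM: "finite (primes_of ?H)"
            using sub_pos[OF MG(1)] by (auto simp: primes_of_def order_def intro: finite_subset[of _ "{..card M}"] dvd_imp_le)
          have "primes_of G = insert p (primes_of ?H)"
          proof -
            have "r dvd p ^ k * card M \<longleftrightarrow> r = p \<or> r dvd card M" if r: "Factorial_Ring.prime r" for r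
              using r p k0 prime_dvd_mult_iff[OF r] prime_dvd_power_iff[OF r, of k p]
              by (auto dest: primes_dvd_imp_eq)
            then show ?thesis unfolding primes_of_def oG using p by (auto simp: order_def)
          qed
          moreover have "p \<notin> primes_of ?H" using pM by (simp add: primes_of_def order_def)
          moreover have "card (primes_of ?H) = 2"
          proof -
            have "\<not> 3 \<le> card (primes_of ?H)"
            proof
              assume 3: "3 \<le> card (primes_of ?H)"
              have "u \<otimes> v = v \<otimes> u" if "u \<in> M" "v \<in> M" for u v
                using M.three_primes_abelian[OF solvable_sub[OF sol MG(1)] 3, of u v] abK that
                by simp
              then show False using nab by blast
            qed
            moreover have "\<not> card (primes_of ?H) \<le> 1"
            proof
              assume "card (primes_of ?H) \<le> 1"
              then have eq: "r = s" if "r \<in> primes_of ?H" "s \<in> primes_of ?H" for r s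
                using that fM by (metis One_nat_def card_le_Suc0_iff_eq)
              have "\<exists>r j. Factorial_Ring.prime (r::nat) \<and> card M = r ^ j"
              proof (cases "card M = 1")
                case True
                then show ?thesis using p by (metis power_0)
              next
                case False
                then obtain r where r: "Factorial_Ring.prime r" "r dvd card M"
                  using prime_factor_nat by blast
                then have "\<And>s. Factorial_Ring.prime s \<Longrightarrow> s dvd card M \<Longrightarrow> s = r"
                  using eq[of _ r] by (simp add: primes_of_def order_def)
                then show ?thesis using prime_power_eq[OF r(1) sub_pos[OF MG(1)]] r(1) by blast
              qed
              then show False using prime_power_supersolvable[OF MG(1)] nssM by blast
            qed
            ultimately show ?thesis by linarith
          qed
          ultimately show ?thesis using fM by simp
        qed
        ultimately show ?thesis by blast
      qed
      then show ?thesis using plen O1 minn max' crit OM by blast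
    next
      case O1: True
      have Nne: "?N \<noteq> carrier G" using core'(2) pG by (auto simp: order_def)
      then obtain K where K: "chief (carrier G) ?N K"
        using chief_above[OF core'(1) normal_sub_self[OF subgroup_self]] NN(3) by blast
      note chK = chiefD[OF K]
      note NK = normal_subD[OF chK(2)]
      obtain r j where r: "Factorial_Ring.prime r" "card K = r ^ j * card ?N"
        using chief_solvable_prime_power[OF sol K] by metis
      have pK: "p dvd card K" using core'(3)[OF chK(2)] chK(3) by blast
      then have "p dvd r ^ j" using r(2) core'(2) p prime_dvd_mult_iff by metis
      then have rp: "r = p" using r(1) p prime_dvd_power primes_dvd_imp_eq by metis
      have NM: "?N \<subseteq> M"
      proof -
        note Y = normal_mult_subgroup[OF core'(1) MG(1) Mc]
        have "\<not> p dvd card (?N <#> M)"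
        proof
          assume "p dvd card (?N <#> M)"
          then have "p dvd card ?N * card M" using card_mult[OF NN(1) MG(1)] by (metis dvd_mult2)
          then show False using p core'(2) pM prime_dvd_mult_iff by blast
        qed
        then have "?N <#> M \<noteq> carrier G" using pG by (auto simp: order_def)
        then show ?thesis using mx[OF Y(1,3)] Y(2) by blast
      qed
      obtain P where P: "is_sylow p P K" using sylow_ex[OF NK(1) p] by blast
      have PG: "subgroup P G" "P \<subseteq> K" "card P = p ^ multiplicity p (card K)"
        using P by (auto simp: is_sylow_def)
      have Pc: "P \<subseteq> carrier G" using subgroup.subset[OF PG(1)] .
      \<comment> \<open>So \<open>K/N\<close> is a \<open>p\<close>-group; its order turns out to be \<open>|G|\<^bsub>p\<^esub>\<close>, because \<open>M\<close> is a \<open>p\<close>-complement.\<close>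
      have KN: "?N <#> P = K"
        by (rule sylow_mult[OF normal_sub_restrict[OF core'(1) NK(1,3)] p _ P]) (use chK(3) r(2) rp in auto)
      have "multiplicity p (card K) = k"
      proof -
        have I: "\<not> p dvd card (K \<inter> M)" "card (K \<inter> M) > 0"
          using sub_card_dvd[OF sub_Int[OF NK(1) MG(1)] MG(1)] pM dvd_trans sub_pos[OF sub_Int[OF NK(1) MG(1)]]
          by blast+
        have "card K * card M = p ^ k * card M * card (K \<inter> M)"
          by (rule card_supp[OF NK(1) supp[OF chK(2) pK]])
        then have "card M * card K = card M * (p ^ k * card (K \<inter> M))" by (simp add: ac_simps)
        then have "card K = p ^ k * card (K \<inter> M)"
          using sub_pos[OF MG(1)] by (simp only: mult_cancel1) simp
        then show ?thesis
          using I p by (simp add: prime_elem_multiplicity_mult_distrib not_dvd_imp_multiplicity_0)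
      qed
      then have cP: "card P = p ^ k" using PG(3) by simp
      have sylP: "is_sylow p P (carrier G)"
        unfolding is_sylow_def using PG(1) Pc cP mult by (simp add: order_def)
      have plen: "p_length p G = 1"
        by (rule p_length_one[OF p pG sylP core'(1,2)]) (simp add: KN chK(2))
      let ?H = "set_normalizer P"
      have NH: "?N <#> ?H = carrier G"
        by (rule frattini_supplement[OF core'(1) P chK(2) KN[symmetric] p])
      have HG: "subgroup ?H G" by (rule set_normalizer_subgroup[OF Pc])
      have PH: "normal_sub P ?H"
        unfolding normal_sub_def
        using PG(1) HG sub_conj_by[OF PG(1)] Pc set_normalizer_iff[OF Pc] by blast
      have P1: "P \<noteq> {\<one>}"
        using cP one_less_power[OF prime_gt_1_nat[OF p], of k] k0 by auto
      have "?H \<noteq> carrier G"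
      proof
        assume "?H = carrier G"
        then have "P \<subseteq> ?O" using core(3)[OF _ cP] PH by simp
        then show False using O1 P1 sub_closed(2)[OF PG(1)] by blast
      qed
      moreover have "p dvd card ?H"
        using sub_card_dvd[OF PG(1) HG normal_subD(3)[OF PH]] cP k0
        by (metis dvd_power dvd_trans gr0I)
      ultimately have ssH: "supersolvable (G\<lparr>carrier := ?H\<rparr>)" by (rule ss[OF HG])
      have "{\<one>} \<subset> P" using P1 sub_closed(2)[OF PG(1)] by blast
      then obtain A where A: "chief ?H {\<one>} A" "A \<subseteq> P"
        by (rule chief_above[OF normal_sub_one[OF HG] PH])
      note NA = normal_subD[OF chiefD(2)[OF A(1)]]
      \<comment> \<open>A minimal normal subgroup of the supersolvable group \<open>N\<^bsub>G\<^esub>(P)\<close> has prime order.\<close>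
      obtain s where s: "Factorial_Ring.prime s" "card A = s * card {\<one>}"
        using supersolvable_chief_prime[OF HG ssH HG order_refl A(1)] by metis
      have "s dvd p ^ k" using sub_card_dvd[OF NA(1) PG(1) A(2)] s(2) cP by simp
      then have "s = p" using s(1) p prime_dvd_power primes_dvd_imp_eq by metis
      then have cA: "card A = p" using s(2) by simp
      let ?Y = "?N <#> A"
      note Y = normal_mult_subgroup[OF core'(1) NA(1) subgroup.subset[OF NA(1)]]
      have "normal_sub ?Y (carrier G)"
      proof -
        have nH: "?H \<subseteq> set_normalizer ?Y"
        proof
          fix h assume h: "h \<in> ?H"
          have hG: "h \<in> carrier G" using h sub_closed(1)[OF HG] by blast
          have "conj_by h y \<in> ?Y" if y: "y \<in> ?Y" for y
          proof -
            obtain n a where na: "n \<in> ?N" "a \<in> A" "y = n \<otimes> a"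
              using y set_mult_iff[of y ?N A] by blast
            have "conj_by h n \<in> ?Y" "conj_by h a \<in> ?Y"
              using NN(4)[OF hG na(1)] NA(4)[OF h na(2)] Y(2,3) by auto
            then have "conj_by h n \<otimes> conj_by h a \<in> ?Y" by (rule sub_closed(3)[OF Y(1)])
            moreover have "n \<in> carrier G" "a \<in> carrier G"
              using na NN(3) sub_closed(1)[OF NA(1)] by auto
            ultimately show ?thesis using na(3) hG by (simp add: conj_by_mult)
          qed
          then show "h \<in> set_normalizer ?Y" using hG by (simp add: set_normalizer_iff[OF Y(4)])
        qed
        have "?N \<subseteq> set_normalizer ?Y"
          using sub_conj_by[OF Y(1)] Y(2,4) unfolding set_normalizer_iff[OF Y(4)] subset_iff
          by blast
        then have "carrier G \<subseteq> set_normalizer ?Y"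
          using mult_sub_least[OF set_normalizer_subgroup[OF Y(4)] _ nH] NH by blast
        then show ?thesis
          unfolding normal_sub_def using Y(1,4) subgroup_self set_normalizer_iff[OF Y(4)] by blast
      qed
      moreover have "p dvd card ?Y" using sub_card_dvd[OF NA(1) Y(1,3)] cA by simp
      ultimately have YM: "?Y <#> M = carrier G" by (rule supp)
      have "k = 1"
      proof -
        have "coprime (card ?N) (card A)"
          unfolding cA using p core'(2) by (simp add: prime_imp_coprime coprime_commute)
        then have "?N \<inter> A = {\<one>}" by (rule coprime_Int[OF NN(1) NA(1)])
        then have cY: "card ?Y = card ?N * p" using card_mult[OF NN(1) NA(1)] cA by simp
        obtain b where b: "card (?Y \<inter> M) = b * card ?N"
          using sub_index[OF NN(1) sub_Int[OF Y(1) MG(1)]] Y(2) NM by blast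
        have "card ?Y * card M = p ^ k * card M * card (?Y \<inter> M)" by (rule card_supp[OF Y(1) YM])
        then have "card ?N * card M * p = card ?N * card M * (p ^ k * b)"
          unfolding cY b by (simp add: ac_simps)
        then have "p = p ^ k * b"
          using sub_pos[OF NN(1)] sub_pos[OF MG(1)] by (simp only: mult_cancel1) simp
        then have "p ^ k dvd p ^ 1" by (metis dvd_triv_left power_one_right)
        then have "k \<le> 1" using p power_dvd_imp_le prime_gt_1_nat by blast
        then show ?thesis using k0 by simp
      qed
      then have pp: "p_part p G = p" unfolding p_part_def mult by simp
      have "P <#> M = carrier G"
      proof -
        have "coprime (card P) (card M)"
          unfolding cP using p pM by (simp add: prime_imp_coprime)
        then have "P \<inter> M = {\<one>}" by (rule coprime_Int[OF PG(1) MG(1)])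
        then have "card (P <#> M) = card (carrier G)"
          using card_mult[OF PG(1) MG(1)] cP oG by (simp add: order_def)
        moreover have "P <#> M \<subseteq> carrier G" by (rule mult_sub_least[OF subgroup_self Pc Mc])
        ultimately show ?thesis by (simp add: card_subset_eq[OF fin])
      qed
      moreover have "sylow_subgroup p P G"
        unfolding sylow_subgroup_def p_part_def mult using PG(1) cP by simp
      ultimately show ?thesis using plen O1 pp max' nssM by metis
    qed
  qed
qed

end

theorem theoremD:
  fixes G :: "('a, 'b) monoid_scheme" and p :: nat
  assumes "group G" and "finite (carrier G)" and "solvable G"
    and "Factorial_Ring.prime p" and "odd p"
    and "U_semicritical p G"
  shows "card (primes_of G) \<le> 4 \<and> p_length p G = 1 \<and>
    ( (critical supersolvable G \<and> p dvd order G)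
    \<or> (p_core p G \<noteq> {\<one>\<^bsub>G\<^esub>} \<and> minimal_normal (p_core p G) G \<and>
       (\<exists>M. maximal_p'_subgroup p M G \<and>
            critical supersolvable (G\<lparr>carrier := M\<rparr>) \<and>
            carrier G = p_core p G <#>\<^bsub>G\<^esub> M \<and>
            (p'_core p G = {\<one>\<^bsub>G\<^esub>} \<longrightarrow>
               critical comm_group (G\<lparr>carrier := M\<rparr>) \<and>
               p_part p G \<ge> p\<^sup>2 \<and>
               card (primes_of G) = 3)))
    \<or> (p_core p G = {\<one>\<^bsub>G\<^esub>} \<and> p_part p G = p \<and>
       (\<exists>P M. sylow_subgroup p P G \<and>
              maximal_p'_subgroup p M G \<and>
              \<not> supersolvable (G\<lparr>carrier := M\<rparr>) \<and>
              carrier G = P <#>\<^bsub>G\<^esub> M)))"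
proof -
  interpret fin_group G
    using assms by (simp add: fin_group_def fin_group_axioms_def)
  have "p dvd order G" using assms(6) by (simp add: U_semicritical_def)
  then show ?thesis
    using semicritical_primes[OF assms(3,4,6)] semicritical_cases[OF assms(3,4,6)] by blast
qed

end
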